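(* Let $d_1,d_2\ge 1$ be integers, let $s\in\overline{\mathbf R_\flat}$, and let $T$ be a linear and continuous map from $\mathcal A_0(\mathbf C^{d_1})$ to $\mathcal A_0'(\mathbf C^{d_2})$. Then the following is true: (1) if $T$ is (i.e. extends to) a linear and continuous map from $\mathcal A_s'(\mathbf C^{d_1})$ to $\mathcal A_s(\mathbf C^{d_2})$, then there is a unique $K\in\widetilde{\mathcal A}_s(\mathbf C^{d_2}\times\mathbf C^{d_1})$ such that $$TF=\big(z_2\mapsto \langle K(z_2,\cdot),F\rangle_{A^2(\mathbf C^{d_1})}\big);$$ (2) if $T$ is (i.e. extends to) a linear and continuous map from $\mathcal A_s(\mathbf C^{d_1})$ to $\mathcal A_s'(\mathbf C^{d_2})$, then there is a unique $K\in\widetilde{\mathcal A}_s'(\mathbf C^{d_2}\times\mathbf C^{d_1})$ such that the same formula for $TF$ holds. The same holds true for $s\in\mathbf R_\flat$ if $\mathcal A_s$, $\widetilde{\mathcal A}_s$, $\mathcal A_s'$ and $\widetilde{\mathcal A}_s'$ are replaced by $\mathcal A_{0,s}$, $\widetilde{\mathcal A}_{0,s}$, $\mathcal A_{0,s}'$ and $\widetilde{\mathcal A}_{0,s}'$, respectively, at each occurrence.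
   Context: Index sets: $\mathbf N=\{0,1,2,\dots\}$; $\mathbf R_\flat=\mathbf R_+\cup\{\flat_\sigma : \sigma>0\}$ with formal symbols $\flat_\sigma$, and $\overline{\mathbf R_\flat}=\mathbf R_\flat\cup\{0\}$. Sequence spaces: for $s\in\mathbf R_\flat$, $r>0$, $\alpha\in\mathbf N^n$ let $\vartheta_{r,s}(\alpha)=e^{r|\alpha|^{1/(2s)}}$ if $s\in\mathbf R_+$ and $\vartheta_{r,s}(\alpha)=r^{|\alpha|}(\alpha!)^{1/(2\sigma)}$ if $s=\flat_\sigma$. For a weight $\vartheta>0$ on $\mathbf N^n$ let $\ell^p_{[\vartheta]}(\mathbf N^n)$ be the Banach space of complex sequences $c$ with $\|c\,\vartheta\|_{\ell^p}<\infty$. Fix any $p\in[1,\infty]$ (the spaces below do not depend on it). For $s\in\mathbf R_\flat$: $\ell_{0,s}(\mathbf N^n)=\bigcap_{r>0}\ell^p_{[\vartheta_{r,s}]}(\mathbf N^n)$ and $\ell_s'(\mathbf N^n)=\bigcap_{r>0}\ell^p_{[1/\vartheta_{r,s}]}(\mathbf N^n)$ with projective limit topologies; $\ell_s(\mathbf N^n)=\bigcup_{r>0}\ell^p_{[\vartheta_{r,s}]}(\mathbf N^n)$ and $\ell_{0,s}'(\mathbf N^n)=\bigcup_{r>0}\ell^p_{[1/\vartheta_{r,s}]}(\mathbf N^n)$ with inductive limit topologies. $\ell_0'(\mathbf N^n)$ is the space of all complex sequences on $\mathbf N^n$, with the topology of the seminorms $c\mapsto\|\{c_\alpha\}_{|\alpha|\le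 N}\|_{\ell^p}$, $N\ge0$; $\ell_0(\mathbf N^n)$ is the space of finitely supported sequences with the inductive limit topology of the finite-dimensional spaces $\{c : c_\alpha=0 \text{ for } |\alpha|>N\}$. Power series spaces: $e_\alpha(z)=z^\alpha/\sqrt{\alpha!}$. The spaces $\mathcal A_{0,s}(\mathbf C^n)$, $\mathcal A_s(\mathbf C^n)$, $\mathcal A_s'(\mathbf C^n)$, $\mathcal A_{0,s}'(\mathbf C^n)$ consist of all formal power series $F=\sum_\alpha c(F,\alpha)e_\alpha$ with $\{c(F,\alpha)\}$ in $\ell_{0,s}(\mathbf N^n)$, $\ell_s(\mathbf N^n)$, $\ell_s'(\mathbf N^n)$, $\ell_{0,s}'(\mathbf N^n)$ respectively, with topologies transported from the sequence spaces. The spaces $\widetilde{\mathcal A}_{0,s},\widetilde{\mathcal A}_s,\widetilde{\mathcal A}_s',\widetilde{\mathcal A}_{0,s}'$ on $\mathbf C^{d_2}\times\mathbf C^{d_1}$ consist of all formal series $K(z_2,z_1)=\sum c_K(\alpha_2,\alpha_1)e_{\alpha_2}(z_2)e_{\alpha_1}(\overline{z_1})$, $(\alpha_2,\alpha_1)\in\mathbf N^{d_2}\times\mathbf N^{d_1}$, with $c_K$ in $\ell_{0,s},\ell_s,\ell_s',\ell_{0,s}'$ on $\mathbf N^{d_2+d_1}$, respectively. Pairing: $\langle F,G\rangle_{A^2(\mathbf C^d)}=\int_{\mathbf C^d}F(z)G(z)\,d\mu(z)$, with $d\mu(z)=\pi^{-d}e^{-|z|^2}d\lambda(z)$ and $d\lambda$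 Lebesgue measure, extended by duality. The formula $TF=(z_2\mapsto\langle K(z_2,\cdot),F\rangle_{A^2(\mathbf C^{d_1})})$ means $(TF,G)_{A^2(\mathbf C^{d_2})}=(K,G\otimes\overline F)_{A^2(\mathbf C^{d_2}\times\mathbf C^{d_1})}$ for $F\in\mathcal A_0(\mathbf C^{d_1})$, $G\in\mathcal A_0(\mathbf C^{d_2})$ (with $(\cdot,\cdot)_{A^2}$ the extension of the sesquilinear form $\int F\overline G\,d\mu$); in terms of coefficients, $c(TF,\alpha_2)=\sum_{\alpha_1}c_K(\alpha_2,\alpha_1)c(F,\alpha_1)$. *)

theory Defs
  imports "HOL-Probability.Probability"
begin

section \<open>Index sets\<close>

text \<open>
  A point of \<open>C\<^sup>d\<close> is a function \<^typ>\<open>'d \<Rightarrow> complex\<close> and a multi-index in \<open>N\<^sup>d\<close> is a function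
  \<^typ>\<open>'d \<Rightarrow> nat\<close>, where \<open>'d\<close> is a finite type with \<open>d\<close> elements. The product
  \<open>C\<^sup>d\<^sub>2 \<times> C\<^sup>d\<^sub>1\<close> is the case of the index type \<^typ>\<open>'d2 + 'd1\<close>: the pair \<open>(z\<^sub>2, z\<^sub>1)\<close> is the
  function \<open>z\<close> with \<open>z\<^sub>2 = z \<circ> Inl\<close> and \<open>z\<^sub>1 = z \<circ> Inr\<close>, and likewise for multi-indices.
\<close>

type_synonym 'd mindex = "'d \<Rightarrow> nat"

definition mdeg :: "'d::finite mindex \<Rightarrow> nat" where
  "mdeg \<alpha> = (\<Sum>i\<in>UNIV. \<alpha> i)"

definition mfact :: "'d::finite mindex \<Rightarrow> real" where
  "mfact \<alpha> = (\<Prod>i\<in>UNIV. fact (\<alpha> i))"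

text \<open>\<open>Flat \<sigma>\<close> is the formal symbol \<open>\<flat>\<^sub>\<sigma>\<close>.\<close>

datatype order_index = Real real | Flat real

definition R_flat :: "order_index set" where
  "R_flat = {Real s |s. 0 < s} \<union> {Flat \<sigma> |\<sigma>. 0 < \<sigma>}"

definition R_flat_bar :: "order_index set" where
  "R_flat_bar = insert (Real 0) R_flat"


section \<open>Projective and inductive limits of function spaces\<close>

text \<open>
  All spaces are complex vector spaces of functions \<^typ>\<open>'i \<Rightarrow> complex\<close> with pointwise operations;
  the carrier of a topology is its \<^const>\<open>topspace\<close>.
\<close>

definition seminorm_topology ::
    "('i \<Rightarrow> complex) set \<Rightarrow> (('i \<Rightarrow> complex) \<Rightarrow> real) set \<Rightarrow> ('i \<Rightarrow> complex) topology" where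
  "seminorm_topology V P = topology (\<lambda>U. U \<subseteq> V \<and>
     (\<forall>x\<in>U. \<exists>Q \<epsilon>. finite Q \<and> Q \<subseteq> P \<and> 0 < \<epsilon> \<and>
        {y \<in> V. \<forall>q\<in>Q. q (\<lambda>\<alpha>. y \<alpha> - x \<alpha>) < \<epsilon>} \<subseteq> U))"

lemma openin_seminorm_topology:
  "openin (seminorm_topology V P) U \<longleftrightarrow> U \<subseteq> V \<and>
     (\<forall>x\<in>U. \<exists>Q \<epsilon>. finite Q \<and> Q \<subseteq> P \<and> 0 < \<epsilon> \<and>
        {y \<in> V. \<forall>q\<in>Q. q (\<lambda>\<alpha>. y \<alpha> - x \<alpha>) < \<epsilon>} \<subseteq> U)"
proof -
  let ?O = "\<lambda>U. U \<subseteq> V \<and>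
     (\<forall>x\<in>U. \<exists>Q \<epsilon>. finite Q \<and> Q \<subseteq> P \<and> 0 < \<epsilon> \<and>
        {y \<in> V. \<forall>q\<in>Q. q (\<lambda>\<alpha>. y \<alpha> - x \<alpha>) < \<epsilon>} \<subseteq> U)"
  have "istopology ?O"
    unfolding istopology_def
  proof (intro conjI allI impI)
    fix A B assume A: "?O A" and B: "?O B"
    show "A \<inter> B \<subseteq> V" using A by blast
    show "\<forall>x\<in>A \<inter> B. \<exists>Q \<epsilon>. finite Q \<and> Q \<subseteq> P \<and> 0 < \<epsilon> \<and>
        {y \<in> V. \<forall>q\<in>Q. q (\<lambda>\<alpha>. y \<alpha> - x \<alpha>) < \<epsilon>} \<subseteq> A \<inter> B"
    proof
      fix x assume "x \<in> A \<inter> B"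
      then obtain Q1 e1 Q2 e2 where
        1: "finite Q1" "Q1 \<subseteq> P" "0 < e1" "{y \<in> V. \<forall>q\<in>Q1. q (\<lambda>\<alpha>. y \<alpha> - x \<alpha>) < e1} \<subseteq> A" and
        2: "finite Q2" "Q2 \<subseteq> P" "0 < e2" "{y \<in> V. \<forall>q\<in>Q2. q (\<lambda>\<alpha>. y \<alpha> - x \<alpha>) < e2} \<subseteq> B"
        using A B by (meson IntD1 IntD2)
      show "\<exists>Q \<epsilon>. finite Q \<and> Q \<subseteq> P \<and> 0 < \<epsilon> \<and>
        {y \<in> V. \<forall>q\<in>Q. q (\<lambda>\<alpha>. y \<alpha> - x \<alpha>) < \<epsilon>} \<subseteq> A \<inter> B"
        by (rule exI[of _ "Q1 \<union> Q2"], rule exI[of _ "min e1 e2"]) (use 1 2 in auto)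
    qed
  next
    fix \<U> assume *: "\<forall>A\<in>\<U>. ?O A"
    show "\<Union>\<U> \<subseteq> V" using * by blast
    show "\<forall>x\<in>\<Union>\<U>. \<exists>Q \<epsilon>. finite Q \<and> Q \<subseteq> P \<and> 0 < \<epsilon> \<and>
        {y \<in> V. \<forall>q\<in>Q. q (\<lambda>\<alpha>. y \<alpha> - x \<alpha>) < \<epsilon>} \<subseteq> \<Union>\<U>"
    proof
      fix x assume "x \<in> \<Union>\<U>"
      then obtain A where A: "A \<in> \<U>" "x \<in> A" by blast
      with * obtain Q e where
        "finite Q" "Q \<subseteq> P" "0 < e" "{y \<in> V. \<forall>q\<in>Q. q (\<lambda>\<alpha>. y \<alpha> - x \<alpha>) < e} \<subseteq> A" by meson
      with A(1) show "\<exists>Q \<epsilon>. finite Q \<and> Q \<subseteq> P \<and> 0 < \<epsilon> \<and>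
        {y \<in> V. \<forall>q\<in>Q. q (\<lambda>\<alpha>. y \<alpha> - x \<alpha>) < \<epsilon>} \<subseteq> \<Union>\<U>"
        by (meson Union_upper order_trans)
    qed
  qed
  then show ?thesis
    unfolding seminorm_topology_def by (simp add: topology_inverse')
qed

lemma topspace_seminorm_topology [simp]: "topspace (seminorm_topology V P) = V"
proof -
  have "openin (seminorm_topology V P) V"
    unfolding openin_seminorm_topology
    by (auto intro!: exI[of _ "{}"] exI[of _ "1::real"])
  then show ?thesis
    by (metis openin_seminorm_topology openin_subset openin_topspace subset_antisym)
qed

text \<open>Locally convex topologies compatible with the vector space structure, not necessarily Hausdorff.\<close>

definition locally_convex_on :: "('i \<Rightarrow> complex) set \<Rightarrow> ('i \<Rightarrow> complex) topology \<Rightarrow> bool" where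
  "locally_convex_on V Y \<longleftrightarrow> topspace Y = V \<and>
     continuous_map (prod_topology Y Y) Y (\<lambda>(x, y). \<lambda>\<alpha>. x \<alpha> + y \<alpha>) \<and>
     continuous_map (prod_topology (euclidean :: complex topology) Y) Y (\<lambda>(a, x). \<lambda>\<alpha>. a * x \<alpha>) \<and>
     (\<forall>U. openin Y U \<and> (\<lambda>_. 0) \<in> U \<longrightarrow>
        (\<exists>C. openin Y C \<and> (\<lambda>_. 0) \<in> C \<and> C \<subseteq> U \<and>
           (\<forall>x\<in>C. \<forall>y\<in>C. \<forall>t\<in>{0..1::real}.
              (\<lambda>\<alpha>. of_real (1 - t) * x \<alpha> + of_real t * y \<alpha>) \<in> C)))"

text \<open>The coarsest topology on the intersection that makes all inclusions continuous.\<close>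

definition proj_lim :: "'k set \<Rightarrow> ('k \<Rightarrow> ('i \<Rightarrow> complex) topology) \<Rightarrow> ('i \<Rightarrow> complex) topology" where
  "proj_lim I X = topology_generated_by
     {U \<inter> (\<Inter>j\<in>I. topspace (X j)) |U k. k \<in> I \<and> openin (X k) U}"

text \<open>
  The finest locally convex topology on the union that makes all inclusions continuous, i.e. the
  supremum of all such topologies.
\<close>

definition ind_lim :: "'k set \<Rightarrow> ('k \<Rightarrow> ('i \<Rightarrow> complex) topology) \<Rightarrow> ('i \<Rightarrow> complex) topology" where
  "ind_lim I X = topology_generated_by
     {U. \<exists>Y. locally_convex_on (\<Union>k\<in>I. topspace (X k)) Y \<and>
             (\<forall>k\<in>I. continuous_map (X k) Y (\<lambda>x. x)) \<and> openin Y U}"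

lemma topspace_proj_lim:
  assumes "I \<noteq> {}"
  shows "topspace (proj_lim I X) = (\<Inter>k\<in>I. topspace (X k))"
proof (rule subset_antisym)
  show "topspace (proj_lim I X) \<subseteq> (\<Inter>k\<in>I. topspace (X k))"
    unfolding proj_lim_def topology_generated_by_topspace by auto
  from assms obtain k where k: "k \<in> I" by blast
  then have "(\<Inter>j\<in>I. topspace (X j)) = topspace (X k) \<inter> (\<Inter>j\<in>I. topspace (X j))" by blast
  then show "(\<Inter>k\<in>I. topspace (X k)) \<subseteq> topspace (proj_lim I X)"
    unfolding proj_lim_def topology_generated_by_topspace
    by (intro Union_upper CollectI exI[of _ "topspace (X k)"] exI[of _ k]) (simp add: k)
qed

lemma topspace_ind_lim:
  fixes X :: "'k \<Rightarrow> ('i \<Rightarrow> complex) topology" and I :: "'k set"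
  defines "V \<equiv> (\<Union>k\<in>I. topspace (X k))"
  assumes add: "\<And>x y. x \<in> V \<Longrightarrow> y \<in> V \<Longrightarrow> (\<lambda>\<alpha>. x \<alpha> + y \<alpha>) \<in> V"
    and scale: "\<And>a x. x \<in> V \<Longrightarrow> (\<lambda>\<alpha>. a * x \<alpha>) \<in> V"
  shows "topspace (ind_lim I X) = V"
proof -
  define Y where "Y = topology (\<lambda>U. U = {} \<or> U = V)"
  have ist: "istopology (\<lambda>U. U = {} \<or> U = V)"
    unfolding istopology_def by blast
  have op: "openin Y U \<longleftrightarrow> U = {} \<or> U = V" for U
    unfolding Y_def using ist by (simp add: topology_inverse')
  have top: "topspace Y = V"
    unfolding topspace_def op by auto
  have cont: "continuous_map Z Y f" if "f \<in> topspace Z \<rightarrow> V" for Z :: "'z topology" and f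
  proof -
    have "{x \<in> topspace Z. f x \<in> V} = topspace Z" using that by blast
    then show ?thesis using that unfolding continuous_map_def top op by auto
  qed
  have "locally_convex_on V Y"
    unfolding locally_convex_on_def
  proof (intro conjI allI impI)
    show "topspace Y = V" by (rule top)
    show "continuous_map (prod_topology Y Y) Y (\<lambda>(x, y). \<lambda>\<alpha>. x \<alpha> + y \<alpha>)"
      by (rule cont) (auto simp: top add)
    show "continuous_map (prod_topology euclidean Y) Y (\<lambda>(a, x). \<lambda>\<alpha>. a * x \<alpha>)"
      by (rule cont) (auto simp: top scale)
    fix U assume U: "openin Y U \<and> (\<lambda>_. 0) \<in> U"
    then have "U = V" by (auto simp: op)
    with U show "\<exists>C. openin Y C \<and> (\<lambda>_. 0) \<in> C \<and> C \<subseteq> U \<and> (\<forall>x\<in>C. \<forall>y\<in>C. \<forall>t\<in>{0..1::real}.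
              (\<lambda>\<alpha>. of_real (1 - t) * x \<alpha> + of_real t * y \<alpha>) \<in> C)"
      by (intro exI[of _ V]) (auto intro!: add scale)
  qed
  moreover have "\<forall>k\<in>I. continuous_map (X k) Y (\<lambda>x. x)"
    by (intro ballI cont) (auto simp: V_def)
  moreover have "openin Y V" by (simp add: op)
  ultimately have "V \<subseteq> topspace (ind_lim I X)"
    unfolding ind_lim_def topology_generated_by_topspace V_def by blast
  moreover have "topspace (ind_lim I X) \<subseteq> V"
    unfolding ind_lim_def topology_generated_by_topspace V_def locally_convex_on_def
    using openin_subset by fastforce
  ultimately show ?thesis by blast
qed


section \<open>Sequence spaces\<close>

fun theta :: "real \<Rightarrow> order_index \<Rightarrow> 'd::finite mindex \<Rightarrow> real" where
  "theta r (Real s) \<alpha> = exp (r * real (mdeg \<alpha>) powr (1 / (2 * s)))"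
| "theta r (Flat \<sigma>) \<alpha> = r ^ mdeg \<alpha> * mfact \<alpha> powr (1 / (2 * \<sigma>))"

definition lp_space :: "ennreal \<Rightarrow> ('i \<Rightarrow> complex) set" where
  "lp_space p = (if p = \<infinity> then {a. bdd_above (range (\<lambda>\<alpha>. norm (a \<alpha>)))}
     else {a. (\<lambda>\<alpha>. norm (a \<alpha>) powr enn2real p) summable_on UNIV})"

definition lp_norm :: "ennreal \<Rightarrow> ('i \<Rightarrow> complex) \<Rightarrow> real" where
  "lp_norm p a = (if p = \<infinity> then (SUP \<alpha>. norm (a \<alpha>))
     else (\<Sum>\<^sub>\<infinity>\<alpha>. norm (a \<alpha>) powr enn2real p) powr (1 / enn2real p))"

text \<open>The Banach space \<open>\<ell>\<^sup>p\<^bsub>[\<theta>]\<^esub>\<close>.\<close>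

definition weighted_lp :: "ennreal \<Rightarrow> ('i \<Rightarrow> real) \<Rightarrow> ('i \<Rightarrow> complex) topology" where
  "weighted_lp p \<theta> = seminorm_topology {c. (\<lambda>\<alpha>. c \<alpha> * of_real (\<theta> \<alpha>)) \<in> lp_space p}
     {\<lambda>c. lp_norm p (\<lambda>\<alpha>. c \<alpha> * of_real (\<theta> \<alpha>))}"

text \<open>\<open>\<ell>\<^sub>0\<close> and \<open>\<ell>\<^sub>0'\<close>; the finite-dimensional steps of \<open>\<ell>\<^sub>0\<close> carry their \<open>\<ell>\<^sup>p\<close> norm.\<close>

definition ell_fin :: "ennreal \<Rightarrow> ('d::finite mindex \<Rightarrow> complex) topology" where
  "ell_fin p = ind_lim (UNIV :: nat set)
     (\<lambda>N. seminorm_topology {c. \<forall>\<alpha>. mdeg \<alpha> > N \<longrightarrow> c \<alpha> = 0} {lp_norm p})"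

definition ell_all :: "ennreal \<Rightarrow> ('d::finite mindex \<Rightarrow> complex) topology" where
  "ell_all p = seminorm_topology UNIV
     {\<lambda>c. lp_norm p (\<lambda>\<alpha>. if mdeg \<alpha> \<le> N then c \<alpha> else 0) |N. True}"

text \<open>
  In the names below, \<open>dual\<close> renders the prime and \<open>ell0\<close> the subscript \<open>0,s\<close>. The value
  \<open>s = Real 0\<close> of \<^const>\<open>R_flat_bar\<close> gives \<open>\<ell>\<^sub>0\<close> and \<open>\<ell>\<^sub>0'\<close>; the spaces with subscript \<open>0,s\<close> are only
  meant for \<open>s \<in> R_flat\<close>.
\<close>

definition ell0 :: "ennreal \<Rightarrow> order_index \<Rightarrow> ('d::finite mindex \<Rightarrow> complex) topology" where
  "ell0 p s = proj_lim {0<..} (\<lambda>r. weighted_lp p (theta r s))"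

definition ell :: "ennreal \<Rightarrow> order_index \<Rightarrow> ('d::finite mindex \<Rightarrow> complex) topology" where
  "ell p s = (if s = Real 0 then ell_fin p
     else ind_lim {0<..} (\<lambda>r. weighted_lp p (theta r s)))"

definition ell_dual :: "ennreal \<Rightarrow> order_index \<Rightarrow> ('d::finite mindex \<Rightarrow> complex) topology" where
  "ell_dual p s = (if s = Real 0 then ell_all p
     else proj_lim {0<..} (\<lambda>r. weighted_lp p (\<lambda>\<alpha>. 1 / theta r s \<alpha>)))"

definition ell0_dual :: "ennreal \<Rightarrow> order_index \<Rightarrow> ('d::finite mindex \<Rightarrow> complex) topology" where
  "ell0_dual p s = ind_lim {0<..} (\<lambda>r. weighted_lp p (\<lambda>\<alpha>. 1 / theta r s \<alpha>))"


section \<open>Power series spaces\<close>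

text \<open>
  A formal power series is given by its coefficients \<open>F \<alpha>\<close> with respect to the monomials
  \<open>z\<^sup>\<alpha>\<close> (for kernels: \<open>z\<^sub>2\<^sup>\<alpha>\<^sup>2 cnj z\<^sub>1\<^sup>\<alpha>\<^sup>1\<close>). As \<open>e\<^sub>\<alpha>(z) = z\<^sup>\<alpha> / sqrt \<alpha>!\<close>, its coefficient \<open>c(F, \<alpha>)\<close>
  with respect to \<open>e\<^sub>\<alpha>\<close> is \<open>sqrt \<alpha>!\<close> times \<open>F \<alpha>\<close>. For kernels the same formula applies, since
  \<open>\<alpha>! = \<alpha>\<^sub>2! \<alpha>\<^sub>1!\<close> for \<open>\<alpha> = (\<alpha>\<^sub>2, \<alpha>\<^sub>1)\<close>.
\<close>

type_synonym 'd series = "'d mindex \<Rightarrow> complex"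

definition e_basis :: "'d::finite mindex \<Rightarrow> ('d \<Rightarrow> complex) \<Rightarrow> complex" where
  "e_basis \<alpha> z = (\<Prod>i\<in>UNIV. z i ^ \<alpha> i) / of_real (sqrt (mfact \<alpha>))"

definition hcoeff :: "'d::finite series \<Rightarrow> 'd mindex \<Rightarrow> complex" where
  "hcoeff F \<alpha> = of_real (sqrt (mfact \<alpha>)) * F \<alpha>"

text \<open>
  Since \<^const>\<open>hcoeff\<close> is a bijection, the pullback is the space of all series whose coefficients
  lie in the given sequence space, with the transported topology.
\<close>

definition series_space :: "('d::finite mindex \<Rightarrow> complex) topology \<Rightarrow> 'd series topology" where
  "series_space L = pullback_topology UNIV hcoeff L"

definition A0 :: "ennreal \<Rightarrow> order_index \<Rightarrow> 'd::finite series topology" where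
  "A0 p s = series_space (ell0 p s)"

definition A :: "ennreal \<Rightarrow> order_index \<Rightarrow> 'd::finite series topology" where
  "A p s = series_space (ell p s)"

definition A_dual :: "ennreal \<Rightarrow> order_index \<Rightarrow> 'd::finite series topology" where
  "A_dual p s = series_space (ell_dual p s)"

definition A0_dual :: "ennreal \<Rightarrow> order_index \<Rightarrow> 'd::finite series topology" where
  "A0_dual p s = series_space (ell0_dual p s)"

abbreviation A_fin :: "ennreal \<Rightarrow> 'd::finite series topology" where
  "A_fin p \<equiv> A p (Real 0)"

abbreviation A_all :: "ennreal \<Rightarrow> 'd::finite series topology" where
  "A_all p \<equiv> A_dual p (Real 0)"

text \<open>Kernels: formal series in \<open>z\<^sub>2\<close> and the conjugate of \<open>z\<^sub>1\<close>, see \<open>kernel_upto\<close> below.\<close>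

definition A0_kernel :: "ennreal \<Rightarrow> order_index \<Rightarrow> ('d2::finite + 'd1::finite) series set" where
  "A0_kernel p s = {K. hcoeff K \<in> topspace (ell0 p s)}"

definition A_kernel :: "ennreal \<Rightarrow> order_index \<Rightarrow> ('d2::finite + 'd1::finite) series set" where
  "A_kernel p s = {K. hcoeff K \<in> topspace (ell p s)}"

definition A_dual_kernel :: "ennreal \<Rightarrow> order_index \<Rightarrow> ('d2::finite + 'd1::finite) series set" where
  "A_dual_kernel p s = {K. hcoeff K \<in> topspace (ell_dual p s)}"

definition A0_dual_kernel :: "ennreal \<Rightarrow> order_index \<Rightarrow> ('d2::finite + 'd1::finite) series set" where
  "A0_dual_kernel p s = {K. hcoeff K \<in> topspace (ell0_dual p s)}"

definition linear_continuous :: "('i \<Rightarrow> complex) topology \<Rightarrow> ('j \<Rightarrow> complex) topology \<Rightarrow>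
    (('i \<Rightarrow> complex) \<Rightarrow> ('j \<Rightarrow> complex)) \<Rightarrow> bool" where
  "linear_continuous X Y T \<longleftrightarrow> continuous_map X Y T \<and>
     (\<forall>F\<in>topspace X. \<forall>G\<in>topspace X. \<forall>a b.
        T (\<lambda>\<alpha>. a * F \<alpha> + b * G \<alpha>) = (\<lambda>\<alpha>. a * T F \<alpha> + b * T G \<alpha>))"

definition extends_to :: "ennreal \<Rightarrow> ('d1::finite series \<Rightarrow> 'd2::finite series) \<Rightarrow>
    'd1 series topology \<Rightarrow> 'd2 series topology \<Rightarrow> bool" where
  "extends_to p T X Y \<longleftrightarrow>
     (\<exists>S. linear_continuous X Y S \<and> (\<forall>F\<in>topspace (A_fin p). S F = T F))"


section \<open>The pairing and the kernel formula\<close>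

text \<open>The measure \<open>d\<mu>(z) = \<pi>\<^sup>-\<^sup>d exp (-|z|\<^sup>2) d\<lambda>(z)\<close>; \<open>d\<lambda>\<close> is Lebesgue measure as a product measure.\<close>

definition gauss :: "('d::finite \<Rightarrow> complex) measure" where
  "gauss = density (Pi\<^sub>M UNIV (\<lambda>_. lborel))
     (\<lambda>z. ennreal (exp (- (\<Sum>i\<in>UNIV. (norm (z i))\<^sup>2)) / pi ^ CARD('d)))"

text \<open>
  The form \<open>(F, G) = \<integral> F cnj G d\<mu>\<close> for a formal series \<open>F\<close> and a polynomial expression \<open>G\<close>. The
  partial sums of \<open>F\<close> of degree at most \<open>N\<close> converge to \<open>F\<close> in \<open>\<A>\<^sub>0'\<close>, so the continuous extension
  of the form in its first argument is the limit of the integrals (which are eventually constant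
  in \<open>N\<close>). Below \<open>f N\<close> is the \<open>N\<close>-th partial sum.
\<close>

definition A2_form :: "(nat \<Rightarrow> ('d::finite \<Rightarrow> complex) \<Rightarrow> complex) \<Rightarrow>
    (('d \<Rightarrow> complex) \<Rightarrow> complex) \<Rightarrow> complex" where
  "A2_form f g = lim (\<lambda>N. \<integral>z. f N z * cnj (g z) \<partial>gauss)"

definition series_upto :: "'d::finite series \<Rightarrow> nat \<Rightarrow> ('d \<Rightarrow> complex) \<Rightarrow> complex" where
  "series_upto F N z = (\<Sum>\<alpha> | mdeg \<alpha> \<le> N. hcoeff F \<alpha> * e_basis \<alpha> z)"

definition kernel_upto :: "('d2::finite + 'd1::finite) series \<Rightarrow> nat \<Rightarrow>
    ('d2 + 'd1 \<Rightarrow> complex) \<Rightarrow> complex" where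
  "kernel_upto K N z = (\<Sum>\<alpha> | mdeg \<alpha> \<le> N.
     hcoeff K \<alpha> * e_basis (\<alpha> \<circ> Inl) (z \<circ> Inl) * e_basis (\<alpha> \<circ> Inr) (cnj \<circ> (z \<circ> Inr)))"

text \<open>The polynomial function defined by a series with finitely many nonzero coefficients.\<close>

definition series_eval :: "'d::finite series \<Rightarrow> ('d \<Rightarrow> complex) \<Rightarrow> complex" where
  "series_eval F z = (\<Sum>\<alpha> | hcoeff F \<alpha> \<noteq> 0. hcoeff F \<alpha> * e_basis \<alpha> z)"

text \<open>
  \<open>T F = (z\<^sub>2 \<mapsto> \<langle>K(z\<^sub>2, \<cdot>), F\<rangle>)\<close>, that is \<open>(T F, G) = (K, G \<otimes> cnj F)\<close> for all \<open>F\<close> and \<open>G\<close> in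
  \<open>\<A>\<^sub>0\<close>, where \<open>(G \<otimes> cnj F)(z\<^sub>2, z\<^sub>1) = G(z\<^sub>2) cnj (F(z\<^sub>1))\<close>.
\<close>

definition has_kernel :: "ennreal \<Rightarrow> ('d1::finite series \<Rightarrow> 'd2::finite series) \<Rightarrow>
    ('d2 + 'd1) series \<Rightarrow> bool" where
  "has_kernel p T K \<longleftrightarrow>
     (\<forall>F\<in>topspace (A_fin p). \<forall>G\<in>topspace (A_fin p).
        A2_form (series_upto (T F)) (series_eval G) =
        A2_form (kernel_upto K) (\<lambda>z. series_eval G (z \<circ> Inl) * cnj (series_eval F (z \<circ> Inr))))"

end

theory Submission
  imports Defs "HOL-Real_Asymp.Real_Asymp"
begin

text \<open>
  The functions \<open>e\<^sub>\<alpha>\<close> are orthonormal for \<open>\<mu>\<close>, so testing the kernel formula on \<open>F = e\<^sub>\<alpha>\<close> and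
  \<open>G = e\<^sub>\<beta>\<close> forces the coefficients of \<open>K\<close> to be \<open>c(T e\<^sub>\<alpha>, \<beta>)\<close>; this gives uniqueness, and these
  coefficients do satisfy the formula by linearity. It remains to estimate them. A continuous map
  from an inductive to a projective limit restricts to bounded maps between all Banach steps,
  which bounds \<open>c(T e\<^sub>\<alpha>, \<beta>)\<close> by products of the step weights of \<open>\<alpha>\<close> and \<open>\<beta>\<close>. A continuous map
  from a projective to an inductive limit satisfies such a bound for at least one pair of steps, by
  a gliding hump argument with a weighted supremum seminorm. The weights \<open>\<theta>\<close> are
  multiplicative in \<open>(\<beta>, \<alpha>)\<close> up to a dilation of \<open>r\<close>, and quotients of two of them are summable,
  so these bounds place the coefficients in the required space of sequences in \<open>(\<beta>, \<alpha>)\<close>.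
\<close>

section \<open>Gaussian moments on the complex plane\<close>

text \<open>The spaces \<open>ell_dual\<close> and \<open>ell0\<close> are projective,
  \<open>ell\<close> and \<open>ell0_dual\<close> inductive. Hence (1) for \<open>A\<close> and (2)
  for \<open>A0\<close> start from a projective space, while (2) for \<open>A\<close> and (1) for
  \<open>A0\<close> start from an inductive one. The bound always has the quantifier over steps that
  the kernel space demands: one step for a union, all steps for an intersection. The exponent p is
  absorbed by three facts: a scaled unit sequence has as \<open>lp_norm\<close> the modulus of its
  entry, \<open>lp_norm\<close> dominates every entry, and a summable majorant places a sequence in
  \<open>lp_space p\<close>. So supremum norms suffice on both sides, and the loss between supremum
  and sum is paid by the summable quotients of weights. The obstacle is the inductive limit, whose
  open sets are known only through all locally convex topologies that make the inclusions
  continuous. Open sets are produced in it as unit balls of seminorms that are bounded on every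
  step. The index s = 0 has no weights: \<open>ell_all\<close> contains every sequence, and a map
  from \<open>ell_all\<close> to \<open>ell_fin\<close> has only finitely many nonzero matrix
  entries.\<close>

lemma measurable_Complex [measurable (raw)]:
  assumes "f \<in> borel_measurable M" and "g \<in> borel_measurable M"
  shows "(\<lambda>x. Complex (f x) (g x)) \<in> borel_measurable M"
  unfolding Complex_eq using assms by measurable

text \<open>Lebesgue measure on the plane is determined by its values on boxes, and the preimage of
  a box is a product of two intervals. This gives access to iterated integrals over the real and the
  imaginary part.\<close>

lemma lborel_complex_eq:
  "(lborel :: complex measure) = distr (lborel \<Otimes>\<^sub>M lborel) borel (\<lambda>z. Complex (fst z) (snd z))"
proof (rule lborel_eqI)
  fix l u :: complex
  assume lu: "\<And>b. b \<in> Basis \<Longrightarrow> l \<bullet> b \<le> u \<bullet> b"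
  have le: "Re l \<le> Re u" "Im l \<le> Im u"
    using lu[of 1] lu[of \<i>] by (auto simp: Basis_complex_def)
  have "(\<lambda>z. Complex (fst z) (snd z)) -` box l u = {Re l<..<Re u} \<times> {Im l<..<Im u}"
    by (auto simp: box_def Basis_complex_def)
  then have "emeasure (distr (lborel \<Otimes>\<^sub>M lborel) borel (\<lambda>z. Complex (fst z) (snd z))) (box l u) =
      ennreal (Re u - Re l) * ennreal (Im u - Im l)"
    using le by (subst emeasure_distr)
      (auto simp: space_pair_measure lborel.emeasure_pair_measure_Times)
  also have "\<dots> = (\<Prod>b\<in>Basis. (u - l) \<bullet> b)"
    using le by (simp add: Basis_complex_def ennreal_mult complex_eq_iff)
  finally show "emeasure (distr (lborel \<Otimes>\<^sub>M lborel) borel (\<lambda>z. Complex (fst z) (snd z))) (box l u) =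
      (\<Prod>b\<in>Basis. (u - l) \<bullet> b)" .
qed simp

lemma nn_integral_lborel_complex:
  assumes [measurable]: "f \<in> borel_measurable borel"
  shows "(\<integral>\<^sup>+z. f z \<partial>lborel) = (\<integral>\<^sup>+y. \<integral>\<^sup>+x. f (Complex x y) \<partial>lborel \<partial>lborel)"
    and "(\<integral>\<^sup>+z. f z \<partial>lborel) = (\<integral>\<^sup>+x. \<integral>\<^sup>+y. f (Complex x y) \<partial>lborel \<partial>lborel)"
proof -
  have *: "(\<integral>\<^sup>+z. f z \<partial>lborel) = (\<integral>\<^sup>+z. f (Complex (fst z) (snd z)) \<partial>(lborel \<Otimes>\<^sub>M lborel))"
    by (subst lborel_complex_eq, subst nn_integral_distr) simp_all
  show "(\<integral>\<^sup>+z. f z \<partial>lborel) = (\<integral>\<^sup>+y. \<integral>\<^sup>+x. f (Complex x y) \<partial>lborel \<partial>lborel)"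
    unfolding * by (subst lborel_pair.nn_integral_snd[symmetric]) simp_all
  show "(\<integral>\<^sup>+z. f z \<partial>lborel) = (\<integral>\<^sup>+x. \<integral>\<^sup>+y. f (Complex x y) \<partial>lborel \<partial>lborel)"
    unfolding * by (subst lborel.nn_integral_fst[symmetric]) simp_all
qed

text \<open>Integrating first in the sheared coordinate, with the other one fixed, turns the shear
  into a translation of the real line.\<close>

lemma nn_integral_shear:
  assumes [measurable]: "f \<in> borel_measurable borel"
  shows "(\<integral>\<^sup>+z. f (Complex (Re z + t * Im z) (Im z)) \<partial>lborel) = (\<integral>\<^sup>+z. f z \<partial>lborel)"
    and "(\<integral>\<^sup>+z. f (Complex (Re z) (Im z + t * Re z)) \<partial>lborel) = (\<integral>\<^sup>+z. f z \<partial>lborel)"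
proof -
  have *: "(\<integral>\<^sup>+x. g (x + c) \<partial>lborel) = (\<integral>\<^sup>+x. g x \<partial>lborel)"
    if "g \<in> borel_measurable borel" for g :: "real \<Rightarrow> ennreal" and c
    using nn_integral_real_affine[OF that, of 1 c] by (simp add: add.commute)
  show "(\<integral>\<^sup>+z. f (Complex (Re z + t * Im z) (Im z)) \<partial>lborel) = (\<integral>\<^sup>+z. f z \<partial>lborel)"
    by (simp add: nn_integral_lborel_complex(1) *[of "\<lambda>x. f (Complex x _)"])
  show "(\<integral>\<^sup>+z. f (Complex (Re z) (Im z + t * Re z)) \<partial>lborel) = (\<integral>\<^sup>+z. f z \<partial>lborel)"
    by (simp add: nn_integral_lborel_complex(2) *[of "\<lambda>y. f (Complex _ y)"])
qed

text \<open>A rotation by an angle that is not a multiple of \<open>\<pi>\<close> is a product of three shears.\<close>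

lemma distr_lborel_rotation:
  fixes u :: complex
  assumes "norm u = 1" and "Im u \<noteq> 0"
  shows "distr lborel borel (\<lambda>z. u * z) = lborel"
proof (rule measure_eqI)
  fix X assume "X \<in> sets (distr lborel borel (\<lambda>z. u * z))"
  then have [measurable]: "X \<in> sets borel" by simp
  let ?f = "indicator X :: complex \<Rightarrow> ennreal"
  \<comment> \<open>For u = exp(i \<phi>) this is -tan(\<phi>/2), the classical slope of the two
    outer shears; the inner one has slope sin \<phi>. The division is the reason for
    \<open>Im u \<noteq> 0\<close>.\<close>
  define t where "t = (Re u - 1) / Im u"
  have u: "(Re u)\<^sup>2 + (Im u)\<^sup>2 = 1"
    using assms(1) by (simp add: cmod_def)
  have t1: "1 + t * Im u = Re u"
    using assms(2) by (simp add: t_def)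
  have t2: "t * (1 + Re u) = - Im u"
    using u assms(2) by (simp add: t_def field_simps power2_eq_square)
  have rot: "u * z = Complex ((Re z + t * Im z) + t * (Im z + Im u * (Re z + t * Im z)))
      (Im z + Im u * (Re z + t * Im z))" for z
  proof -
    have "(Re z + t * Im z) + t * (Im z + Im u * (Re z + t * Im z)) =
        Re z * (1 + t * Im u) + Im z * (t * (1 + (1 + t * Im u)))"
      and "Im z + Im u * (Re z + t * Im z) = Im u * Re z + Im z * (1 + t * Im u)"
      by algebra+
    then show ?thesis
      unfolding t1 t2 by (simp add: complex_eq_iff algebra_simps)
  qed
  have "emeasure (distr lborel borel (\<lambda>z. u * z)) X = (\<integral>\<^sup>+z. ?f z \<partial>distr lborel borel (\<lambda>z. u * z))"
    by simp
  also have "\<dots> = (\<integral>\<^sup>+z. ?f (u * z) \<partial>lborel)"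
    by (rule nn_integral_distr) simp_all
  also have "\<dots> = (\<integral>\<^sup>+z. ?f z \<partial>lborel)"
    unfolding rot
    using nn_integral_shear(1)[of "\<lambda>w. ?f (Complex (Re w + t * (Im w + Im u * Re w)) (Im w + Im u * Re w))" t]
      nn_integral_shear(2)[of "\<lambda>w. ?f (Complex (Re w + t * Im w) (Im w))" "Im u"]
      nn_integral_shear(1)[of ?f t]
    by simp
  finally show "emeasure (distr lborel borel (\<lambda>z. u * z)) X = emeasure lborel X" by simp
qed simp

text \<open>Polar coordinates in disguise: the disc |z|^2 \<le> t has area \<pi> t, and half-lines
  generate the Borel sets. Integrals of functions of |z|^2 thus become integrals over a
  half-line.\<close>

lemma distr_lborel_norm_square:
  "distr lborel borel (\<lambda>z::complex. (norm z)\<^sup>2) = density lborel (\<lambda>t. ennreal pi * indicator {0..} t)"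
proof (rule measure_eqI_generator_eq)
  show "Int_stable (range (\<lambda>t::real. {..t}))"
    by (auto simp: Int_stable_def)
  show "sets (distr lborel borel (\<lambda>z::complex. (norm z)\<^sup>2)) = sigma_sets UNIV (range (\<lambda>t::real. {..t}))"
    "sets (density lborel (\<lambda>t. ennreal pi * indicator {0..} t)) = sigma_sets UNIV (range (\<lambda>t::real. {..t}))"
    by (simp_all add: borel_eq_atMost)
  have m: "emeasure (distr lborel borel (\<lambda>z::complex. (norm z)\<^sup>2)) {..t} = ennreal (pi * max 0 t)" for t
  proof -
    have "(\<lambda>z::complex. (norm z)\<^sup>2) -` {..t} = (if 0 \<le> t then cball 0 (sqrt t) else {})"
      by (auto simp: real_le_rsqrt dest: order_trans[OF zero_le_power2] real_sqrt_le_mono)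
        (metis norm_ge_zero power_mono real_sqrt_pow2)
    then show ?thesis
      by (simp add: emeasure_distr emeasure_cball unit_ball_vol_2)
  qed
  show "emeasure (distr lborel borel (\<lambda>z::complex. (norm z)\<^sup>2)) X =
      emeasure (density lborel (\<lambda>t. ennreal pi * indicator {0..} t)) X"
    if X: "X \<in> range (\<lambda>t::real. {..t})" for X
  proof -
    from X obtain t where t: "X = {..t}" by blast
    have "emeasure (density lborel (\<lambda>t. ennreal pi * indicator {0..} t)) X =
        (\<integral>\<^sup>+x. ennreal pi * indicator {0..t} x \<partial>lborel)"
      by (subst emeasure_density) (auto simp: t indicator_def intro!: nn_integral_cong)
    also have "\<dots> = ennreal pi * emeasure lborel {0..t}"
      by (simp add: nn_integral_cmult)
    also have "\<dots> = ennreal (pi * max 0 t)"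
      by (cases "0 \<le> t") (simp_all add: ennreal_mult)
    finally show ?thesis using m t by simp
  qed
  show "range (\<lambda>n::nat. {..real n}) \<subseteq> range (\<lambda>t::real. {..t})" by auto
  show "(\<Union>n::nat. {..real n}) = UNIV" using real_arch_simple by auto
  show "emeasure (distr lborel borel (\<lambda>z::complex. (norm z)\<^sup>2)) {..real n} \<noteq> \<infinity>" for n
    by (simp add: m)
qed simp

lemma measurable_cnj [measurable]: "cnj \<in> borel_measurable borel"
  by (intro borel_measurable_continuous_onI continuous_intros)

definition gauss1 :: "nat \<Rightarrow> nat \<Rightarrow> complex \<Rightarrow> complex" where
  "gauss1 a b z = of_real (exp (- (norm z)\<^sup>2) / pi) * (z ^ a * cnj z ^ b)"

lemma gauss1_measurable [measurable]: "gauss1 a b \<in> borel_measurable borel"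
  unfolding gauss1_def by measurable

text \<open>After the passage to t = |z|^2 the factor \<pi> cancels, and Euler's integral of t^k
  exp(-t) remains.\<close>

lemma nn_integral_gauss_power:
  "(\<integral>\<^sup>+z. ennreal (exp (- (norm z)\<^sup>2) / pi * ((norm (z::complex))\<^sup>2) ^ k) \<partial>lborel) = ennreal (fact k)"
proof -
  have "(\<integral>\<^sup>+z. ennreal (exp (- (norm z)\<^sup>2) / pi * ((norm (z::complex))\<^sup>2) ^ k) \<partial>lborel) =
      (\<integral>\<^sup>+t. ennreal (exp (- t) / pi * t ^ k) \<partial>distr lborel borel (\<lambda>z::complex. (norm z)\<^sup>2))"
    by (subst nn_integral_distr) simp_all
  also have "\<dots> = (\<integral>\<^sup>+t. (ennreal pi * indicator {0..} t) * ennreal (exp (- t) / pi * t ^ k) \<partial>lborel)"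
    unfolding distr_lborel_norm_square by (subst nn_integral_density) simp_all
  also have "\<dots> = (\<integral>\<^sup>+t. ennreal (t ^ k * exp (- t)) * indicator {0..} t \<partial>lborel)"
    by (rule nn_integral_cong) (auto simp: indicator_def ennreal_mult[symmetric] mult.commute)
  finally show ?thesis
    by (simp only: nn_intergal_power_times_exp_Ici of_nat_fact)
qed

lemma integrable_gauss1: "integrable lborel (gauss1 a b)"
proof -
  have int: "integrable lborel (\<lambda>z::complex. exp (- (norm z)\<^sup>2) / pi * ((norm z)\<^sup>2) ^ k)" for k
    using nn_integral_gauss_power[of k] by (intro integrableI_nonneg) auto
  show ?thesis
  proof (rule Bochner_Integration.integrable_bound)
    show "integrable lborel (\<lambda>z::complex. exp (- (norm z)\<^sup>2) / pi * ((norm z)\<^sup>2) ^ 0 +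
        exp (- (norm z)\<^sup>2) / pi * ((norm z)\<^sup>2) ^ (a + b))"
      by (intro Bochner_Integration.integrable_add int)
    \<comment> \<open>The degree a + b in |z| may be odd; the comparison with even powers makes the
      moments above applicable.\<close>
    have *: "x ^ k \<le> 1 + (x\<^sup>2) ^ k" if "0 \<le> x" for x :: real and k
    proof (cases "x \<le> 1")
      case True
      then show ?thesis using that by (simp add: add_increasing2 power_le_one)
    next
      case False
      then have "x ^ k \<le> (x\<^sup>2) ^ k"
        by (intro power_mono) (auto simp: power2_eq_square)
      then show ?thesis by simp
    qed
    show "AE z in lborel. norm (gauss1 a b z) \<le> norm (exp (- (norm z)\<^sup>2) / pi * ((norm z)\<^sup>2) ^ 0 +
        exp (- (norm z)\<^sup>2) / pi * ((norm z)\<^sup>2) ^ (a + b))"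
    proof (rule AE_I2)
      fix z :: complex
      have "norm (gauss1 a b z) = exp (- (norm z)\<^sup>2) / pi * norm z ^ (a + b)"
        by (simp add: gauss1_def norm_mult norm_power norm_divide power_add)
      also have "\<dots> \<le> exp (- (norm z)\<^sup>2) / pi * (1 + ((norm z)\<^sup>2) ^ (a + b))"
        by (intro mult_left_mono *) auto
      finally show "norm (gauss1 a b z) \<le> norm (exp (- (norm z)\<^sup>2) / pi * ((norm z)\<^sup>2) ^ 0 +
          exp (- (norm z)\<^sup>2) / pi * ((norm z)\<^sup>2) ^ (a + b))"
        by (simp add: distrib_left)
    qed
  qed simp
qed

text \<open>On the diagonal the integrand is a radial moment. Off it, the substitution of u z for z
  with |u| = 1 preserves Lebesgue measure and multiplies the integral by u^(a-b), so the integral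
  vanishes once this power differs from 1.\<close>

lemma integral_gauss1: "(\<integral>z. gauss1 a b z \<partial>lborel) = (if a = b then fact a else 0)"
proof (cases "a = b")
  case True
  have "gauss1 a a z = of_real (exp (- (norm z)\<^sup>2) / pi * ((norm z)\<^sup>2) ^ a)" for z
  proof -
    have "z ^ a * cnj z ^ a = of_real (((norm z)\<^sup>2) ^ a)"
      by (simp add: power_mult_distrib[symmetric] complex_norm_square[symmetric])
    then show ?thesis by (simp add: gauss1_def)
  qed
  then have "(\<integral>z. gauss1 a a z \<partial>lborel) =
      of_real (\<integral>z. exp (- (norm (z::complex))\<^sup>2) / pi * ((norm z)\<^sup>2) ^ a \<partial>lborel)"
    by (simp only: integral_complex_of_real)
  also have "(\<integral>z. exp (- (norm (z::complex))\<^sup>2) / pi * ((norm z)\<^sup>2) ^ a \<partial>lborel) = fact a"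
    using nn_integral_gauss_power[of a] by (subst integral_eq_nn_integral) auto
  finally show ?thesis using True by simp
next
  case False
  define n where "n = (if a < b then b - a else a - b)"
  \<comment> \<open>With n = |a - b|, the angle 1/n gives u^n = cis 1, which is not 1. The angle
    lies in (0, 1], where sin is positive, so \<open>Im u \<noteq> 0\<close> and the decomposition
    into shears applies.\<close>
  define u where "u = cis (1 / real n)"
  have n: "1 \<le> n" using False by (auto simp: n_def)
  have pos: "0 < sin x" if "0 < x" "x \<le> 1" for x :: real
    using that pi_gt3 by (intro sin_gt_zero) auto
  have "norm u = 1" "Im u \<noteq> 0"
    using n pos[of "1 / real n"] by (simp_all add: u_def)
  have "u ^ n = cis 1"
    using n by (subst u_def, subst Complex.DeMoivre) simp
  moreover have "cis 1 \<noteq> 1"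
    using pos[of 1] by (auto simp: complex_eq_iff)
  ultimately have un: "u ^ n \<noteq> 1" by simp
  have uu: "u * cnj u = 1"
    using \<open>norm u = 1\<close> by (simp add: complex_norm_square[symmetric])
  have "u ^ a * cnj u ^ b \<noteq> 1"
  proof
    assume eq: "u ^ a * cnj u ^ b = 1"
    have pw: "u ^ k * cnj u ^ k = 1" for k
      by (simp add: power_mult_distrib[symmetric] uu)
    show False
    proof (cases "a < b")
      case True
      then have "cnj u ^ b = cnj u ^ a * cnj u ^ n"
        by (simp add: n_def power_add[symmetric])
      then have "cnj u ^ n = 1" using eq pw[of a] by (simp add: mult.assoc[symmetric])
      then show False using pw[of n] un by simp
    next
      case F: False
      then have "u ^ a = u ^ n * u ^ b"
        using False by (simp add: n_def power_add[symmetric])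
      then show False using eq pw[of b] un by (simp add: mult.assoc)
    qed
  qed
  moreover have "(\<integral>z. gauss1 a b z \<partial>lborel) = u ^ a * cnj u ^ b * (\<integral>z. gauss1 a b z \<partial>lborel)"
  proof -
    have "(\<integral>z. gauss1 a b z \<partial>lborel) = (\<integral>z. gauss1 a b z \<partial>distr lborel borel (\<lambda>z. u * z))"
      using distr_lborel_rotation[OF \<open>norm u = 1\<close> \<open>Im u \<noteq> 0\<close>] by simp
    also have "\<dots> = (\<integral>z. gauss1 a b (u * z) \<partial>lborel)"
      by (rule integral_distr) simp_all
    also have "\<dots> = (\<integral>z. u ^ a * cnj u ^ b * gauss1 a b z \<partial>lborel)"
      using \<open>norm u = 1\<close>
      by (intro Bochner_Integration.integral_cong)
        (simp_all add: gauss1_def norm_mult power_mult_distrib ac_simps)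
    finally show ?thesis by simp
  qed
  ultimately show ?thesis using False by (metis mult_cancel_right1)
qed

section \<open>Orthonormality and the form on polynomials\<close>

lemma mfact_pos [simp]: "0 < mfact \<alpha>"
  by (simp add: mfact_def prod_pos)

lemma mfact_nonzero [simp]: "mfact \<alpha> \<noteq> 0"
  by (rule less_imp_neq[OF mfact_pos, symmetric])

text \<open>
  The coordinates in \<open>B\<close> enter conjugated: \<open>B = {}\<close> gives \<open>e\<^sub>\<alpha>\<close>, and \<open>B = range Inr\<close> gives the
  functions \<open>e_basis \<alpha>\<^sub>2 z\<^sub>2 * e_basis \<alpha>\<^sub>1 (cnj \<circ> z\<^sub>1)\<close> in which kernels are expanded.
\<close>

definition mixed_basis :: "'d set \<Rightarrow> 'd::finite mindex \<Rightarrow> ('d \<Rightarrow> complex) \<Rightarrow> complex" where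
  "mixed_basis B \<alpha> z = (\<Prod>i\<in>UNIV. (if i \<in> B then cnj (z i) else z i) ^ \<alpha> i) / of_real (sqrt (mfact \<alpha>))"

lemma mixed_basis_measurable [measurable]:
  fixes B :: "'d::finite set"
  shows "mixed_basis B \<alpha> \<in> borel_measurable (Pi\<^sub>M UNIV (\<lambda>_. lborel))"
proof -
  have [measurable]: "(\<lambda>z. if i \<in> B then cnj (z i) else z i) \<in> borel_measurable (Pi\<^sub>M UNIV (\<lambda>_. lborel))"
    for i :: 'd
    by (cases "i \<in> B") simp_all
  show ?thesis unfolding mixed_basis_def by measurable
qed

text \<open>The Gaussian density and the functions \<open>mixed_basis\<close> are products over the
  coordinates, so the integral splits into one-dimensional ones. For \<alpha> \<noteq> \<beta> a
  single coordinate in which they differ makes the product vanish.\<close>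

lemma mixed_basis_orthonormal:
  fixes B :: "'d::finite set"
  shows "integrable gauss (\<lambda>z. mixed_basis B \<alpha> z * cnj (mixed_basis B \<beta> z))"
    and "(\<integral>z. mixed_basis B \<alpha> z * cnj (mixed_basis B \<beta> z) \<partial>gauss) = (if \<alpha> = \<beta> then 1 else 0)"
proof -
  let ?M = "Pi\<^sub>M UNIV (\<lambda>_. lborel) :: ('d \<Rightarrow> complex) measure"
  let ?w = "\<lambda>z :: 'd \<Rightarrow> complex. exp (- (\<Sum>i\<in>UNIV. (norm (z i))\<^sup>2)) / pi ^ CARD('d)"
  let ?f = "\<lambda>z. mixed_basis B \<alpha> z * cnj (mixed_basis B \<beta> z)"
  \<comment> \<open>Conjugating coordinate i swaps the two exponents in its one-dimensional
    integral, whose value is symmetric in them.\<close>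
  let ?g = "\<lambda>i. if i \<in> B then gauss1 (\<beta> i) (\<alpha> i) else gauss1 (\<alpha> i) (\<beta> i)"
  let ?c = "1 / of_real (sqrt (mfact \<alpha>) * sqrt (mfact \<beta>)) :: complex"
  interpret product_sigma_finite "\<lambda>_::'d. lborel :: complex measure"
    by standard
  have [measurable]: "?w \<in> borel_measurable ?M" by measurable
  have wf: "?w z *\<^sub>R ?f z = ?c * (\<Prod>i\<in>UNIV. ?g i (z i))" for z
  proof -
    let ?p = "\<lambda>\<alpha> i. (if i \<in> B then cnj (z i) else z i) ^ \<alpha> i"
    have w: "?w z = (\<Prod>i\<in>UNIV. exp (- (norm (z i))\<^sup>2) / pi)"
      by (simp add: sum_negf[symmetric] exp_sum prod_dividef)
    have "(\<Prod>i\<in>UNIV. ?g i (z i)) =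
        (\<Prod>i\<in>UNIV. of_real (exp (- (norm (z i))\<^sup>2) / pi) * (?p \<alpha> i * cnj (?p \<beta> i)))"
      by (rule prod.cong) (auto simp: gauss1_def mult.commute)
    also have "\<dots> = of_real (?w z) * (prod (?p \<alpha>) UNIV * cnj (prod (?p \<beta>) UNIV))"
      unfolding w by (simp only: prod.distrib cnj_prod of_real_prod)
    finally show ?thesis
      by (simp add: scaleR_conv_of_real mixed_basis_def)
  qed
  have int: "integrable ?M (\<lambda>z. \<Prod>i\<in>UNIV. ?g i (z i))"
    by (rule product_integrable_prod) (simp_all add: integrable_gauss1)
  show "integrable gauss ?f"
    unfolding gauss_def
    by (subst integrable_density) (simp_all only: wf, use int in \<open>auto intro!: integrable_mult_right\<close>)
  have "(\<integral>z. ?f z \<partial>gauss) = (\<integral>z. ?w z *\<^sub>R ?f z \<partial>?M)"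
    unfolding gauss_def by (rule integral_density) auto
  also have "\<dots> = ?c * (\<integral>z. (\<Prod>i\<in>UNIV. ?g i (z i)) \<partial>?M)"
    unfolding wf by simp
  also have "(\<integral>z. (\<Prod>i\<in>UNIV. ?g i (z i)) \<partial>?M) = (\<Prod>i\<in>UNIV. integral\<^sup>L lborel (?g i))"
    by (rule product_integral_prod) (simp_all add: integrable_gauss1)
  also have "\<dots> = (\<Prod>i\<in>UNIV. if \<alpha> i = \<beta> i then fact (\<alpha> i) else 0)"
    by (rule prod.cong) (auto simp: integral_gauss1)
  also have "?c * \<dots> = (if \<alpha> = \<beta> then 1 else 0)"
  proof (cases "\<alpha> = \<beta>")
    case True
    have "(\<Prod>i\<in>UNIV. fact (\<beta> i)) = complex_of_real (mfact \<beta>)"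
      by (simp add: mfact_def of_real_prod)
    then show ?thesis using mfact_pos[of \<beta>] True
      by (simp add: less_imp_le less_imp_neq[symmetric] flip: of_real_mult)
  next
    case False
    then obtain i where "\<alpha> i \<noteq> \<beta> i" by blast
    then have "(\<Prod>i\<in>UNIV. if \<alpha> i = \<beta> i then fact (\<alpha> i) else 0 :: complex) = 0"
      by (intro prod_zero) auto
    then show ?thesis using False by simp
  qed
  finally show "(\<integral>z. ?f z \<partial>gauss) = (if \<alpha> = \<beta> then 1 else 0)" .
qed

lemma finite_mdeg_le: "finite {\<alpha> :: 'd::finite mindex. mdeg \<alpha> \<le> N}"
proof (rule finite_subset)
  show "{\<alpha> :: 'd mindex. mdeg \<alpha> \<le> N} \<subseteq> Pi\<^sub>E UNIV (\<lambda>_. {..N})"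
  proof (clarsimp simp: PiE_def Pi_def)
    fix \<alpha> :: "'d mindex" and i assume "mdeg \<alpha> \<le> N"
    moreover have "\<alpha> i \<le> mdeg \<alpha>"
      unfolding mdeg_def by (rule member_le_sum) auto
    ultimately show "\<alpha> i \<le> N" by simp
  qed
qed (auto intro: finite_PiE)

text \<open>Orthonormality picks out equal indices. Once N bounds the degrees in the finite set D,
  the partial sum catches all of D, so the limit in \<open>A2_form\<close> is that of an eventually
  constant sequence.\<close>

lemma A2_form_mixed_basis:
  fixes c g :: "'d::finite mindex \<Rightarrow> complex"
  assumes "finite D"
  shows "A2_form (\<lambda>N z. \<Sum>\<alpha> | mdeg \<alpha> \<le> N. c \<alpha> * mixed_basis B \<alpha> z)
      (\<lambda>z. \<Sum>\<beta>\<in>D. g \<beta> * mixed_basis B \<beta> z) = (\<Sum>\<beta>\<in>D. c \<beta> * cnj (g \<beta>))"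
proof -
  let ?e = "mixed_basis B"
  let ?I = "\<lambda>N. \<integral>z. (\<Sum>\<alpha> | mdeg \<alpha> \<le> N. c \<alpha> * ?e \<alpha> z) * cnj (\<Sum>\<beta>\<in>D. g \<beta> * ?e \<beta> z) \<partial>gauss"
  have I: "?I N = (\<Sum>\<beta>\<in>D. c \<beta> * cnj (g \<beta>))" if N: "\<forall>\<beta>\<in>D. mdeg \<beta> \<le> N" for N
  proof -
    have "?I N = (\<integral>z. (\<Sum>\<alpha> | mdeg \<alpha> \<le> N. \<Sum>\<beta>\<in>D. c \<alpha> * cnj (g \<beta>) * (?e \<alpha> z * cnj (?e \<beta> z))) \<partial>gauss)"
      unfolding cnj_sum sum_product by (simp add: ac_simps)
    also have "\<dots> = (\<Sum>\<alpha> | mdeg \<alpha> \<le> N. \<Sum>\<beta>\<in>D. c \<alpha> * cnj (g \<beta>) * (if \<alpha> = \<beta> then 1 else 0))"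
      by (simp add: mixed_basis_orthonormal)
    also have "\<dots> = (\<Sum>\<beta>\<in>D. \<Sum>\<alpha> | mdeg \<alpha> \<le> N. if \<alpha> = \<beta> then c \<beta> * cnj (g \<beta>) else 0)"
      by (subst sum.swap) (intro sum.cong, auto)
    also have "\<dots> = (\<Sum>\<beta>\<in>D. c \<beta> * cnj (g \<beta>))"
      using N by (intro sum.cong refl) (simp add: finite_mdeg_le)
    finally show ?thesis .
  qed
  define M where "M = Max (insert 0 (mdeg ` D))"
  have "\<forall>\<beta>\<in>D. mdeg \<beta> \<le> M" using assms by (auto simp: M_def)
  then have "?I N = (\<Sum>\<beta>\<in>D. c \<beta> * cnj (g \<beta>))" if "M \<le> N" for N
    using that by (intro I) force
  then have "?I \<longlonglongrightarrow> (\<Sum>\<beta>\<in>D. c \<beta> * cnj (g \<beta>))"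
    by (intro tendsto_eventually) (auto simp: eventually_sequentially)
  then show ?thesis unfolding A2_form_def by (rule limI)
qed

lemma e_basis_eq_mixed_basis: "e_basis \<alpha> = mixed_basis {} \<alpha>"
  by (simp add: fun_eq_iff e_basis_def mixed_basis_def)

lemma mdeg_sum_index: "mdeg \<gamma> = mdeg (\<gamma> \<circ> Inl) + mdeg (\<gamma> \<circ> Inr)"
  unfolding mdeg_def by (subst UNIV_Plus_UNIV[symmetric], subst sum.Plus) simp_all

lemma mfact_sum_index: "mfact \<gamma> = mfact (\<gamma> \<circ> Inl) * mfact (\<gamma> \<circ> Inr)"
  unfolding mfact_def by (subst UNIV_Plus_UNIV[symmetric], subst prod.Plus) simp_all

lemma e_basis_tensor:
  fixes \<gamma> :: "('d2::finite + 'd1::finite) mindex"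
  shows "e_basis (\<gamma> \<circ> Inl) (z \<circ> Inl) * e_basis (\<gamma> \<circ> Inr) (cnj \<circ> (z \<circ> Inr)) = mixed_basis (range Inr) \<gamma> z"
proof -
  have "(\<Prod>i\<in>UNIV. (if i \<in> range Inr then cnj (z i) else z i) ^ \<gamma> i) =
      (\<Prod>i\<in>UNIV. z (Inl i) ^ \<gamma> (Inl i)) * (\<Prod>i\<in>UNIV. cnj (z (Inr i)) ^ \<gamma> (Inr i))"
    by (subst UNIV_Plus_UNIV[symmetric], subst prod.Plus) (auto intro!: prod.cong arg_cong2[where f="(*)"])
  then show ?thesis
    by (simp add: e_basis_def mixed_basis_def mfact_sum_index[of \<gamma>] real_sqrt_mult)
qed

lemma A2_form_series:
  assumes "finite {\<alpha>. hcoeff G \<alpha> \<noteq> 0}"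
  shows "A2_form (series_upto F) (series_eval G) =
      (\<Sum>\<alpha> | hcoeff G \<alpha> \<noteq> 0. hcoeff F \<alpha> * cnj (hcoeff G \<alpha>))"
  using A2_form_mixed_basis[OF assms, of "hcoeff F" "{}" "hcoeff G"]
  unfolding series_upto_def[abs_def] series_eval_def[abs_def] e_basis_eq_mixed_basis .

lemma A2_form_kernel:
  fixes K :: "('d2::finite + 'd1::finite) series"
  assumes F: "finite {\<alpha>. hcoeff F \<alpha> \<noteq> 0}" and G: "finite {\<beta>. hcoeff G \<beta> \<noteq> 0}"
  shows "A2_form (kernel_upto K) (\<lambda>z. series_eval G (z \<circ> Inl) * cnj (series_eval F (z \<circ> Inr))) =
      (\<Sum>\<beta> | hcoeff G \<beta> \<noteq> 0. \<Sum>\<alpha> | hcoeff F \<alpha> \<noteq> 0.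
        hcoeff K (case_sum \<beta> \<alpha>) * hcoeff F \<alpha> * cnj (hcoeff G \<beta>))"
proof -
  let ?P = "{\<beta>. hcoeff G \<beta> \<noteq> 0} \<times> {\<alpha>. hcoeff F \<alpha> \<noteq> 0}"
  let ?D = "(\<lambda>(\<beta>, \<alpha>). case_sum \<beta> \<alpha>) ` ?P"
  let ?g = "\<lambda>\<gamma>. hcoeff G (\<gamma> \<circ> Inl) * cnj (hcoeff F (\<gamma> \<circ> Inr))"
  have inj: "inj_on (\<lambda>(\<beta>, \<alpha>). case_sum \<beta> \<alpha>) X" for X :: "(('d2 \<Rightarrow> nat) \<times> ('d1 \<Rightarrow> nat)) set"
    by (rule inj_on_inverseI[of _ "\<lambda>\<gamma>. (\<gamma> \<circ> Inl, \<gamma> \<circ> Inr)"]) (auto simp: fun_eq_iff)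
  have D: "(\<Sum>\<gamma>\<in>?D. h \<gamma>) = (\<Sum>\<beta> | hcoeff G \<beta> \<noteq> 0. \<Sum>\<alpha> | hcoeff F \<alpha> \<noteq> 0. h (case_sum \<beta> \<alpha>))"
    for h :: "_ \<Rightarrow> complex"
    by (subst sum.reindex[OF inj]) (simp add: sum.cartesian_product case_prod_beta)
  have cnj_e: "cnj (e_basis \<alpha> z) = e_basis \<alpha> (cnj \<circ> z)" for \<alpha> :: "'d1 mindex" and z
    by (simp add: e_basis_def)
  have [simp]: "case_sum \<beta> \<alpha> \<circ> Inl = \<beta>" "case_sum \<beta> \<alpha> \<circ> Inr = \<alpha>"
    for \<beta> :: "'d2 mindex" and \<alpha> :: "'d1 mindex"
    by (simp_all add: fun_eq_iff)
  \<comment> \<open>The test function is expanded in the same orthonormal system as the kernel: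
    conjugating e_\<alpha> amounts to conjugating its argument. The coefficients of F get conjugated
    here, and the conjugation in the form restores them.\<close>
  have test: "series_eval G (z \<circ> Inl) * cnj (series_eval F (z \<circ> Inr)) =
      (\<Sum>\<gamma>\<in>?D. ?g \<gamma> * mixed_basis (range Inr) \<gamma> z)" for z
    unfolding D series_eval_def
    by (simp add: sum_product cnj_e ac_simps flip: e_basis_tensor)
  have "finite ?D" using F G by simp
  from A2_form_mixed_basis[OF this, of "hcoeff K" "range Inr" ?g]
  show ?thesis
    unfolding kernel_upto_def[abs_def] test D mult.assoc e_basis_tensor by (simp add: ac_simps)
qed

section \<open>Weighted sequence spaces and seminorms\<close>

definition delta :: "'i \<Rightarrow> complex \<Rightarrow> 'i \<Rightarrow> complex" where
  "delta a t = (\<lambda>b. if b = a then t else 0)"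

lemma delta_mult: "(\<lambda>b. delta a t b * c b) = delta a (t * c a)"
  by (auto simp: delta_def)

lemma nonzero_mult_div_self: "k \<noteq> 0 \<Longrightarrow> k * (x / k) = (x::real)"
  by simp

lemma lp_exponent:
  assumes "1 \<le> p" and "p \<noteq> \<infinity>"
  shows "1 \<le> enn2real p"
  using assms by (metis enn2real_1 enn2real_mono infinity_ennreal_def top.not_eq_extremum)

lemma delta_in_lp_space:
  assumes "1 \<le> p"
  shows "delta a t \<in> lp_space p"
proof (cases "p = \<infinity>")
  case True
  then show ?thesis
    by (auto simp: lp_space_def delta_def intro!: bdd_aboveI[of _ "norm t"])
next
  case False
  have "(\<lambda>b. norm (delta a t b) powr enn2real p) summable_on UNIV \<longleftrightarrow>
      (\<lambda>b. norm (delta a t b) powr enn2real p) summable_on {a}"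
    by (rule summable_on_cong_neutral) (auto simp: delta_def)
  then show ?thesis using False by (simp add: lp_space_def)
qed

lemma lp_norm_delta:
  assumes "1 \<le> p"
  shows "lp_norm p (delta a t) = norm t"
proof (cases "p = \<infinity>")
  case True
  have "(SUP b. norm (delta a t b)) = norm t"
    by (rule cSup_eq_maximum) (auto simp: delta_def image_def)
  then show ?thesis using True by (simp add: lp_norm_def)
next
  case False
  have "(\<Sum>\<^sub>\<infinity>b. norm (delta a t b) powr enn2real p) =
      (\<Sum>\<^sub>\<infinity>b\<in>{a}. norm (delta a t b) powr enn2real p)"
    by (rule infsum_cong_neutral) (auto simp: delta_def)
  also have "\<dots> = norm t powr enn2real p"
    by (simp add: delta_def)
  finally show ?thesis
    using False lp_exponent[OF assms] by (simp add: lp_norm_def powr_powr)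
qed

lemma norm_le_lp_norm:
  assumes "1 \<le> p" and x: "x \<in> lp_space p"
  shows "norm (x b) \<le> lp_norm p x"
proof (cases "p = \<infinity>")
  case True
  then show ?thesis using x by (auto simp: lp_space_def lp_norm_def intro: cSUP_upper)
next
  case False
  let ?q = "enn2real p"
  have q: "1 \<le> ?q" using assms(1) False by (rule lp_exponent)
  have "(\<Sum>b\<in>{b}. norm (x b) powr ?q) \<le> (\<Sum>\<^sub>\<infinity>b. norm (x b) powr ?q)"
    using x False by (intro finite_sum_le_infsum) (auto simp: lp_space_def)
  then have "(norm (x b) powr ?q) powr (1 / ?q) \<le> (\<Sum>\<^sub>\<infinity>b. norm (x b) powr ?q) powr (1 / ?q)"
    using q by (intro powr_mono2) auto
  then show ?thesis using False q by (simp add: lp_norm_def powr_powr)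
qed

lemma lp_space_mono:
  assumes "1 \<le> p" and y: "y \<in> lp_space p" and le: "\<And>b. norm (x b) \<le> norm (y b)"
  shows "x \<in> lp_space p"
proof (cases "p = \<infinity>")
  case True
  with y obtain C where "\<And>b. norm (y b) \<le> C"
    by (auto simp: lp_space_def bdd_above_def)
  then have "norm (x b) \<le> C" for b using le order_trans by blast
  then show ?thesis using True by (auto simp: lp_space_def intro!: bdd_aboveI[of _ C])
next
  case False
  have "(\<lambda>b. norm (x b) powr enn2real p) summable_on UNIV"
  proof (rule summable_on_comparison_test)
    show "(\<lambda>b. norm (y b) powr enn2real p) summable_on UNIV"
      using y False by (simp add: lp_space_def)
  qed (use le in \<open>auto intro!: powr_mono2\<close>)
  then show ?thesis using False by (simp add: lp_space_def)
qed

lemma lp_space_scale: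
  assumes "x \<in> lp_space p"
  shows "(\<lambda>b. a * x b) \<in> lp_space p"
proof (cases "p = \<infinity>")
  case True
  with assms obtain C where "\<And>b. norm (x b) \<le> C"
    by (auto simp: lp_space_def bdd_above_def)
  then have "norm (a * x b) \<le> norm a * C" for b by (simp add: norm_mult mult_left_mono)
  then show ?thesis using True by (auto simp: lp_space_def intro!: bdd_aboveI[of _ "norm a * C"])
next
  case False
  then show ?thesis using assms
    by (auto simp: lp_space_def norm_mult powr_mult intro!: summable_on_cmult_right)
qed

lemma lp_space_add:
  assumes "1 \<le> p" and x: "x \<in> lp_space p" and y: "y \<in> lp_space p"
  shows "(\<lambda>b. x b + y b) \<in> lp_space p"
proof (cases "p = \<infinity>")
  case True
  with x y obtain C D where "\<And>b. norm (x b) \<le> C" "\<And>b. norm (y b) \<le> D"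
    by (auto simp: lp_space_def bdd_above_def)
  then have "norm (x b + y b) \<le> C + D" for b by (meson add_mono norm_triangle_le)
  then show ?thesis using True by (auto simp: lp_space_def intro!: bdd_aboveI[of _ "C + D"])
next
  case False
  let ?q = "enn2real p"
  have "(\<lambda>b. norm (x b + y b) powr ?q) summable_on UNIV"
  proof (rule summable_on_comparison_test)
    show "(\<lambda>b. 2 powr ?q * (norm (x b) powr ?q + norm (y b) powr ?q)) summable_on UNIV"
      using x y False by (intro summable_on_cmult_right summable_on_add) (auto simp: lp_space_def)
    fix b
    \<comment> \<open>Bounding by twice the larger summand keeps the two q-th powers apart, at the
      price of the factor \<open>2 powr q\<close>.\<close>
    have "norm (x b + y b) \<le> 2 * max (norm (x b)) (norm (y b))"
      using norm_triangle_ineq[of "x b" "y b"] by (simp add: max_def)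
    then have "norm (x b + y b) powr ?q \<le> (2 * max (norm (x b)) (norm (y b))) powr ?q"
      by (intro powr_mono2) auto
    also have "\<dots> = 2 powr ?q * max (norm (x b)) (norm (y b)) powr ?q"
      by (rule powr_mult)
    also have "max (norm (x b)) (norm (y b)) powr ?q \<le> norm (x b) powr ?q + norm (y b) powr ?q"
      by (simp add: max_def)
    finally show "norm (x b + y b) powr ?q \<le> 2 powr ?q * (norm (x b) powr ?q + norm (y b) powr ?q)"
      by simp
  qed auto
  then show ?thesis using False by (simp add: lp_space_def)
qed

text \<open>Embedding of l^1 into l^p: a summable nonnegative h is bounded by its total H, so h^q
  \<le> H^(q-1) h. A summable majorant thus yields membership for every p at once.\<close>

lemma lp_space_summable:
  assumes "1 \<le> p" and h: "h summable_on UNIV" and le: "\<And>b. norm (x b) \<le> h b"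
  shows "x \<in> lp_space p"
proof -
  have h0: "0 \<le> h b" for b using le[of b] norm_ge_zero order_trans by blast
  define H where "H = (\<Sum>\<^sub>\<infinity>b. h b)"
  have hH: "h b \<le> H" for b
    using finite_sum_le_infsum[OF h, of "{b}"] h0 by (simp add: H_def)
  show ?thesis
  proof (cases "p = \<infinity>")
    case True
    then show ?thesis
      by (auto simp: lp_space_def intro!: bdd_aboveI[of _ H] order_trans[OF le hH])
  next
    case False
    let ?q = "enn2real p"
    have q: "1 \<le> ?q" using assms(1) False by (rule lp_exponent)
    have "(\<lambda>b. norm (x b) powr ?q) summable_on UNIV"
    proof (rule summable_on_comparison_test)
      show "(\<lambda>b. H powr (?q - 1) * h b) summable_on UNIV"
        by (rule summable_on_cmult_right[OF h])
      fix b
      have "norm (x b) powr ?q \<le> h b powr ?q"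
        using le q by (intro powr_mono2) auto
      also have "\<dots> = h b powr (?q - 1) * h b"
        using h0[of b] by (cases "h b = 0") (simp_all add: powr_diff)
      also have "\<dots> \<le> H powr (?q - 1) * h b"
        using h0 hH q by (intro mult_right_mono powr_mono2) auto
      finally show "norm (x b) powr ?q \<le> H powr (?q - 1) * h b" .
    qed auto
    then show ?thesis using False by (simp add: lp_space_def)
  qed
qed

section \<open>Seminorms and the topology defined by a single one\<close>

definition seminorm_on :: "('i \<Rightarrow> complex) set \<Rightarrow> (('i \<Rightarrow> complex) \<Rightarrow> real) \<Rightarrow> bool" where
  "seminorm_on V q \<longleftrightarrow>
     (\<forall>x\<in>V. \<forall>y\<in>V. (\<lambda>i. x i + y i) \<in> V \<and> q (\<lambda>i. x i + y i) \<le> q x + q y) \<and>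
     (\<forall>a. \<forall>x\<in>V. (\<lambda>i. a * x i) \<in> V \<and> q (\<lambda>i. a * x i) = norm a * q x)"

lemma seminorm_onD:
  assumes "seminorm_on V q"
  shows "x \<in> V \<Longrightarrow> y \<in> V \<Longrightarrow> (\<lambda>i. x i + y i) \<in> V"
    and "x \<in> V \<Longrightarrow> y \<in> V \<Longrightarrow> q (\<lambda>i. x i + y i) \<le> q x + q y"
    and "x \<in> V \<Longrightarrow> (\<lambda>i. a * x i) \<in> V"
    and "x \<in> V \<Longrightarrow> q (\<lambda>i. a * x i) = norm a * q x"
  using assms by (auto simp: seminorm_on_def)

lemma seminorm_on_diff:
  assumes q: "seminorm_on V q" and x: "x \<in> V" and y: "y \<in> V"
  shows "(\<lambda>i. x i - y i) \<in> V" and "q x \<le> q y + q (\<lambda>i. x i - y i)"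
proof -
  have "(\<lambda>i. x i + - 1 * y i) \<in> V"
    by (intro seminorm_onD(1,3)[OF q] x y)
  then show d: "(\<lambda>i. x i - y i) \<in> V" by simp
  show "q x \<le> q y + q (\<lambda>i. x i - y i)"
    using seminorm_onD(2)[OF q y d] by simp
qed

lemma openin_seminorm_topology_single:
  "openin (seminorm_topology V {q}) U \<longleftrightarrow>
     U \<subseteq> V \<and> (\<forall>x\<in>U. \<exists>\<epsilon>>0. {y \<in> V. q (\<lambda>\<alpha>. y \<alpha> - x \<alpha>) < \<epsilon>} \<subseteq> U)"
  unfolding openin_seminorm_topology
proof (intro conj_cong ball_cong refl iffI)
  fix x assume "\<exists>Q \<epsilon>. finite Q \<and> Q \<subseteq> {q} \<and> 0 < \<epsilon> \<and> {y \<in> V. \<forall>q\<in>Q. q (\<lambda>\<alpha>. y \<alpha> - x \<alpha>) < \<epsilon>} \<subseteq> U"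
  then show "\<exists>\<epsilon>>0. {y \<in> V. q (\<lambda>\<alpha>. y \<alpha> - x \<alpha>) < \<epsilon>} \<subseteq> U" by blast
next
  fix x assume "\<exists>\<epsilon>>0. {y \<in> V. q (\<lambda>\<alpha>. y \<alpha> - x \<alpha>) < \<epsilon>} \<subseteq> U"
  then obtain \<epsilon> where "0 < \<epsilon>" "{y \<in> V. q (\<lambda>\<alpha>. y \<alpha> - x \<alpha>) < \<epsilon>} \<subseteq> U" by blast
  then show "\<exists>Q \<epsilon>. finite Q \<and> Q \<subseteq> {q} \<and> 0 < \<epsilon> \<and> {y \<in> V. \<forall>q\<in>Q. q (\<lambda>\<alpha>. y \<alpha> - x \<alpha>) < \<epsilon>} \<subseteq> U"
    by (intro exI[of _ "{q}"] exI[of _ \<epsilon>]) auto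
qed

lemma openin_seminorm_topologyE:
  assumes "openin (seminorm_topology V {q}) U" and "x \<in> U"
  obtains \<epsilon> where "0 < \<epsilon>" and "\<And>y. y \<in> V \<Longrightarrow> q (\<lambda>\<alpha>. y \<alpha> - x \<alpha>) < \<epsilon> \<Longrightarrow> y \<in> U"
proof -
  from assms have "\<exists>\<epsilon>>0. {y \<in> V. q (\<lambda>\<alpha>. y \<alpha> - x \<alpha>) < \<epsilon>} \<subseteq> U"
    by (simp add: openin_seminorm_topology_single)
  then show thesis using that by auto
qed

lemma openin_seminorm_ball:
  assumes q: "seminorm_on V q" and x: "x \<in> V"
  shows "openin (seminorm_topology V {q}) {y \<in> V. q (\<lambda>i. y i - x i) < \<epsilon>}"
  unfolding openin_seminorm_topology_single
proof (intro conjI ballI)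
  fix y assume "y \<in> {y \<in> V. q (\<lambda>i. y i - x i) < \<epsilon>}"
  then have y: "y \<in> V" "q (\<lambda>i. y i - x i) < \<epsilon>" by auto
  show "\<exists>\<delta>>0. {z \<in> V. q (\<lambda>i. z i - y i) < \<delta>} \<subseteq> {y \<in> V. q (\<lambda>i. y i - x i) < \<epsilon>}"
  proof (intro exI[of _ "\<epsilon> - q (\<lambda>i. y i - x i)"] conjI subsetI CollectI)
    fix z assume z: "z \<in> {z \<in> V. q (\<lambda>i. z i - y i) < \<epsilon> - q (\<lambda>i. y i - x i)}"
    then show "z \<in> V" by simp
    have "q (\<lambda>i. (z i - y i) + (y i - x i)) \<le> q (\<lambda>i. z i - y i) + q (\<lambda>i. y i - x i)"
      using z y x by (intro seminorm_onD(2)[OF q] seminorm_on_diff(1)[OF q]) auto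
    then show "q (\<lambda>i. z i - x i) < \<epsilon>" using z by simp
  qed (use y in simp)
qed auto

text \<open>\<open>ind_lim\<close> ranges over locally convex topologies; this supplies one for
  every seminorm.\<close>

lemma locally_convex_on_seminorm_topology:
  assumes q: "seminorm_on V q"
  shows "locally_convex_on V (seminorm_topology V {q})"
  unfolding locally_convex_on_def
proof (intro conjI allI impI)
  let ?Y = "seminorm_topology V {q}"
  let ?B = "\<lambda>x \<epsilon>. {y \<in> V. q (\<lambda>i. y i - x i) < \<epsilon>}"
  have zero: "q (\<lambda>_. 0) = 0" if "x \<in> V" for x
    using seminorm_onD(4)[OF q that, of 0] by simp
  \<comment> \<open>Nonnegativity comes from the triangle inequality: 0 = q(x - x) \<le> 2
    q(x).\<close>
  have nonneg: "0 \<le> q x" if "x \<in> V" for x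
    using seminorm_on_diff(2)[OF q that seminorm_onD(3)[OF q that, of 0]]
      seminorm_onD(2)[OF q that seminorm_onD(3)[OF q that, of "-1"]]
      seminorm_onD(4)[OF q that, of 0] seminorm_onD(4)[OF q that, of "-1"] by simp
  note ball = openin_seminorm_ball[OF q]

  show "topspace ?Y = V" by simp
  show "continuous_map (prod_topology ?Y ?Y) ?Y (\<lambda>(x, y). \<lambda>\<alpha>. x \<alpha> + y \<alpha>)"
    unfolding continuous_map_def
  proof (intro conjI allI impI)
    show "(\<lambda>(x, y). \<lambda>\<alpha>. x \<alpha> + y \<alpha>) \<in> topspace (prod_topology ?Y ?Y) \<rightarrow> topspace ?Y"
      by (auto intro: seminorm_onD[OF q])
    fix U assume U: "openin ?Y U"
    show "openin (prod_topology ?Y ?Y) {z \<in> topspace (prod_topology ?Y ?Y). (case z of (x, y) \<Rightarrow> \<lambda>\<alpha>. x \<alpha> + y \<alpha>) \<in> U}"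
      unfolding openin_prod_topology_alt
    proof (intro allI impI)
      fix x y assume "(x, y) \<in> {z \<in> topspace (prod_topology ?Y ?Y). (case z of (x, y) \<Rightarrow> \<lambda>\<alpha>. x \<alpha> + y \<alpha>) \<in> U}"
      then have x: "x \<in> V" and y: "y \<in> V" and "(\<lambda>\<alpha>. x \<alpha> + y \<alpha>) \<in> U" by auto
      from openin_seminorm_topologyE[OF U this(3)] obtain \<epsilon> where \<epsilon>: "0 < \<epsilon>"
        "\<And>z. z \<in> V \<Longrightarrow> q (\<lambda>\<alpha>. z \<alpha> - (x \<alpha> + y \<alpha>)) < \<epsilon> \<Longrightarrow> z \<in> U" by metis
      have "(\<lambda>\<alpha>. x' \<alpha> + y' \<alpha>) \<in> U" if "x' \<in> ?B x (\<epsilon> / 2)" "y' \<in> ?B y (\<epsilon> / 2)" for x' y'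
      proof -
        have "q (\<lambda>i. (x' i - x i) + (y' i - y i)) \<le> q (\<lambda>i. x' i - x i) + q (\<lambda>i. y' i - y i)"
          using that x y by (intro seminorm_onD(2)[OF q] seminorm_on_diff(1)[OF q]) auto
        then have "q (\<lambda>i. (x' i + y' i) - (x i + y i)) < \<epsilon>"
          using that by (simp add: algebra_simps)
        then show ?thesis using that by (intro \<epsilon>(2) seminorm_onD(1)[OF q]) auto
      qed
      then have sub: "?B x (\<epsilon> / 2) \<times> ?B y (\<epsilon> / 2) \<subseteq>
          {z \<in> topspace (prod_topology ?Y ?Y). (case z of (x, y) \<Rightarrow> \<lambda>\<alpha>. x \<alpha> + y \<alpha>) \<in> U}"
        by auto
      have mem: "x \<in> ?B x (\<epsilon> / 2)" "y \<in> ?B y (\<epsilon> / 2)"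
        using x y \<epsilon>(1) zero[OF x] by auto
      show "\<exists>A B. openin ?Y A \<and> openin ?Y B \<and> x \<in> A \<and> y \<in> B \<and> A \<times> B \<subseteq>
          {z \<in> topspace (prod_topology ?Y ?Y). (case z of (x, y) \<Rightarrow> \<lambda>\<alpha>. x \<alpha> + y \<alpha>) \<in> U}"
        by (rule exI[of _ "?B x (\<epsilon> / 2)"], rule exI[of _ "?B y (\<epsilon> / 2)"])
          (intro conjI ball[OF x] ball[OF y] mem sub)
    qed
  qed
  show "continuous_map (prod_topology (euclidean :: complex topology) ?Y) ?Y (\<lambda>(a, x). \<lambda>\<alpha>. a * x \<alpha>)"
    unfolding continuous_map_def
  proof (intro conjI allI impI)
    let ?P = "prod_topology (euclidean :: complex topology) ?Y"
    show "(\<lambda>(a, x). \<lambda>\<alpha>. a * x \<alpha>) \<in> topspace ?P \<rightarrow> topspace ?Y"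
      by (auto intro: seminorm_onD[OF q])
    fix U assume U: "openin ?Y U"
    show "openin ?P {z \<in> topspace ?P. (case z of (a, x) \<Rightarrow> \<lambda>\<alpha>. a * x \<alpha>) \<in> U}"
      unfolding openin_prod_topology_alt
    proof (intro allI impI)
      fix a x assume "(a, x) \<in> {z \<in> topspace ?P. (case z of (a, x) \<Rightarrow> \<lambda>\<alpha>. a * x \<alpha>) \<in> U}"
      then have x: "x \<in> V" and "(\<lambda>\<alpha>. a * x \<alpha>) \<in> U" by auto
      from openin_seminorm_topologyE[OF U this(2)] obtain \<epsilon> where \<epsilon>: "0 < \<epsilon>"
        "\<And>z. z \<in> V \<Longrightarrow> q (\<lambda>\<alpha>. z \<alpha> - a * x \<alpha>) < \<epsilon> \<Longrightarrow> z \<in> U" by metis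
      \<comment> \<open>Radii adapted to a'x' - ax = a'(x' - x) + (a' - a)x: since r \<le> 1 gives
        |a'| < |a| + 1, \<delta> makes the first term smaller than \<epsilon>/2, and r keeps the
        second at most \<epsilon>/2. Adding 1 to q(x) and to |a| avoids zero denominators.\<close>
      define r where "r = min 1 (\<epsilon> / (2 * (q x + 1)))"
      define \<delta> where "\<delta> = \<epsilon> / 2 / (norm a + 1)"
      have r: "0 < r" using \<epsilon>(1) nonneg[OF x] by (simp add: r_def)
      have \<delta>: "0 < \<delta>" using \<epsilon>(1) by (simp add: \<delta>_def add_nonneg_pos)
      have "(\<lambda>\<alpha>. a' * x' \<alpha>) \<in> U" if a': "a' \<in> ball a r" and x': "x' \<in> ?B x \<delta>" for a' x'
      proof -
        have d: "norm (a' - a) < r" using a' by (simp add: dist_norm norm_minus_commute)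
        have na: "norm a' < norm a + 1"
          using d norm_triangle_sub[of a' a] by (simp add: r_def)
        have D: "(\<lambda>i. x' i - x i) \<in> V" using x x' by (intro seminorm_on_diff(1)[OF q]) auto
        have "norm a' * q (\<lambda>i. x' i - x i) \<le> (norm a + 1) * q (\<lambda>i. x' i - x i)"
          using na nonneg[OF D] by (intro mult_right_mono) auto
        also have "\<dots> < (norm a + 1) * \<delta>"
          using x' by (intro mult_strict_left_mono) (auto simp: add_nonneg_pos)
        also have "\<dots> = \<epsilon> / 2"
        proof -
          have "norm a + 1 \<noteq> 0" using norm_ge_zero[of a] by linarith
          then show ?thesis unfolding \<delta>_def by (rule nonzero_mult_div_self)
        qed
        finally have 1: "norm a' * q (\<lambda>i. x' i - x i) < \<epsilon> / 2" .
        have "norm (a' - a) * q x \<le> \<epsilon> / (2 * (q x + 1)) * q x"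
          using d nonneg[OF x] by (intro mult_right_mono) (auto simp: r_def)
        also have "\<dots> \<le> \<epsilon> / 2"
          using nonneg[OF x] \<epsilon>(1) by (simp add: field_simps)
        finally have 2: "norm (a' - a) * q x \<le> \<epsilon> / 2" .
        have "q (\<lambda>i. a' * (x' i - x i) + (a' - a) * x i) \<le> q (\<lambda>i. a' * (x' i - x i)) + q (\<lambda>i. (a' - a) * x i)"
          by (intro seminorm_onD(2,3)[OF q] D x)
        also have "\<dots> < \<epsilon>"
          using 1 2 by (simp add: seminorm_onD(4)[OF q D] seminorm_onD(4)[OF q x])
        finally have "q (\<lambda>i. a' * x' i - a * x i) < \<epsilon>"
          by (simp only: right_diff_distrib left_diff_distrib) simp
        then show ?thesis using x' by (intro \<epsilon>(2) seminorm_onD(3)[OF q]) auto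
      qed
      then have sub: "ball a r \<times> ?B x \<delta> \<subseteq>
          {z \<in> topspace ?P. (case z of (a, x) \<Rightarrow> \<lambda>\<alpha>. a * x \<alpha>) \<in> U}"
        by auto
      have mem: "openin euclidean (ball a r)" "a \<in> ball a r" "x \<in> ?B x \<delta>"
        using x r \<delta> zero[OF x] by auto
      show "\<exists>A B. openin euclidean A \<and> openin ?Y B \<and> a \<in> A \<and> x \<in> B \<and> A \<times> B \<subseteq>
          {z \<in> topspace ?P. (case z of (a, x) \<Rightarrow> \<lambda>\<alpha>. a * x \<alpha>) \<in> U}"
        by (rule exI[of _ "ball a r"], rule exI[of _ "?B x \<delta>"])
          (intro conjI ball[OF x] mem sub)
    qed
  qed
  fix U assume "openin ?Y U \<and> (\<lambda>_. 0) \<in> U"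
  then have U: "openin ?Y U" and 0: "(\<lambda>_. 0) \<in> U" by auto
  from openin_seminorm_topologyE[OF this] obtain \<epsilon> where \<epsilon>: "0 < \<epsilon>"
    "\<And>z. z \<in> V \<Longrightarrow> q (\<lambda>\<alpha>. z \<alpha> - 0) < \<epsilon> \<Longrightarrow> z \<in> U" by metis
  have V0: "(\<lambda>_. 0) \<in> V" using U 0 openin_subset by fastforce
  show "\<exists>C. openin ?Y C \<and> (\<lambda>_. 0) \<in> C \<and> C \<subseteq> U \<and> (\<forall>x\<in>C. \<forall>y\<in>C. \<forall>t\<in>{0..1::real}.
      (\<lambda>\<alpha>. of_real (1 - t) * x \<alpha> + of_real t * y \<alpha>) \<in> C)"
  proof (intro exI[of _ "?B (\<lambda>_. 0) \<epsilon>"] conjI ballI)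
    show "openin ?Y (?B (\<lambda>_. 0) \<epsilon>)" by (rule ball[OF V0])
    show "(\<lambda>_. 0) \<in> ?B (\<lambda>_. 0) \<epsilon>" using V0 \<epsilon>(1) zero[OF V0] by simp
    show "?B (\<lambda>_. 0) \<epsilon> \<subseteq> U" using \<epsilon>(2) by auto
    fix x y and t :: real
    assume "x \<in> ?B (\<lambda>_. 0) \<epsilon>" "y \<in> ?B (\<lambda>_. 0) \<epsilon>" and t: "t \<in> {0..1}"
    then have x: "x \<in> V" "q x < \<epsilon>" and y: "y \<in> V" "q y < \<epsilon>" by auto
    have "q (\<lambda>\<alpha>. of_real (1 - t) * x \<alpha> + of_real t * y \<alpha>) \<le>
        q (\<lambda>\<alpha>. of_real (1 - t) * x \<alpha>) + q (\<lambda>\<alpha>. of_real t * y \<alpha>)"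
      by (intro seminorm_onD(2,3)[OF q] x y)
    also have "\<dots> = (1 - t) * q x + t * q y"
      using t by (simp only: seminorm_onD(4)[OF q x(1)] seminorm_onD(4)[OF q y(1)] norm_of_real) auto
    also have "\<dots> < \<epsilon>"
      using t x(2) y(2) by (intro convex_bound_lt) auto
    finally show "(\<lambda>\<alpha>. of_real (1 - t) * x \<alpha> + of_real t * y \<alpha>) \<in> ?B (\<lambda>_. 0) \<epsilon>"
      using seminorm_onD(1,3)[OF q] x y by simp
  qed
qed

section \<open>Maps between projective and inductive limits\<close>

text \<open>A seminorm bounded by a multiple of the norm of each step defines a locally convex
  topology for which all inclusions are continuous. It is one of the topologies whose supremum is
  \<open>ind_lim\<close>, so its balls are among the generating open sets. Closure under differences
  lets the bound act on y - x.\<close>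

lemma openin_ind_lim_seminorm_ball:
  assumes X: "\<And>k. k \<in> I \<Longrightarrow> X k = seminorm_topology (W k) {n k}"
    and diff: "\<And>k x y. k \<in> I \<Longrightarrow> x \<in> W k \<Longrightarrow> y \<in> W k \<Longrightarrow> (\<lambda>i. x i - y i) \<in> W k"
    and q: "seminorm_on (\<Union>k\<in>I. W k) q"
    and bound: "\<And>k. k \<in> I \<Longrightarrow> \<exists>C>0. \<forall>x\<in>W k. q x \<le> C * n k x"
    and zero: "(\<lambda>_. 0) \<in> (\<Union>k\<in>I. W k)"
  shows "openin (ind_lim I X) {y \<in> (\<Union>k\<in>I. W k). q y < \<epsilon>}"
proof -
  let ?V = "\<Union>k\<in>I. W k"
  let ?Y = "seminorm_topology ?V {q}"
  have V: "(\<Union>k\<in>I. topspace (X k)) = ?V"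
    by (rule SUP_cong[OF refl]) (simp add: X)
  have cont: "continuous_map (X k) ?Y (\<lambda>x. x)" if k: "k \<in> I" for k
    unfolding continuous_map_def
  proof (intro conjI allI impI)
    show "(\<lambda>x. x) \<in> topspace (X k) \<rightarrow> topspace ?Y" using k by (auto simp: X)
    fix U assume U: "openin ?Y U"
    obtain C where C: "0 < C" "\<And>x. x \<in> W k \<Longrightarrow> q x \<le> C * n k x"
      using bound[OF k] by blast
    show "openin (X k) {x \<in> topspace (X k). x \<in> U}"
      unfolding X[OF k] openin_seminorm_topology_single topspace_seminorm_topology
    proof (intro conjI ballI)
      fix x assume "x \<in> {x \<in> W k. x \<in> U}"
      then have x: "x \<in> W k" "x \<in> U" by auto
      from openin_seminorm_topologyE[OF U x(2)] obtain \<epsilon> where \<epsilon>: "0 < \<epsilon>"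
        "\<And>y. y \<in> ?V \<Longrightarrow> q (\<lambda>\<alpha>. y \<alpha> - x \<alpha>) < \<epsilon> \<Longrightarrow> y \<in> U" by metis
      show "\<exists>\<epsilon>>0. {y \<in> W k. n k (\<lambda>\<alpha>. y \<alpha> - x \<alpha>) < \<epsilon>} \<subseteq> {x \<in> W k. x \<in> U}"
      proof (intro exI[of _ "\<epsilon> / C"] conjI subsetI CollectI)
        fix y assume "y \<in> {y \<in> W k. n k (\<lambda>\<alpha>. y \<alpha> - x \<alpha>) < \<epsilon> / C}"
        then have y: "y \<in> W k" "n k (\<lambda>\<alpha>. y \<alpha> - x \<alpha>) < \<epsilon> / C" by auto
        show "y \<in> W k" by (rule y)
        have "q (\<lambda>\<alpha>. y \<alpha> - x \<alpha>) \<le> C * n k (\<lambda>\<alpha>. y \<alpha> - x \<alpha>)"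
          by (intro C(2) diff k y x)
        also have "\<dots> < C * (\<epsilon> / C)"
          using y(2) C(1) by (intro mult_strict_left_mono)
        finally show "y \<in> U" using y(1) k C(1) by (intro \<epsilon>(2)) auto
      qed (use \<epsilon>(1) C(1) in simp)
    qed auto
  qed
  have "openin ?Y {y \<in> ?V. q (\<lambda>i. y i - 0) < \<epsilon>}"
    by (rule openin_seminorm_ball[OF q zero])
  then show ?thesis
    unfolding ind_lim_def
    using locally_convex_on_seminorm_topology[OF q] cont
    by (intro topology_generated_by_Basis) (auto simp: V)
qed

text \<open>Every generator of \<open>ind_lim\<close> is open in a topology that already makes the
  inclusion continuous, so its preimage in the step is open. The assumption on
  \<open>topspace\<close> says that the generators cover the steps.\<close>

lemma continuous_map_into_ind_lim:
  assumes "topspace (ind_lim I X) = (\<Union>k\<in>I. topspace (X k))" and k: "k \<in> I"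
  shows "continuous_map (X k) (ind_lim I X) (\<lambda>x. x)"
proof -
  have "openin (X k) ((\<lambda>x. x) -` U \<inter> topspace (X k))"
    if "continuous_map (X k) Y (\<lambda>x. x)" "openin Y U" for Y U
    using openin_continuous_map_preimage[OF that] by (simp add: vimage_def Int_def conj_commute)
  then show ?thesis
    using assms unfolding ind_lim_def topology_generated_by_topspace
    by (intro continuous_on_generated_topo) auto
qed

lemma continuous_map_from_proj_lim:
  assumes k: "k \<in> I"
  shows "continuous_map (proj_lim I X) (X k) (\<lambda>x. x)"
  unfolding continuous_map_def
proof (intro conjI allI impI)
  have T: "topspace (proj_lim I X) = (\<Inter>k\<in>I. topspace (X k))"
    using k by (intro topspace_proj_lim) auto
  then show "(\<lambda>x. x) \<in> topspace (proj_lim I X) \<rightarrow> topspace (X k)" using k by auto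
  fix U assume U: "openin (X k) U"
  then have "{x \<in> topspace (proj_lim I X). x \<in> U} = U \<inter> (\<Inter>j\<in>I. topspace (X j))"
    using T by auto
  then show "openin (proj_lim I X) {x \<in> topspace (proj_lim I X). x \<in> U}"
    using U k unfolding proj_lim_def by (auto intro!: topology_generated_by_Basis)
qed

section \<open>Weighted steps and neighbourhoods of zero\<close>

lemma topspace_weighted_lp: "topspace (weighted_lp p \<theta>) = {c. (\<lambda>\<alpha>. c \<alpha> * of_real (\<theta> \<alpha>)) \<in> lp_space p}"
  by (simp add: weighted_lp_def)

lemma delta_in_weighted_lp: "1 \<le> p \<Longrightarrow> delta a t \<in> topspace (weighted_lp p \<theta>)"
  by (simp add: topspace_weighted_lp delta_mult delta_in_lp_space)

lemma zero_in_weighted_lp: "1 \<le> p \<Longrightarrow> (\<lambda>_. 0) \<in> topspace (weighted_lp p \<theta>)"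
  using delta_in_weighted_lp[of p _ 0 \<theta>] by (simp add: delta_def cong: if_cong)

lemma weighted_lp_scale:
  "x \<in> topspace (weighted_lp p \<theta>) \<Longrightarrow> (\<lambda>\<alpha>. c * x \<alpha>) \<in> topspace (weighted_lp p \<theta>)"
  using lp_space_scale[of "\<lambda>\<alpha>. x \<alpha> * of_real (\<theta> \<alpha>)" p c]
  by (simp add: topspace_weighted_lp mult.assoc)

lemma weighted_lp_add:
  assumes "1 \<le> p" "x \<in> topspace (weighted_lp p \<theta>)" "y \<in> topspace (weighted_lp p \<theta>)"
  shows "(\<lambda>\<alpha>. x \<alpha> + y \<alpha>) \<in> topspace (weighted_lp p \<theta>)"
  using assms lp_space_add[of p "\<lambda>\<alpha>. x \<alpha> * of_real (\<theta> \<alpha>)" "\<lambda>\<alpha>. y \<alpha> * of_real (\<theta> \<alpha>)"]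
  by (simp add: topspace_weighted_lp distrib_right)

lemma weighted_lp_antimono:
  assumes p: "1 \<le> p" and x: "x \<in> topspace (weighted_lp p \<theta>)"
    and le: "\<And>\<alpha>. 0 \<le> \<eta> \<alpha>" "\<And>\<alpha>. \<eta> \<alpha> \<le> \<theta> \<alpha>"
  shows "x \<in> topspace (weighted_lp p \<eta>)"
  unfolding topspace_weighted_lp mem_Collect_eq
proof (rule lp_space_mono[OF p])
  show "(\<lambda>\<alpha>. x \<alpha> * of_real (\<theta> \<alpha>)) \<in> lp_space p"
    using x by (simp add: topspace_weighted_lp)
qed (use le in \<open>auto simp: norm_mult intro!: mult_left_mono order_trans[OF le(2) abs_ge_self]\<close>)

lemma openin_weighted_lp_zero:
  assumes "openin (weighted_lp p \<theta>) U" and "(\<lambda>_. 0) \<in> U"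
  obtains \<epsilon> where "0 < \<epsilon>" and "\<And>x. x \<in> topspace (weighted_lp p \<theta>) \<Longrightarrow>
    lp_norm p (\<lambda>\<alpha>. x \<alpha> * of_real (\<theta> \<alpha>)) < \<epsilon> \<Longrightarrow> x \<in> U"
  using openin_seminorm_topologyE[OF assms[unfolded weighted_lp_def]]
  unfolding topspace_weighted_lp by (simp only: diff_zero) blast

text \<open>The uniform \<delta> expresses that the weighted supremum is strictly below 1. It leaves
  room 1 - \<delta>, which a perturbation of small l^p norm, a bound for every entry, cannot
  exhaust.\<close>

lemma openin_weighted_lp_sup_ball:
  assumes p: "1 \<le> p" and C: "0 \<le> C" and w: "\<And>\<alpha>. 0 \<le> w \<alpha>" "\<And>\<alpha>. w \<alpha> \<le> C * \<theta> \<alpha>"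
  shows "openin (weighted_lp p \<theta>)
    {y \<in> topspace (weighted_lp p \<theta>). \<exists>\<delta><1. \<forall>\<alpha>. norm (y \<alpha>) * w \<alpha> \<le> \<delta>}"
    (is "openin _ ?B")
proof -
  let ?V = "topspace (weighted_lp p \<theta>)"
  have "\<exists>\<epsilon>>0. {y \<in> ?V. lp_norm p (\<lambda>\<alpha>. (y \<alpha> - x \<alpha>) * of_real (\<theta> \<alpha>)) < \<epsilon>} \<subseteq> ?B"
    if x: "x \<in> ?B" for x
  proof -
    from x obtain \<delta> where \<delta>: "\<delta> < 1" "\<And>\<alpha>. norm (x \<alpha>) * w \<alpha> \<le> \<delta>" by blast
    \<comment> \<open>Half of the room 1 - \<delta> is spent on the perturbation; C + 1 in place of
      C allows C = 0.\<close>
    define \<epsilon> where "\<epsilon> = (1 - \<delta>) / 2 / (C + 1)"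
    have \<epsilon>: "0 < \<epsilon>" using \<delta>(1) C by (simp add: \<epsilon>_def)
    have "C * \<epsilon> \<le> (C + 1) * \<epsilon>" using \<epsilon> by (intro mult_right_mono) auto
    also have "\<dots> = (1 - \<delta>) / 2" unfolding \<epsilon>_def by (rule nonzero_mult_div_self) (use C in linarith)
    finally have C\<epsilon>: "C * \<epsilon> \<le> (1 - \<delta>) / 2" .
    have "\<forall>\<alpha>. norm (y \<alpha>) * w \<alpha> \<le> (1 + \<delta>) / 2"
      if y: "y \<in> ?V" "lp_norm p (\<lambda>\<alpha>. (y \<alpha> - x \<alpha>) * of_real (\<theta> \<alpha>)) < \<epsilon>" for y
    proof
      fix \<alpha>
      have "(\<lambda>\<alpha>. y \<alpha> + - 1 * x \<alpha>) \<in> ?V"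
        using x y by (intro weighted_lp_add[OF p] weighted_lp_scale) auto
      then have "(\<lambda>\<alpha>. (y \<alpha> - x \<alpha>) * of_real (\<theta> \<alpha>)) \<in> lp_space p"
        by (simp add: topspace_weighted_lp)
      from norm_le_lp_norm[OF p this, of \<alpha>] y(2)
      have *: "norm (y \<alpha> - x \<alpha>) * \<bar>\<theta> \<alpha>\<bar> \<le> \<epsilon>" by (simp add: norm_mult)
      have "norm (y \<alpha> - x \<alpha>) * w \<alpha> \<le> norm (y \<alpha> - x \<alpha>) * (C * \<bar>\<theta> \<alpha>\<bar>)"
        by (intro mult_left_mono order_trans[OF w(2) mult_left_mono[OF abs_ge_self C]]) simp
      also have "\<dots> \<le> C * \<epsilon>"
        using mult_left_mono[OF * C] by (simp add: ac_simps)
      finally have "norm (y \<alpha> - x \<alpha>) * w \<alpha> \<le> C * \<epsilon>" .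
      moreover have "norm (y \<alpha>) * w \<alpha> \<le> (norm (x \<alpha>) + norm (y \<alpha> - x \<alpha>)) * w \<alpha>"
        using w(1) norm_triangle_sub[of "y \<alpha>" "x \<alpha>"] by (intro mult_right_mono) auto
      ultimately show "norm (y \<alpha>) * w \<alpha> \<le> (1 + \<delta>) / 2"
        using \<delta>(2)[of \<alpha>] C\<epsilon> by (simp add: distrib_right)
    qed
    moreover have "(1 + \<delta>) / 2 < 1" using \<delta>(1) by simp
    ultimately show ?thesis using \<epsilon> by blast
  qed
  then show ?thesis
    unfolding weighted_lp_def openin_seminorm_topology_single topspace_seminorm_topology by blast
qed

text \<open>Induction over the generation of U: an intersection merges two finite families of steps
  and takes the smaller \<epsilon>, a union inherits from a member containing zero, a basic set
  involves one step. Guarding the claim by zero being in the set makes it hold for the empty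
  set.\<close>

lemma openin_proj_lim_zero:
  assumes "openin (proj_lim I (\<lambda>r. weighted_lp p (u r))) U" and "(\<lambda>_. 0) \<in> U"
  obtains R \<epsilon> where "finite R" "R \<subseteq> I" "0 < \<epsilon>"
    and "\<And>x. x \<in> (\<Inter>r\<in>I. topspace (weighted_lp p (u r))) \<Longrightarrow>
      (\<And>r. r \<in> R \<Longrightarrow> lp_norm p (\<lambda>\<alpha>. x \<alpha> * of_real (u r \<alpha>)) < \<epsilon>) \<Longrightarrow> x \<in> U"
proof -
  let ?V = "\<Inter>r\<in>I. topspace (weighted_lp p (u r))"
  let ?n = "\<lambda>r x. lp_norm p (\<lambda>\<alpha>. x \<alpha> * of_real (u r \<alpha>))"
  from assms(1) have "generate_topology_on
      {U \<inter> ?V |U k. k \<in> I \<and> openin (weighted_lp p (u k)) U} U"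
    unfolding proj_lim_def by (simp add: openin_topology_generated_by_iff)
  then have "(\<lambda>_. 0) \<in> U \<longrightarrow> (\<exists>R \<epsilon>. finite R \<and> R \<subseteq> I \<and> 0 < \<epsilon> \<and>
      (\<forall>x\<in>?V. (\<forall>r\<in>R. ?n r x < \<epsilon>) \<longrightarrow> x \<in> U))"
  proof induction
    case Empty
    then show ?case by simp
  next
    case (Int A B)
    show ?case
    proof
      assume 0: "(\<lambda>_. 0) \<in> A \<inter> B"
      with Int.IH(1) obtain R \<epsilon> where A: "finite R" "R \<subseteq> I" "0 < \<epsilon>"
          "\<forall>x\<in>?V. (\<forall>r\<in>R. ?n r x < \<epsilon>) \<longrightarrow> x \<in> A" by blast
      from 0 Int.IH(2) obtain R' \<epsilon>' where B: "finite R'" "R' \<subseteq> I" "0 < \<epsilon>'"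
          "\<forall>x\<in>?V. (\<forall>r\<in>R'. ?n r x < \<epsilon>') \<longrightarrow> x \<in> B" by blast
      show "\<exists>R \<epsilon>. finite R \<and> R \<subseteq> I \<and> 0 < \<epsilon> \<and>
          (\<forall>x\<in>?V. (\<forall>r\<in>R. ?n r x < \<epsilon>) \<longrightarrow> x \<in> A \<inter> B)"
        using A B by (intro exI[of _ "R \<union> R'"] exI[of _ "min \<epsilon> \<epsilon>'"]) auto
    qed
  next
    case (UN K)
    show ?case
    proof
      assume "(\<lambda>_. 0) \<in> \<Union>K"
      then obtain k where k: "k \<in> K" "(\<lambda>_. 0) \<in> k" by blast
      with UN.IH[OF k(1)] obtain R \<epsilon> where "finite R" "R \<subseteq> I" "0 < \<epsilon>"
          "\<forall>x\<in>?V. (\<forall>r\<in>R. ?n r x < \<epsilon>) \<longrightarrow> x \<in> k" by blast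
      with k show "\<exists>R \<epsilon>. finite R \<and> R \<subseteq> I \<and> 0 < \<epsilon> \<and>
          (\<forall>x\<in>?V. (\<forall>r\<in>R. ?n r x < \<epsilon>) \<longrightarrow> x \<in> \<Union>K)"
        by (intro exI[of _ R] exI[of _ \<epsilon>]) auto
    qed
  next
    case (Basis A)
    then obtain B k where B: "A = B \<inter> ?V" "k \<in> I" "openin (weighted_lp p (u k)) B" by blast
    show ?case
    proof
      assume 0: "(\<lambda>_. 0) \<in> A"
      then have "(\<lambda>_. 0) \<in> B" using B by blast
      from openin_weighted_lp_zero[OF B(3) this] obtain \<epsilon> where "0 < \<epsilon>"
        "\<And>x. x \<in> topspace (weighted_lp p (u k)) \<Longrightarrow> ?n k x < \<epsilon> \<Longrightarrow> x \<in> B" by metis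
      then show "\<exists>R \<epsilon>. finite R \<and> R \<subseteq> I \<and> 0 < \<epsilon> \<and> (\<forall>x\<in>?V. (\<forall>r\<in>R. ?n r x < \<epsilon>) \<longrightarrow> x \<in> A)"
        using B(1,2) by (intro exI[of _ "{k}"] exI[of _ \<epsilon>]) auto
    qed
  qed
  with assms(2) obtain R \<epsilon> where *: "finite R" "R \<subseteq> I" "0 < \<epsilon>"
    "\<forall>x\<in>?V. (\<forall>r\<in>R. ?n r x < \<epsilon>) \<longrightarrow> x \<in> U" by metis
  show thesis
    by (rule that[OF *(1-3)]) (use *(4) in simp)
qed

text \<open>A smaller weight gives a larger step, so \<open>dir\<close> provides a common step for
  two elements of the union, which is therefore closed under addition.\<close>

lemma topspace_weighted_ind_lim:
  assumes p: "1 \<le> p"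
    and u: "\<And>r a. r \<in> I \<Longrightarrow> 0 \<le> u r a"
    and dir: "\<And>r r'. r \<in> I \<Longrightarrow> r' \<in> I \<Longrightarrow> \<exists>R\<in>I. \<forall>a. u R a \<le> u r a \<and> u R a \<le> u r' a"
  shows "topspace (ind_lim I (\<lambda>r. weighted_lp p (u r))) = (\<Union>r\<in>I. topspace (weighted_lp p (u r)))"
proof (rule topspace_ind_lim)
  fix x y
  assume "x \<in> (\<Union>r\<in>I. topspace (weighted_lp p (u r)))" "y \<in> (\<Union>r\<in>I. topspace (weighted_lp p (u r)))"
  then obtain r r' where r: "r \<in> I" "x \<in> topspace (weighted_lp p (u r))"
    and r': "r' \<in> I" "y \<in> topspace (weighted_lp p (u r'))" by blast
  from dir[OF r(1) r'(1)] obtain R where R: "R \<in> I" "\<And>a. u R a \<le> u r a" "\<And>a. u R a \<le> u r' a"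
    by blast
  have "(\<lambda>\<alpha>. x \<alpha> + y \<alpha>) \<in> topspace (weighted_lp p (u R))"
    by (intro weighted_lp_add[OF p] weighted_lp_antimono[OF p r(2)] weighted_lp_antimono[OF p r'(2)] R u)
  then show "(\<lambda>\<alpha>. x \<alpha> + y \<alpha>) \<in> (\<Union>r\<in>I. topspace (weighted_lp p (u r)))" using R by blast
qed (auto intro: weighted_lp_scale)

section \<open>Coefficient bounds for maps between limits\<close>

lemma linear_continuous_delta:
  assumes S: "linear_continuous X Y S" and a: "delta a 1 \<in> topspace X" "delta a t \<in> topspace X"
  shows "S (delta a t) = (\<lambda>b. t * S (delta a 1) b)" and "S (\<lambda>_. 0) = (\<lambda>_. 0)"
proof -
  have lin: "S (\<lambda>\<alpha>. c * delta a 1 \<alpha> + d * delta a 1 \<alpha>) =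
      (\<lambda>\<alpha>. c * S (delta a 1) \<alpha> + d * S (delta a 1) \<alpha>)" for c d
    using S a(1) unfolding linear_continuous_def by blast
  have "(\<lambda>\<alpha>. t * delta a 1 \<alpha> + 0 * delta a 1 \<alpha>) = delta a t" by (auto simp: delta_def)
  then show "S (delta a t) = (\<lambda>b. t * S (delta a 1) b)" using lin[of t 0] by simp
  show "S (\<lambda>_. 0) = (\<lambda>_. 0)" using lin[of 0 0] by simp
qed

text \<open>Composed with the inclusions, S is continuous between two weighted steps. The preimage
  of a weighted supremum ball contains an \<epsilon>-ball around zero, and scaled unit sequences in
  it give the bound with C = 2/\<epsilon>.\<close>

lemma ind_proj_coefficient_bound:
  fixes u :: "real \<Rightarrow> 'i \<Rightarrow> real" and v :: "real \<Rightarrow> 'j \<Rightarrow> real"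
  assumes p: "1 \<le> p"
    and S: "linear_continuous (ind_lim {0<..} (\<lambda>r. weighted_lp p (u r)))
      (proj_lim {0<..} (\<lambda>r. weighted_lp p (v r))) S"
    and u: "\<And>r a. 0 < r \<Longrightarrow> 0 < u r a" and v: "\<And>r b. 0 < r \<Longrightarrow> 0 < v r b"
    and dir: "\<And>r r'. 0 < r \<Longrightarrow> 0 < r' \<Longrightarrow> \<exists>R>0. \<forall>a. u R a \<le> u r a \<and> u R a \<le> u r' a"
    and r: "0 < r" and r': "0 < r'"
  shows "\<exists>C>0. \<forall>a b. norm (S (delta a 1) b) * v r' b \<le> C * u r a"
proof -
  let ?X = "ind_lim {0<..} (\<lambda>r. weighted_lp p (u r))"
  let ?Y = "proj_lim {0<..} (\<lambda>r. weighted_lp p (v r))"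
  have top: "topspace ?X = (\<Union>r\<in>{0<..}. topspace (weighted_lp p (u r)))"
    by (rule topspace_weighted_ind_lim[OF p]) (use less_imp_le[OF u] dir in \<open>auto simp: Bex_def\<close>)
  have D: "delta a t \<in> topspace ?X" for a t
    using delta_in_weighted_lp[OF p, of a t "u r"] r unfolding top by blast
  note S_delta = linear_continuous_delta[OF S D D]
  define B where "B = {y \<in> topspace (weighted_lp p (v r')). \<exists>\<delta><1. \<forall>\<alpha>. norm (y \<alpha>) * v r' \<alpha> \<le> \<delta>}"
  have B: "openin (weighted_lp p (v r')) B"
    unfolding B_def using v[OF r'] by (intro openin_weighted_lp_sup_ball[OF p, of 1]) (auto simp: less_imp_le)
  have "continuous_map (weighted_lp p (u r)) (weighted_lp p (v r')) ((\<lambda>x. x) \<circ> (S \<circ> (\<lambda>x. x)))"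
  proof (intro continuous_map_compose)
    show "continuous_map (weighted_lp p (u r)) ?X (\<lambda>x. x)"
      using continuous_map_into_ind_lim[OF top] r by simp
    show "continuous_map ?X ?Y S" using S by (simp add: linear_continuous_def)
    show "continuous_map ?Y (weighted_lp p (v r')) (\<lambda>x. x)"
      using continuous_map_from_proj_lim[of r' "{0<..}"] r' by simp
  qed
  then have "continuous_map (weighted_lp p (u r)) (weighted_lp p (v r')) S" by (simp add: o_def)
  define P where "P = {x \<in> topspace (weighted_lp p (u r)). S x \<in> B}"
  have open_pre: "openin (weighted_lp p (u r)) P"
    unfolding P_def by (rule openin_continuous_map_preimage[OF \<open>continuous_map _ _ S\<close> B])
  have zero: "(\<lambda>_. 0) \<in> P"
    by (auto simp: P_def S_delta(2) B_def zero_in_weighted_lp[OF p] intro!: exI[of _ "0::real"])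
  from openin_weighted_lp_zero[OF open_pre zero] obtain \<epsilon> where \<epsilon>: "0 < \<epsilon>"
    "\<And>x. x \<in> topspace (weighted_lp p (u r)) \<Longrightarrow> lp_norm p (\<lambda>\<alpha>. x \<alpha> * of_real (u r \<alpha>)) < \<epsilon> \<Longrightarrow>
      x \<in> P" by metis
  show ?thesis
  proof (intro exI[of _ "2 / \<epsilon>"] conjI allI)
    fix a b
    \<comment> \<open>The multiple of the unit sequence at a whose weighted norm is
      \<epsilon>/2.\<close>
    define t where "t = \<epsilon> / 2 / u r a"
    have t: "0 < t" "t * u r a = \<epsilon> / 2" using \<epsilon>(1) u[OF r, of a] by (simp_all add: t_def)
    have "S (delta a (of_real t)) \<in> B"
    proof -
      have "lp_norm p (\<lambda>\<alpha>. delta a (of_real t) \<alpha> * of_real (u r \<alpha>)) = \<bar>t * u r a\<bar>"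
        by (simp add: delta_mult lp_norm_delta[OF p] norm_mult abs_mult)
      then have "lp_norm p (\<lambda>\<alpha>. delta a (of_real t) \<alpha> * of_real (u r \<alpha>)) < \<epsilon>"
        using t \<epsilon>(1) by simp
      from \<epsilon>(2)[OF delta_in_weighted_lp[OF p] this] show ?thesis by (simp add: P_def)
    qed
    then obtain \<delta> where "\<delta> < 1" "norm (S (delta a (of_real t)) b) * v r' b \<le> \<delta>"
      unfolding B_def by blast
    then have "t * (norm (S (delta a 1) b) * v r' b) \<le> 1"
      using t(1) by (simp add: S_delta(1)[of a "of_real t"] norm_mult mult.assoc)
    then have "norm (S (delta a 1) b) * v r' b \<le> 1 / t"
      using t(1) by (simp add: field_simps)
    also have "1 / t = 2 / \<epsilon> * u r a"
      using \<epsilon>(1) u[OF r, of a] by (simp add: t_def)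
    finally show "norm (S (delta a 1) b) * v r' b \<le> 2 / \<epsilon> * u r a" .
  qed (use \<epsilon>(1) in simp)
qed

definition weighted_sup :: "('i \<Rightarrow> real) \<Rightarrow> ('i \<Rightarrow> complex) \<Rightarrow> real" where
  "weighted_sup w y = (SUP b. norm (y b) * w b)"

lemma weighted_sup_upper:
  assumes "bdd_above (range (\<lambda>b. norm (y b) * w b))"
  shows "norm (y b) * w b \<le> weighted_sup w y"
  unfolding weighted_sup_def using assms by (intro cSUP_upper) auto

lemma seminorm_on_weighted_sup:
  assumes add: "\<And>x y. x \<in> V \<Longrightarrow> y \<in> V \<Longrightarrow> (\<lambda>i. x i + y i) \<in> V"
    and scale: "\<And>a x. x \<in> V \<Longrightarrow> (\<lambda>i. a * x i) \<in> V"
    and bdd: "\<And>y. y \<in> V \<Longrightarrow> bdd_above (range (\<lambda>b. norm (y b) * w b))"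
    and w: "\<And>b. 0 \<le> w b"
  shows "seminorm_on V (weighted_sup w)"
proof -
  have scale_le: "weighted_sup w (\<lambda>i. a * x i) \<le> norm a * weighted_sup w x" if x: "x \<in> V" for a x
    unfolding weighted_sup_def[of w "\<lambda>i. a * x i"]
    using mult_left_mono[OF weighted_sup_upper[OF bdd[OF x]] norm_ge_zero[of a]]
    by (intro cSUP_least) (simp_all add: norm_mult mult.assoc)
  show ?thesis
    unfolding seminorm_on_def
  proof (intro conjI ballI allI add scale)
    fix x y assume x: "x \<in> V" and y: "y \<in> V"
    show "weighted_sup w (\<lambda>i. x i + y i) \<le> weighted_sup w x + weighted_sup w y"
      unfolding weighted_sup_def[of w "\<lambda>i. x i + y i"]
    proof (rule cSUP_least)
      fix b
      have "norm (x b + y b) * w b \<le> (norm (x b) + norm (y b)) * w b"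
        by (intro mult_right_mono norm_triangle_ineq w)
      then show "norm (x b + y b) * w b \<le> weighted_sup w x + weighted_sup w y"
        using weighted_sup_upper[OF bdd[OF x], of b] weighted_sup_upper[OF bdd[OF y], of b]
        by (simp add: distrib_right)
    qed simp
  next
    fix a x assume x: "x \<in> V"
    show "weighted_sup w (\<lambda>i. a * x i) = norm a * weighted_sup w x"
    proof (cases "a = 0")
      case True
      then show ?thesis by (simp add: weighted_sup_def)
    next
      case False
      have "weighted_sup w (\<lambda>i. inverse a * (a * x i)) \<le> norm (inverse a) * weighted_sup w (\<lambda>i. a * x i)"
        by (intro scale_le scale x)
      then have "weighted_sup w x \<le> inverse (norm a) * weighted_sup w (\<lambda>i. a * x i)"
        using False by (simp add: norm_inverse mult.assoc[symmetric])
      then have "norm a * weighted_sup w x \<le> weighted_sup w (\<lambda>i. a * x i)"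
        using False by (simp add: field_simps)
      then show ?thesis using scale_le[OF x, of a] by simp
    qed
  qed
qed

text \<open>
  A Grothendieck-type factorization through single steps of both limits. If it failed for every
  \<open>\<rho> n\<close>, witnesses \<open>a n\<close>, \<open>b n\<close> would yield the weight \<open>w\<close>, the supremum of \<open>v (\<rho> n)\<close> over all \<open>n\<close>
  with \<open>b n = b\<close>. It is dominated by a multiple of each \<open>v r\<close>, so the corresponding weighted
  supremum is a continuous seminorm on the inductive limit, while it is unbounded on the image of
  the bounded sequence \<open>delta (a n) (1 / u (\<rho> n) (a n))\<close>.
\<close>

lemma proj_ind_coefficient_bound:
  fixes u :: "real \<Rightarrow> 'i \<Rightarrow> real" and v :: "real \<Rightarrow> 'j \<Rightarrow> real" and \<rho> :: "nat \<Rightarrow> real"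
  assumes p: "1 \<le> p"
    and S: "linear_continuous (proj_lim {0<..} (\<lambda>r. weighted_lp p (u r)))
      (ind_lim {0<..} (\<lambda>r. weighted_lp p (v r))) S"
    and u: "\<And>r a. 0 < r \<Longrightarrow> 0 < u r a" and v: "\<And>r b. 0 < r \<Longrightarrow> 0 < v r b"
    and dir: "\<And>r r'. 0 < r \<Longrightarrow> 0 < r' \<Longrightarrow> \<exists>R>0. \<forall>b. v R b \<le> v r b \<and> v R b \<le> v r' b"
    and \<rho>: "\<And>n. 0 < \<rho> n"
    and u\<rho>: "\<And>r. 0 < r \<Longrightarrow> \<exists>N. \<forall>n\<ge>N. \<forall>a. u r a \<le> u (\<rho> n) a"
    and v\<rho>: "\<And>r. 0 < r \<Longrightarrow> \<exists>N. \<forall>n\<ge>N. \<forall>b. v (\<rho> n) b \<le> v r b"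
  shows "\<exists>n. \<forall>a b. norm (S (delta a 1) b) * v (\<rho> n) b \<le> real n * u (\<rho> n) a"
proof (rule ccontr)
  let ?X = "proj_lim {0<..} (\<lambda>r. weighted_lp p (u r))"
  let ?Y = "ind_lim {0<..} (\<lambda>r. weighted_lp p (v r))"
  assume "\<nexists>n. \<forall>a b. norm (S (delta a 1) b) * v (\<rho> n) b \<le> real n * u (\<rho> n) a"
  then have "\<forall>n. \<exists>a b. real n * u (\<rho> n) a < norm (S (delta a 1) b) * v (\<rho> n) b"
    by (simp add: not_le)
  then obtain a b where ab: "\<And>n. real n * u (\<rho> n) (a n) < norm (S (delta (a n) 1) (b n)) * v (\<rho> n) (b n)"
    by metis

  have C: "\<exists>C>0. \<forall>n. v (\<rho> n) (b n) \<le> C * v r (b n)" if r: "0 < r" for r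
  proof -
    obtain N where N: "\<And>n b. N \<le> n \<Longrightarrow> v (\<rho> n) b \<le> v r b" using v\<rho>[OF r] by blast
    \<comment> \<open>The summand 1 serves all n \<ge> N; the finitely many earlier n are covered by
      their quotients at the points b n.\<close>
    let ?C = "1 + (\<Sum>n<N. v (\<rho> n) (b n) / v r (b n))"
    have nn: "0 \<le> v (\<rho> n) (b n) / v r (b n)" for n
      using v[OF \<rho>, of n "b n"] v[OF r, of "b n"] by simp
    have "v (\<rho> n) (b n) \<le> ?C * v r (b n)" for n
    proof (cases "n < N")
      case True
      then have "v (\<rho> n) (b n) / v r (b n) \<le> (\<Sum>n<N. v (\<rho> n) (b n) / v r (b n))"
        by (intro member_le_sum nn) auto
      then have "v (\<rho> n) (b n) / v r (b n) \<le> ?C" by simp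
      then show ?thesis using v[OF r, of "b n"] by (simp add: pos_divide_le_eq)
    next
      case False
      then have "v (\<rho> n) (b n) \<le> 1 * v r (b n)" using N by simp
      also have "\<dots> \<le> ?C * v r (b n)"
        using v[OF r, of "b n"] nn by (intro mult_right_mono) (auto intro!: sum_nonneg)
      finally show ?thesis .
    qed
    moreover have "0 < ?C" using nn by (intro add_pos_nonneg sum_nonneg) auto
    ultimately show ?thesis by blast
  qed
  \<comment> \<open>The inserted 0 is the value at those \<beta> that are no b n, where the supremum
    would be over the empty set. At the other \<beta> the set is bounded by the domination property
    for r = 1.\<close>
  define w where "w \<beta> = Sup (insert 0 {v (\<rho> n) \<beta> |n. b n = \<beta>})" for \<beta>
  have le_C: "s \<le> C * v r \<beta>"
    if "0 < r" "0 < C" "\<forall>n. v (\<rho> n) (b n) \<le> C * v r (b n)" "s \<in> insert 0 {v (\<rho> n) \<beta> |n. b n = \<beta>}"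
    for r C \<beta> s
    using that v[of r \<beta>] by auto
  have w_le: "w \<beta> \<le> C * v r \<beta>" if "0 < r" "0 < C" "\<forall>n. v (\<rho> n) (b n) \<le> C * v r (b n)" for r C \<beta>
    unfolding w_def by (rule cSup_least) (use le_C[OF that] in auto)
  obtain C1 where C1: "0 < C1" "\<forall>n. v (\<rho> n) (b n) \<le> C1 * v 1 (b n)" using C[of 1] by auto
  have bdd: "bdd_above (insert 0 {v (\<rho> n) \<beta> |n. b n = \<beta>})" for \<beta>
    using le_C[OF zero_less_one C1, where \<beta> = \<beta>] by (intro bdd_aboveI[of _ "C1 * v 1 \<beta>"]) auto
  have w0: "0 \<le> w \<beta>" for \<beta>
    unfolding w_def using bdd by (intro cSup_upper) auto
  have w_ge: "v (\<rho> n) (b n) \<le> w (b n)" for n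
    unfolding w_def using bdd by (intro cSup_upper) auto

  let ?V = "\<Union>r\<in>{0<..}. topspace (weighted_lp p (v r))"
  have top: "topspace ?Y = ?V"
    by (rule topspace_weighted_ind_lim[OF p]) (use less_imp_le[OF v] dir in \<open>auto simp: Bex_def\<close>)
  have bound: "norm (y \<beta>) * w \<beta> \<le> C * lp_norm p (\<lambda>\<alpha>. y \<alpha> * of_real (v r \<alpha>))"
    if r: "0 < r" and C: "0 < C" "\<forall>n. v (\<rho> n) (b n) \<le> C * v r (b n)"
      and y: "y \<in> topspace (weighted_lp p (v r))" for r C y \<beta>
  proof -
    have "norm (y \<beta>) * w \<beta> \<le> norm (y \<beta>) * (C * v r \<beta>)"
      by (intro mult_left_mono w_le r C) simp
    also have "\<dots> = C * norm (y \<beta> * of_real (v r \<beta>))"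
      using v[OF r, of \<beta>] by (simp add: norm_mult)
    also have "\<dots> \<le> C * lp_norm p (\<lambda>\<alpha>. y \<alpha> * of_real (v r \<alpha>))"
      using y C(1) by (intro mult_left_mono norm_le_lp_norm[OF p]) (auto simp: topspace_weighted_lp)
    finally show ?thesis .
  qed
  have bdd_V: "bdd_above (range (\<lambda>b. norm (y b) * w b))" if "y \<in> ?V" for y
  proof -
    from that obtain r where r: "0 < r" "y \<in> topspace (weighted_lp p (v r))" by auto
    from C[OF r(1)] obtain C where "0 < C" "\<forall>n. v (\<rho> n) (b n) \<le> C * v r (b n)" by blast
    from bound[OF r(1) this r(2)] show ?thesis
      by (intro bdd_aboveI[of _ "C * lp_norm p (\<lambda>\<alpha>. y \<alpha> * of_real (v r \<alpha>))"]) auto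
  qed
  have "seminorm_on ?V (weighted_sup w)"
  proof (rule seminorm_on_weighted_sup[OF _ _ bdd_V w0])
    fix x y assume "x \<in> ?V" "y \<in> ?V"
    then obtain r r' where r: "0 < r" "x \<in> topspace (weighted_lp p (v r))"
      and r': "0 < r'" "y \<in> topspace (weighted_lp p (v r'))" by auto
    from dir[OF r(1) r'(1)] obtain R where R: "0 < R" "\<And>b. v R b \<le> v r b" "\<And>b. v R b \<le> v r' b" by blast
    have "(\<lambda>i. x i + y i) \<in> topspace (weighted_lp p (v R))"
      by (intro weighted_lp_add[OF p] weighted_lp_antimono[OF p r(2)] weighted_lp_antimono[OF p r'(2)]
        R less_imp_le[OF v])
    then show "(\<lambda>i. x i + y i) \<in> ?V" using R(1) by auto
  qed (auto intro: weighted_lp_scale)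
  \<comment> \<open>Here the domination of w by every step weight enters: it bounds the seminorm on
    each step, with a constant that may depend on the step.\<close>
  have ball: "openin ?Y {y \<in> ?V. weighted_sup w y < 1}"
    unfolding topspace_weighted_lp
  proof (rule openin_ind_lim_seminorm_ball)
    show "weighted_lp p (v r) = seminorm_topology {c. (\<lambda>\<alpha>. c \<alpha> * of_real (v r \<alpha>)) \<in> lp_space p}
        {\<lambda>c. lp_norm p (\<lambda>\<alpha>. c \<alpha> * of_real (v r \<alpha>))}" for r
      by (rule weighted_lp_def)
    show "(\<lambda>i. x i - y i) \<in> {c. (\<lambda>\<alpha>. c \<alpha> * of_real (v r \<alpha>)) \<in> lp_space p}"
      if "x \<in> {c. (\<lambda>\<alpha>. c \<alpha> * of_real (v r \<alpha>)) \<in> lp_space p}"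
        "y \<in> {c. (\<lambda>\<alpha>. c \<alpha> * of_real (v r \<alpha>)) \<in> lp_space p}" for r x y
      using weighted_lp_add[OF p, of x "v r" "\<lambda>i. - 1 * y i"] weighted_lp_scale[of y p "v r" "- 1"] that
      by (simp add: topspace_weighted_lp)
    show "seminorm_on (\<Union>k\<in>{0<..}. {c. (\<lambda>\<alpha>. c \<alpha> * of_real (v k \<alpha>)) \<in> lp_space p}) (weighted_sup w)"
      using \<open>seminorm_on ?V (weighted_sup w)\<close> by (simp only: topspace_weighted_lp)
    show "(\<lambda>_. 0) \<in> (\<Union>k\<in>{0<..}. {c. (\<lambda>\<alpha>. c \<alpha> * of_real (v k \<alpha>)) \<in> lp_space p})"
      using delta_in_lp_space[OF p, of _ 0] by (auto simp: delta_def cong: if_cong intro: gt_ex)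
    fix r :: real assume "r \<in> {0<..}"
    then have r: "0 < r" by simp
    from C[OF r] obtain C where C: "0 < C" "\<forall>n. v (\<rho> n) (b n) \<le> C * v r (b n)" by blast
    have "weighted_sup w y \<le> C * lp_norm p (\<lambda>\<alpha>. y \<alpha> * of_real (v r \<alpha>))"
      if "y \<in> {c. (\<lambda>\<alpha>. c \<alpha> * of_real (v r \<alpha>)) \<in> lp_space p}" for y
      unfolding weighted_sup_def using bound[OF r C] that
      by (intro cSUP_least) (auto simp: topspace_weighted_lp)
    with C(1) show "\<exists>C>0. \<forall>x\<in>{c. (\<lambda>\<alpha>. c \<alpha> * of_real (v r \<alpha>)) \<in> lp_space p}.
        weighted_sup w x \<le> C * lp_norm p (\<lambda>\<alpha>. x \<alpha> * of_real (v r \<alpha>))" by blast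
  qed

  have topX: "topspace ?X = (\<Inter>r\<in>{0<..}. topspace (weighted_lp p (u r)))"
    by (rule topspace_proj_lim) (simp add: greaterThan_non_empty)
  have D: "delta \<alpha> t \<in> topspace ?X" for \<alpha> t
    by (simp add: topX delta_in_weighted_lp[OF p])
  note S_delta = linear_continuous_delta[OF S D D]
  define P where "P = {x \<in> topspace ?X. S x \<in> {y \<in> ?V. weighted_sup w y < 1}}"
  have "continuous_map ?X ?Y S" using S by (simp add: linear_continuous_def)
  then have P: "openin ?X P"
    unfolding P_def by (rule openin_continuous_map_preimage[OF _ ball])
  have z: "(\<lambda>_. 0) = delta (a 0) 0" "(\<lambda>_. 0) = delta (b 0) 0" by (auto simp: delta_def)
  have "(\<lambda>_. 0) \<in> topspace ?X" unfolding z(1) by (rule D)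
  moreover have "(\<lambda>_. 0) \<in> ?V"
    unfolding z(2) using delta_in_weighted_lp[OF p, of _ _ "v 1"] by (auto intro!: bexI[of _ 1])
  ultimately have "(\<lambda>_. 0) \<in> P"
    by (simp add: P_def S_delta(2) weighted_sup_def)
  from openin_proj_lim_zero[OF P this] obtain R \<epsilon> where R: "finite R" "R \<subseteq> {0<..}" and \<epsilon>: "0 < \<epsilon>"
    and RP: "\<And>x. x \<in> topspace ?X \<Longrightarrow>
      (\<And>r. r \<in> R \<Longrightarrow> lp_norm p (\<lambda>\<alpha>. x \<alpha> * of_real (u r \<alpha>)) < \<epsilon>) \<Longrightarrow> x \<in> P"
    unfolding topX by metis
  have "\<forall>r\<in>R. \<exists>N. \<forall>n\<ge>N. \<forall>a. u r a \<le> u (\<rho> n) a" using u\<rho> R(2) by auto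
  then obtain N where N: "\<And>r n a. r \<in> R \<Longrightarrow> N r \<le> n \<Longrightarrow> u r a \<le> u (\<rho> n) a" by metis
  \<comment> \<open>Large enough for \<open>u (\<rho> n)\<close> to dominate the finitely many
    weights of the neighbourhood, and at least 2/\<epsilon>, so that the factor n of the violated
    bound outweighs \<epsilon>/2.\<close>
  define n where "n = (\<Sum>r\<in>R. N r) + nat \<lceil>2 / \<epsilon>\<rceil>"
  have nN: "N r \<le> n" if "r \<in> R" for r
    using member_le_sum[OF that, of N] R(1) by (simp add: n_def)
  have "nat \<lceil>2 / \<epsilon>\<rceil> \<le> n" by (simp add: n_def)
  then have n\<epsilon>: "2 / \<epsilon> \<le> real n"
    using real_nat_ceiling_ge[of "2 / \<epsilon>"] by linarith
  \<comment> \<open>The norm with weight \<open>u (\<rho> n)\<close> becomes \<epsilon>/2, and those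
    with weight \<open>u r\<close> for r in R are no larger.\<close>
  define t where "t = \<epsilon> / 2 / u (\<rho> n) (a n)"
  have un: "0 < u (\<rho> n) (a n)" by (intro u \<rho>)
  have t: "0 < t" "t * u (\<rho> n) (a n) = \<epsilon> / 2" using \<epsilon> un by (simp_all add: t_def)
  have "delta (a n) (of_real t) \<in> P"
  proof (rule RP[OF D])
    fix r assume r: "r \<in> R"
    then have "0 < u r (a n)" using R(2) by (intro u) auto
    then have "lp_norm p (\<lambda>\<alpha>. delta (a n) (of_real t) \<alpha> * of_real (u r \<alpha>)) = t * u r (a n)"
      using t(1) by (simp add: delta_mult lp_norm_delta[OF p] norm_mult)
    also have "\<dots> \<le> t * u (\<rho> n) (a n)"
      using t(1) by (intro mult_left_mono N[OF r nN[OF r]]) simp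
    finally show "lp_norm p (\<lambda>\<alpha>. delta (a n) (of_real t) \<alpha> * of_real (u r \<alpha>)) < \<epsilon>"
      using t(2) \<epsilon> by simp
  qed
  then have y: "S (delta (a n) (of_real t)) \<in> ?V" "weighted_sup w (S (delta (a n) (of_real t))) < 1"
    by (auto simp: P_def)
  \<comment> \<open>The left side is n \<epsilon>/2 \<ge> 1, whereas the chain ends below 1.\<close>
  have "t * (real n * u (\<rho> n) (a n)) \<le> t * (norm (S (delta (a n) 1) (b n)) * v (\<rho> n) (b n))"
    using t(1) ab[of n] by (intro mult_left_mono) auto
  also have "\<dots> \<le> t * (norm (S (delta (a n) 1) (b n)) * w (b n))"
    using t(1) w_ge[of n] by (intro mult_left_mono) auto
  also have "\<dots> = norm (S (delta (a n) (of_real t)) (b n)) * w (b n)"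
    using t(1) by (simp add: S_delta(1)[of "a n" "of_real t"] norm_mult)
  also have "\<dots> \<le> weighted_sup w (S (delta (a n) (of_real t)))"
    by (intro weighted_sup_upper bdd_V y)
  also have "\<dots> < 1" by (rule y)
  finally have "real n * (t * u (\<rho> n) (a n)) < 1" by (simp add: ac_simps)
  moreover have "1 \<le> real n * (\<epsilon> / 2)"
    using n\<epsilon> \<epsilon> by (simp add: field_simps)
  ultimately show False using t(2) by simp
qed

section \<open>Finitely supported sequences and the weights\<close>

lemma lp_space_finite_support:
  assumes "1 \<le> p" and "finite {b. x b \<noteq> 0}"
  shows "x \<in> lp_space p"
proof (rule lp_space_summable[OF assms(1)])
  have "(\<lambda>b. norm (x b)) summable_on UNIV \<longleftrightarrow> (\<lambda>b. norm (x b)) summable_on {b. x b \<noteq> 0}"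
    by (rule summable_on_cong_neutral) auto
  then show "(\<lambda>b. norm (x b)) summable_on UNIV" using assms(2) by simp
qed simp

lemma finite_support_iff_mdeg:
  "finite {\<alpha> :: 'd::finite mindex. c \<alpha> \<noteq> 0} \<longleftrightarrow> (\<exists>N. \<forall>\<alpha>. N < mdeg \<alpha> \<longrightarrow> c \<alpha> = 0)"
proof
  assume fin: "finite {\<alpha>. c \<alpha> \<noteq> 0}"
  then have "mdeg \<alpha> \<le> (\<Sum>\<beta> | c \<beta> \<noteq> 0. mdeg \<beta>)" if "c \<alpha> \<noteq> 0" for \<alpha>
    using that by (intro member_le_sum) auto
  then show "\<exists>N. \<forall>\<alpha>. N < mdeg \<alpha> \<longrightarrow> c \<alpha> = 0" by (meson not_le)
next
  assume "\<exists>N. \<forall>\<alpha>. N < mdeg \<alpha> \<longrightarrow> c \<alpha> = 0"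
  then obtain N where "\<And>\<alpha>. N < mdeg \<alpha> \<Longrightarrow> c \<alpha> = 0" by blast
  then have "{\<alpha>. c \<alpha> \<noteq> 0} \<subseteq> {\<alpha>. mdeg \<alpha> \<le> N}" by (auto simp: not_less[symmetric])
  then show "finite {\<alpha>. c \<alpha> \<noteq> 0}" using finite_mdeg_le finite_subset by blast
qed

lemma topspace_ell_fin:
  "topspace (ell_fin p) = {c :: 'd::finite mindex \<Rightarrow> complex. finite {\<alpha>. c \<alpha> \<noteq> 0}}"
proof -
  let ?X = "\<lambda>N. seminorm_topology {c :: 'd mindex \<Rightarrow> complex. \<forall>\<alpha>. N < mdeg \<alpha> \<longrightarrow> c \<alpha> = 0} {lp_norm p}"
  have U: "(\<Union>N\<in>UNIV. topspace (?X N)) = {c. finite {\<alpha>. c \<alpha> \<noteq> 0}}"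
    by (auto simp: finite_support_iff_mdeg)
  have "topspace (ind_lim UNIV ?X) = (\<Union>N\<in>UNIV. topspace (?X N))"
  proof (rule topspace_ind_lim, unfold U mem_Collect_eq)
    fix x y :: "'d mindex \<Rightarrow> complex"
    assume "finite {\<alpha>. x \<alpha> \<noteq> 0}" "finite {\<alpha>. y \<alpha> \<noteq> 0}"
    then have "finite ({\<alpha>. x \<alpha> \<noteq> 0} \<union> {\<alpha>. y \<alpha> \<noteq> 0})" by simp
    then show "finite {\<alpha>. x \<alpha> + y \<alpha> \<noteq> 0}" by (rule rev_finite_subset) auto
  next
    fix a :: complex and x :: "'d mindex \<Rightarrow> complex" assume "finite {\<alpha>. x \<alpha> \<noteq> 0}"
    then show "finite {\<alpha>. a * x \<alpha> \<noteq> 0}" by (rule rev_finite_subset) auto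
  qed
  then show ?thesis unfolding U ell_fin_def .
qed

lemma openin_seminorm_topology_zero:
  assumes "openin (seminorm_topology V (range n)) U" and "(\<lambda>_. 0) \<in> U"
  obtains R \<epsilon> where "finite R" and "0 < \<epsilon>"
    and "\<And>x. x \<in> V \<Longrightarrow> \<forall>k\<in>R. n k x < \<epsilon> \<Longrightarrow> x \<in> U"
proof -
  from assms obtain Q \<epsilon> where Q: "finite Q" "Q \<subseteq> range n" and \<epsilon>: "0 < \<epsilon>"
    and QU: "{y \<in> V. \<forall>q\<in>Q. q (\<lambda>\<alpha>. y \<alpha> - 0) < \<epsilon>} \<subseteq> U"
    unfolding openin_seminorm_topology by fast
  from finite_subset_image[OF Q] obtain R where R: "finite R" "Q = n ` R" by blast
  show thesis
    by (rule that[OF R(1) \<epsilon>]) (use QU in \<open>auto simp: R(2)\<close>)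
qed

text \<open>
  The supremum norm is continuous on \<open>\<ell>\<^sub>0\<close>, and a neighbourhood of zero in \<open>\<ell>\<^sub>0'\<close> contains all
  sequences supported in large degrees.
\<close>

lemma all_fin_coefficients_vanish:
  fixes S :: "('d::finite mindex \<Rightarrow> complex) \<Rightarrow> ('e::finite mindex \<Rightarrow> complex)"
  assumes p: "1 \<le> p" and S: "linear_continuous (ell_all p) (ell_fin p) S"
  shows "\<exists>N. \<forall>a b. N < mdeg a + mdeg b \<longrightarrow> S (delta a 1) b = 0"
proof -
  let ?W = "\<lambda>N. {c :: 'e mindex \<Rightarrow> complex. \<forall>\<alpha>. N < mdeg \<alpha> \<longrightarrow> c \<alpha> = 0}"
  let ?q = "weighted_sup (\<lambda>_. 1) :: ('e mindex \<Rightarrow> complex) \<Rightarrow> real"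
  define V where "V = (\<Union>N. ?W N)"
  have V: "V = topspace (ell_fin p)"
    unfolding topspace_ell_fin V_def by (auto simp: finite_support_iff_mdeg)
  have lp: "c \<in> lp_space p" if "c \<in> V" for c
    using that unfolding V topspace_ell_fin by (auto intro: lp_space_finite_support[OF p])
  have le: "norm (c b) * 1 \<le> lp_norm p c" if "c \<in> V" for c b
    using norm_le_lp_norm[OF p lp[OF that]] by simp
  have bdd: "bdd_above (range (\<lambda>b. norm (c b) * 1))" if "c \<in> V" for c
    using le[OF that] by (intro bdd_aboveI[of _ "lp_norm p c"]) auto
  have add: "(\<lambda>i. x i + y i) \<in> V" if "x \<in> V" "y \<in> V" for x y
  proof -
    have "finite ({\<alpha>. x \<alpha> \<noteq> 0} \<union> {\<alpha>. y \<alpha> \<noteq> 0})"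
      using that unfolding V topspace_ell_fin by simp
    then show ?thesis
      unfolding V topspace_ell_fin mem_Collect_eq by (rule rev_finite_subset) auto
  qed
  have semi: "seminorm_on V ?q"
    by (rule seminorm_on_weighted_sup[OF add _ bdd]) (auto simp: V_def)
  have ball: "openin (ell_fin p) {y \<in> V. ?q y < 1}"
    unfolding ell_fin_def V_def
  proof (rule openin_ind_lim_seminorm_ball)
    show "seminorm_on (\<Union>N. ?W N) ?q" using semi by (simp only: V_def)
    fix N
    have "?q c \<le> 1 * lp_norm p c" if "c \<in> ?W N" for c
      unfolding weighted_sup_def using le[of c] that by (intro cSUP_least) (auto simp: V_def)
    then show "\<exists>C>0. \<forall>c\<in>?W N. ?q c \<le> C * lp_norm p c" by (intro exI[of _ 1]) auto
  qed auto
  define P where "P = {x \<in> topspace (ell_all p). S x \<in> {y \<in> V. ?q y < 1}}"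
  have "continuous_map (ell_all p) (ell_fin p) S" using S by (simp add: linear_continuous_def)
  then have P: "openin (ell_all p) P"
    unfolding P_def by (rule openin_continuous_map_preimage[OF _ ball])
  have D: "delta a t \<in> topspace (ell_all p :: ('d mindex \<Rightarrow> complex) topology)" for a t
    by (simp add: ell_all_def)
  note S_delta = linear_continuous_delta[OF S D D]
  let ?n = "\<lambda>N (c :: 'd mindex \<Rightarrow> complex). lp_norm p (\<lambda>\<alpha>. if mdeg \<alpha> \<le> N then c \<alpha> else 0)"
  have zero: "(\<lambda>_. 0) \<in> P"
    by (simp add: P_def S_delta(2) weighted_sup_def V_def ell_all_def)
  have P': "openin (seminorm_topology UNIV (range ?n)) P"
    using P by (simp add: ell_all_def full_SetCompr_eq)
  obtain R \<epsilon> where R: "finite R" and \<epsilon>: "0 < \<epsilon>"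
    and RP: "\<And>x. x \<in> UNIV \<Longrightarrow> \<forall>N\<in>R. ?n N x < \<epsilon> \<Longrightarrow> x \<in> P"
    by (rule openin_seminorm_topology_zero[OF P' zero]) (rule that)
  \<comment> \<open>The neighbourhood found in P only restricts entries of degree at most M, so a
    unit sequence of higher degree lies in P together with all its multiples.\<close>
  define M where "M = Max (insert 0 R)"
  have z: "lp_norm p (\<lambda>_ :: 'd mindex. 0 :: complex) = 0"
    using lp_norm_delta[OF p, of _ 0] by (simp add: delta_def cong: if_cong)
  have high: "S (delta a 1) b = 0" if a: "M < mdeg a" for a b
  proof (rule ccontr)
    assume ne: "S (delta a 1) b \<noteq> 0"
    \<comment> \<open>With this factor the entry at b of the image would be 1, against the supremum
      bound.\<close>
    define t where "t = 1 / S (delta a 1) b"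
    have "?n N (delta a t) = 0" if "N \<in> R" for N
    proof -
      have "N \<le> M" using that R by (simp add: M_def)
      then have "(\<lambda>\<alpha>. if mdeg \<alpha> \<le> N then delta a t \<alpha> else 0) = (\<lambda>_. 0)"
        using a by (intro ext) (auto simp: delta_def)
      then show ?thesis using z by simp
    qed
    then have "delta a t \<in> P" using \<epsilon> by (intro RP) simp_all
    then have "S (delta a t) \<in> V" "?q (S (delta a t)) < 1" by (auto simp: P_def)
    then have "norm (S (delta a t) b) < 1"
      using weighted_sup_upper[OF bdd, of "S (delta a t)" b] by simp
    then have "norm (t * S (delta a 1) b) < 1" by (simp only: S_delta(1)[of a t])
    then show False using ne by (simp add: t_def)
  qed
  have "S (delta a 1) \<in> topspace (ell_fin p)" for a
    using S D[of a 1] unfolding linear_continuous_def continuous_map_def by blast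
  then have "\<forall>a. \<exists>N. \<forall>b. N < mdeg b \<longrightarrow> S (delta a 1) b = 0"
    by (simp add: topspace_ell_fin finite_support_iff_mdeg)
  then obtain B where B: "\<And>a b. B a < mdeg b \<Longrightarrow> S (delta a 1) b = 0" by metis
  \<comment> \<open>Only finitely many a have degree at most M, and their images have finite
    support. If \<open>N < mdeg a + mdeg b\<close> and \<open>mdeg a \<le> M\<close>, then
    \<open>mdeg b\<close> exceeds the whole sum and with it \<open>B a\<close>.\<close>
  define N where "N = M + (\<Sum>a | mdeg a \<le> M. B a)"
  have "S (delta a 1) b = 0" if N: "N < mdeg a + mdeg b" for a b
  proof (cases "M < mdeg a")
    case True
    then show ?thesis by (rule high)
  next
    case False
    then have "B a \<le> (\<Sum>a | mdeg a \<le> M. B a)"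
      by (intro member_le_sum) (auto simp: finite_mdeg_le)
    then show ?thesis using N False by (intro B) (simp add: N_def)
  qed
  then show ?thesis by blast
qed

section \<open>Growth and tensor behaviour of the weights\<close>

lemma theta_pos: "0 < r \<Longrightarrow> 0 < theta r s \<alpha>"
  by (cases s) (simp_all add: less_imp_neq[OF mfact_pos, symmetric])

lemma theta_mono: "0 < r \<Longrightarrow> r \<le> r' \<Longrightarrow> theta r s \<alpha> \<le> theta r' s \<alpha>"
  by (cases s) (auto intro!: mult_right_mono power_mono)

text \<open>Every finite set of multi-indices lies in a box, over which the sum of products is a
  product of sums, each at most the total of g.\<close>

lemma summable_on_prod_coordinates:
  fixes g :: "nat \<Rightarrow> real"
  assumes g: "summable g" "\<And>n. 0 \<le> g n"
  shows "(\<lambda>\<alpha> :: 'd::finite mindex. \<Prod>i\<in>UNIV. g (\<alpha> i)) summable_on UNIV"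
proof (rule nonneg_bdd_above_summable_on)
  show "bdd_above (sum (\<lambda>\<alpha> :: 'd mindex. \<Prod>i\<in>UNIV. g (\<alpha> i)) ` {F. F \<subseteq> UNIV \<and> finite F})"
  proof (rule bdd_aboveI2)
    fix F :: "'d mindex set" assume "F \<in> {F. F \<subseteq> UNIV \<and> finite F}"
    then have F: "finite F" by simp
    let ?B = "\<lambda>i. (\<lambda>\<alpha>. \<alpha> i) ` F"
    have "(\<Sum>\<alpha>\<in>F. \<Prod>i\<in>UNIV. g (\<alpha> i)) \<le> (\<Sum>\<alpha>\<in>Pi\<^sub>E UNIV ?B. \<Prod>i\<in>UNIV. g (\<alpha> i))"
      using F g(2) by (intro sum_mono2 finite_PiE) (auto intro!: prod_nonneg)
    also have "\<dots> = (\<Prod>i\<in>UNIV. \<Sum>n\<in>?B i. g n)"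
      using F by (intro prod_sum_PiE[symmetric]) auto
    also have "\<dots> \<le> (\<Prod>i\<in>(UNIV :: 'd set). suminf g)"
      using F g by (intro prod_mono conjI sum_nonneg sum_le_suminf) auto
    finally show "(\<Sum>\<alpha>\<in>F. \<Prod>i\<in>UNIV. g (\<alpha> i)) \<le> (\<Prod>i\<in>(UNIV :: 'd set). suminf g)" .
  qed
qed (use g(2) in \<open>auto intro: prod_nonneg\<close>)

lemma summable_exp_neg_powr:
  fixes a c :: real
  assumes "0 < a" "0 < c"
  shows "summable (\<lambda>n. exp (- (c * real n powr a)))"
proof (rule summable_comparison_test_bigo)
  show "summable (\<lambda>n. norm (1 / real n ^ 2))"
    using inverse_power_summable[of 2, where 'a = real] by (simp add: field_simps)
  show "(\<lambda>n. exp (- (c * real n powr a))) \<in> O(\<lambda>n. 1 / real n ^ 2)"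
    using assms by real_asymp
qed

text \<open>For a flat index the factorials cancel and a product of geometric terms is left. For a
  real index the power of the degree is distributed over the coordinates.\<close>

lemma theta_ratio_summable:
  fixes s :: order_index
  assumes s: "s \<in> R_flat" and r: "0 < r" "r < r'"
  shows "(\<lambda>\<alpha> :: 'd::finite mindex. theta r s \<alpha> / theta r' s \<alpha>) summable_on UNIV"
proof (cases s)
  case (Flat \<sigma>)
  have "theta r s \<alpha> / theta r' s \<alpha> = (\<Prod>i\<in>UNIV. (r / r') ^ \<alpha> i)" for \<alpha> :: "'d mindex"
    using less_imp_neq[OF mfact_pos[of \<alpha>]]
    by (simp add: Flat mdeg_def power_sum power_divide prod_dividef)
  moreover have "(\<lambda>\<alpha> :: 'd mindex. \<Prod>i\<in>UNIV. (r / r') ^ \<alpha> i) summable_on UNIV"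
    using r by (intro summable_on_prod_coordinates summable_geometric) auto
  ultimately show ?thesis by simp
next
  case (Real t)
  with s have t: "0 < t" by (auto simp: R_flat_def)
  define a where "a = 1 / (2 * t)"
  \<comment> \<open>Each coordinate is at most the degree, so the power of the degree is at least
    the mean of the coordinate powers; the division by the dimension accounts for the mean.\<close>
  define c where "c = (r' - r) / CARD('d)"
  have a: "0 < a" and c: "0 < c" using t r by (simp_all add: a_def c_def)
  show ?thesis
  proof (rule summable_on_comparison_test)
    show "(\<lambda>\<alpha> :: 'd mindex. \<Prod>i\<in>UNIV. exp (- (c * real (\<alpha> i) powr a))) summable_on UNIV"
      by (intro summable_on_prod_coordinates summable_exp_neg_powr a c) simp
    fix \<alpha> :: "'d mindex"
    have "\<alpha> i \<le> mdeg \<alpha>" for i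
      unfolding mdeg_def by (rule member_le_sum) auto
    then have "(\<Sum>i\<in>UNIV. real (\<alpha> i) powr a) \<le> real CARD('d) * real (mdeg \<alpha>) powr a"
      using a by (intro sum_bounded_above powr_mono2) auto
    then have "c * (\<Sum>i\<in>UNIV. real (\<alpha> i) powr a) \<le> c * (real CARD('d) * real (mdeg \<alpha>) powr a)"
      using c by (intro mult_left_mono) auto
    also have "\<dots> = (r' - r) * real (mdeg \<alpha>) powr a"
      by (simp add: c_def)
    finally have "exp (- ((r' - r) * real (mdeg \<alpha>) powr a)) \<le> exp (\<Sum>i\<in>UNIV. - (c * real (\<alpha> i) powr a))"
      by (simp add: sum_negf sum_distrib_left)
    moreover have "theta r s \<alpha> / theta r' s \<alpha> = exp (- ((r' - r) * real (mdeg \<alpha>) powr a))"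
      by (simp add: Real a_def exp_diff[symmetric] algebra_simps)
    ultimately show "theta r s \<alpha> / theta r' s \<alpha> \<le> (\<Prod>i\<in>UNIV. exp (- (c * real (\<alpha> i) powr a)))"
      by (simp add: exp_sum)
  qed (intro divide_nonneg_nonneg less_imp_le[OF theta_pos], use r in auto)
qed

text \<open>Degrees add and factorials multiply along the sum type, so flat weights split exactly,
  with \<kappa> = 1. For real indices the power of a sum and the sum of the powers agree up to
  constants, which are absorbed into r.\<close>

lemma theta_tensor:
  assumes s: "s \<in> R_flat"
  obtains \<kappa> where "0 < \<kappa>"
    and "\<And>r \<gamma>. 0 < r \<Longrightarrow> theta r s (\<gamma> :: ('e::finite + 'd::finite) mindex) \<le>
      theta (\<kappa> * r) s (\<gamma> \<circ> Inl) * theta (\<kappa> * r) s (\<gamma> \<circ> Inr)"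
    and "\<And>r \<gamma>. 0 < r \<Longrightarrow> theta r s (\<gamma> \<circ> Inl) * theta r s (\<gamma> \<circ> Inr) \<le>
      theta (\<kappa> * r) s (\<gamma> :: ('e::finite + 'd::finite) mindex)"
proof (cases s)
  case (Flat \<sigma>)
  have "theta r s (\<gamma> :: ('e + 'd) mindex) = theta r s (\<gamma> \<circ> Inl) * theta r s (\<gamma> \<circ> Inr)" for r \<gamma>
    by (simp add: Flat mdeg_sum_index[of \<gamma>] mfact_sum_index[of \<gamma>] power_add powr_mult)
  then show thesis by (intro that[of 1]) simp_all
next
  case (Real t)
  with s have t: "0 < t" by (auto simp: R_flat_def)
  define a where "a = 1 / (2 * t)"
  have a: "0 < a" using t by (simp add: a_def)
  \<comment> \<open>The summand \<open>2 powr a\<close> pays for (x + y)^a \<le> 2^a max(x, y)^a,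
    and 2 for x^a + y^a \<le> 2 (x + y)^a.\<close>
  define \<kappa> where "\<kappa> = 2 powr a + 2"
  have \<kappa>: "2 \<le> \<kappa>" "2 powr a \<le> \<kappa>" by (simp_all add: \<kappa>_def)
  have 1: "(x + y) powr a \<le> \<kappa> * (x powr a + y powr a)" if "0 \<le> x" "0 \<le> y" for x y :: real
  proof -
    have "(x + y) powr a \<le> (2 * max x y) powr a"
      using that a by (intro powr_mono2) auto
    also have "\<dots> = 2 powr a * max x y powr a" by (rule powr_mult)
    also have "\<dots> \<le> \<kappa> * (x powr a + y powr a)"
      using \<kappa> by (intro mult_mono) (auto simp: max_def)
    finally show ?thesis .
  qed
  have 2: "x powr a + y powr a \<le> \<kappa> * (x + y) powr a" if "0 \<le> x" "0 \<le> y" for x y :: real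
  proof -
    have "x powr a + y powr a \<le> (x + y) powr a + (x + y) powr a"
      using that a by (intro add_mono powr_mono2) auto
    also have "\<dots> \<le> \<kappa> * (x + y) powr a"
      using mult_right_mono[OF \<kappa>(1), of "(x + y) powr a"] by simp
    finally show ?thesis .
  qed
  have th: "theta r s \<alpha> = exp (r * real (mdeg \<alpha>) powr a)" for r and \<alpha> :: "'f::finite mindex"
    by (simp add: Real a_def)
  show thesis
  proof (rule that[of \<kappa>])
    fix r and \<gamma> :: "('e + 'd) mindex" assume r: "0 < (r :: real)"
    show "theta r s \<gamma> \<le> theta (\<kappa> * r) s (\<gamma> \<circ> Inl) * theta (\<kappa> * r) s (\<gamma> \<circ> Inr)"
      using mult_left_mono[OF 1[of "real (mdeg (\<gamma> \<circ> Inl))" "real (mdeg (\<gamma> \<circ> Inr))"], of r] r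
      by (simp add: th mdeg_sum_index[of \<gamma>] exp_add[symmetric] algebra_simps)
    show "theta r s (\<gamma> \<circ> Inl) * theta r s (\<gamma> \<circ> Inr) \<le> theta (\<kappa> * r) s \<gamma>"
      using mult_left_mono[OF 2[of "real (mdeg (\<gamma> \<circ> Inl))" "real (mdeg (\<gamma> \<circ> Inr))"], of r] r
      by (simp add: th mdeg_sum_index[of \<gamma>] exp_add[symmetric] algebra_simps)
  qed (use \<kappa> in simp)
qed

text \<open>A further factor 2 in \<kappa> buys summability: after the product of weights is
  compared with a single weight, a quotient of two weights with parameters in the ratio 1 : 2
  remains.\<close>

lemma theta_tensor_summable:
  assumes s: "s \<in> R_flat"
  obtains \<kappa> where "0 < \<kappa>"
    and "\<And>r. 0 < r \<Longrightarrow> (\<lambda>\<gamma> :: ('e::finite + 'd::finite) mindex.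
      theta r s \<gamma> / (theta (\<kappa> * r) s (\<gamma> \<circ> Inl) * theta (\<kappa> * r) s (\<gamma> \<circ> Inr))) summable_on UNIV"
    and "\<And>r. 0 < r \<Longrightarrow> (\<lambda>\<gamma> :: ('e::finite + 'd::finite) mindex.
      theta r s (\<gamma> \<circ> Inl) * theta r s (\<gamma> \<circ> Inr) / theta (\<kappa> * r) s \<gamma>) summable_on UNIV"
proof -
  obtain \<kappa> where \<kappa>: "0 < \<kappa>"
    and 1: "\<And>r \<gamma>. 0 < r \<Longrightarrow> theta r s (\<gamma> :: ('e + 'd) mindex) \<le>
      theta (\<kappa> * r) s (\<gamma> \<circ> Inl) * theta (\<kappa> * r) s (\<gamma> \<circ> Inr)"
    and 2: "\<And>r \<gamma>. 0 < r \<Longrightarrow> theta r s (\<gamma> \<circ> Inl) * theta r s (\<gamma> \<circ> Inr) \<le>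
      theta (\<kappa> * r) s (\<gamma> :: ('e + 'd) mindex)"
    by (rule theta_tensor[OF s, where 'd = 'd and 'e = 'e]) (rule that)
  note nn = less_imp_le[OF theta_pos]
  show thesis
  proof (rule that[of "\<kappa> * 2"])
    fix r :: real assume r: "0 < r"
    have r2: "0 < \<kappa> * 2 * r" "0 < 2 * r" "0 < \<kappa> * r" using \<kappa> r by simp_all
    show "(\<lambda>\<gamma> :: ('e + 'd) mindex. theta r s \<gamma> /
        (theta (\<kappa> * 2 * r) s (\<gamma> \<circ> Inl) * theta (\<kappa> * 2 * r) s (\<gamma> \<circ> Inr))) summable_on UNIV"
    proof (rule summable_on_comparison_test)
      show "(\<lambda>\<gamma> :: ('e + 'd) mindex. theta r s \<gamma> / theta (2 * r) s \<gamma>) summable_on UNIV"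
        using r by (intro theta_ratio_summable s) auto
      fix \<gamma> :: "('e + 'd) mindex"
      show "theta r s \<gamma> / (theta (\<kappa> * 2 * r) s (\<gamma> \<circ> Inl) * theta (\<kappa> * 2 * r) s (\<gamma> \<circ> Inr)) \<le>
          theta r s \<gamma> / theta (2 * r) s \<gamma>"
        using 1[OF r2(2), of \<gamma>]
        by (intro divide_left_mono mult_pos_pos theta_pos nn r r2) (simp add: mult.assoc)
    qed (intro divide_nonneg_nonneg mult_nonneg_nonneg nn r r2)
    show "(\<lambda>\<gamma> :: ('e + 'd) mindex. theta r s (\<gamma> \<circ> Inl) * theta r s (\<gamma> \<circ> Inr) /
        theta (\<kappa> * 2 * r) s \<gamma>) summable_on UNIV"
    proof (rule summable_on_comparison_test)
      show "(\<lambda>\<gamma> :: ('e + 'd) mindex. theta (\<kappa> * r) s \<gamma> / theta (\<kappa> * 2 * r) s \<gamma>) summable_on UNIV"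
        using r \<kappa> by (intro theta_ratio_summable s) auto
      fix \<gamma> :: "('e + 'd) mindex"
      show "theta r s (\<gamma> \<circ> Inl) * theta r s (\<gamma> \<circ> Inr) / theta (\<kappa> * 2 * r) s \<gamma> \<le>
          theta (\<kappa> * r) s \<gamma> / theta (\<kappa> * 2 * r) s \<gamma>"
        by (intro divide_right_mono 2 nn r r2)
    qed (intro divide_nonneg_nonneg mult_nonneg_nonneg nn r r2)
  qed (use \<kappa> in simp)
qed

section \<open>Kernels\<close>

definition hseries :: "('d::finite mindex \<Rightarrow> complex) \<Rightarrow> 'd series" where
  "hseries c \<alpha> = c \<alpha> / of_real (sqrt (mfact \<alpha>))"

lemma hcoeff_hseries [simp]: "hcoeff (hseries c) = c"
  by (simp add: fun_eq_iff hcoeff_def hseries_def)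

lemma hseries_hcoeff [simp]: "hseries (hcoeff F) = F"
  by (simp add: fun_eq_iff hcoeff_def hseries_def)

lemma topspace_series_space [simp]: "F \<in> topspace (series_space X) \<longleftrightarrow> hcoeff F \<in> topspace X"
  by (simp add: series_space_def topspace_pullback_topology)

text \<open>\<open>hcoeff\<close> is continuous for the pullback topology, and so is
  \<open>hseries\<close>, because their composition is the identity on sequences. Both respect
  linear combinations.\<close>

lemma linear_continuous_coefficients:
  assumes "linear_continuous (series_space X) (series_space Y) S"
  shows "linear_continuous X Y (\<lambda>c. hcoeff (S (hseries c)))"
proof -
  have S: "continuous_map (series_space X) (series_space Y) S"
    and lin: "\<And>F G a b. F \<in> topspace (series_space X) \<Longrightarrow> G \<in> topspace (series_space X) \<Longrightarrow>
      S (\<lambda>\<alpha>. a * F \<alpha> + b * G \<alpha>) = (\<lambda>\<alpha>. a * S F \<alpha> + b * S G \<alpha>)"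
    using assms by (auto simp: linear_continuous_def)
  have "continuous_map X (series_space X) hseries"
    unfolding series_space_def by (rule continuous_map_pullback') (simp_all add: o_def)
  then have "continuous_map X (series_space Y) (S \<circ> hseries)"
    using S by (rule continuous_map_compose)
  moreover have "continuous_map (series_space Y) Y hcoeff"
    using continuous_map_pullback[OF continuous_map_id, of UNIV hcoeff Y] by (simp add: series_space_def)
  ultimately have "continuous_map X Y (hcoeff \<circ> (S \<circ> hseries))"
    by (rule continuous_map_compose)
  moreover have "hcoeff (S (hseries (\<lambda>\<alpha>. a * c \<alpha> + b * d \<alpha>))) =
      (\<lambda>\<alpha>. a * hcoeff (S (hseries c)) \<alpha> + b * hcoeff (S (hseries d)) \<alpha>)"
    if "c \<in> topspace X" "d \<in> topspace X" for a b c d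
  proof -
    have "hseries (\<lambda>\<alpha>. a * c \<alpha> + b * d \<alpha>) = (\<lambda>\<alpha>. a * hseries c \<alpha> + b * hseries d \<alpha>)"
      by (simp add: fun_eq_iff hseries_def add_divide_distrib)
    moreover have "S (\<lambda>\<alpha>. a * hseries c \<alpha> + b * hseries d \<alpha>) =
        (\<lambda>\<alpha>. a * S (hseries c) \<alpha> + b * S (hseries d) \<alpha>)"
      using that by (intro lin) simp_all
    ultimately show ?thesis
      by (simp only: hcoeff_def[abs_def]) (simp add: algebra_simps)
  qed
  ultimately show ?thesis by (simp add: linear_continuous_def o_def)
qed

lemma linear_continuous_finite_support:
  assumes S: "linear_continuous (ell_fin p) Y S" and B: "finite B"
  shows "S (\<lambda>b. \<Sum>a\<in>B. c a * delta a 1 b) = (\<lambda>b. \<Sum>a\<in>B. c a * S (delta a 1) b)"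
  using B
proof induction
  case empty
  have "delta (\<lambda>_. 0) 1 \<in> topspace (ell_fin p)"
    by (simp add: topspace_ell_fin delta_def)
  from linear_continuous_delta(2)[OF S this this] show ?case by simp
next
  case (insert a B)
  have "delta a 1 \<in> topspace (ell_fin p)" by (simp add: topspace_ell_fin delta_def)
  moreover have "(\<lambda>b. \<Sum>a\<in>B. c a * delta a 1 b) \<in> topspace (ell_fin p)"
  proof -
    have "{b. (\<Sum>a\<in>B. c a * delta a 1 b) \<noteq> 0} \<subseteq> B"
      by (auto simp: delta_def intro: sum.neutral)
    then show ?thesis using insert.hyps(1) by (auto simp: topspace_ell_fin intro: finite_subset)
  qed
  moreover have "S (\<lambda>\<alpha>. t * F \<alpha> + u * G \<alpha>) = (\<lambda>\<alpha>. t * S F \<alpha> + u * S G \<alpha>)"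
    if "F \<in> topspace (ell_fin p)" "G \<in> topspace (ell_fin p)" for F G t u
    using S that unfolding linear_continuous_def by blast
  ultimately have "S (\<lambda>b. c a * delta a 1 b + 1 * (\<Sum>a\<in>B. c a * delta a 1 b)) =
      (\<lambda>b. c a * S (delta a 1) b + 1 * S (\<lambda>b. \<Sum>a\<in>B. c a * delta a 1 b) b)"
    by blast
  then show ?case using insert by simp
qed

text \<open>The matrix of T with respect to the functions e_\<alpha>: the output index is the
  \<open>Inl\<close> part and the input index the \<open>Inr\<close> part, in the order of the
  variables of a kernel.\<close>

definition kernel_coeff :: "('d1::finite series \<Rightarrow> 'd2::finite series) \<Rightarrow> ('d2 + 'd1) mindex \<Rightarrow> complex" where
  "kernel_coeff T \<gamma> = hcoeff (T (hseries (delta (\<gamma> \<circ> Inr) 1))) (\<gamma> \<circ> Inl)"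

lemma topspace_A_fin: "F \<in> topspace (A_fin p) \<longleftrightarrow> finite {\<alpha>. hcoeff F \<alpha> \<noteq> 0}"
  by (simp add: A_def ell_def topspace_ell_fin)

lemma delta_support: "{b. delta a 1 b \<noteq> 0} = {a}"
  by (auto simp: delta_def)

text \<open>This turns existence and uniqueness of a kernel into a question about one sequence, the
  same for all spaces.\<close>

lemma has_kernel_iff:
  fixes T :: "'d1::finite series \<Rightarrow> 'd2::finite series"
  assumes T: "linear_continuous (A_fin p) (A_all p) T"
  shows "has_kernel p T K \<longleftrightarrow> hcoeff K = kernel_coeff T"
proof -
  have form: "A2_form (series_upto (T F)) (series_eval G) =
        (\<Sum>\<beta> | hcoeff G \<beta> \<noteq> 0. hcoeff (T F) \<beta> * cnj (hcoeff G \<beta>))"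
      "A2_form (kernel_upto K) (\<lambda>z. series_eval G (z \<circ> Inl) * cnj (series_eval F (z \<circ> Inr))) =
        (\<Sum>\<beta> | hcoeff G \<beta> \<noteq> 0. \<Sum>\<alpha> | hcoeff F \<alpha> \<noteq> 0.
          hcoeff K (case_sum \<beta> \<alpha>) * hcoeff F \<alpha> * cnj (hcoeff G \<beta>))"
    if "F \<in> topspace (A_fin p)" "G \<in> topspace (A_fin p)" for F :: "'d1 series" and G :: "'d2 series"
    using that A2_form_series[of G "T F"] A2_form_kernel[of F G K] by (simp_all only: topspace_A_fin)
  have case_sum_o: "case_sum (\<gamma> \<circ> Inl) (\<gamma> \<circ> Inr) = \<gamma>" for \<gamma> :: "('d2 + 'd1) mindex"
    by (auto simp: fun_eq_iff split: sum.split)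
  show ?thesis
  proof
    assume K: "has_kernel p T K"
    show "hcoeff K = kernel_coeff T"
    proof
      fix \<gamma> :: "('d2 + 'd1) mindex"
      let ?F = "hseries (delta (\<gamma> \<circ> Inr) 1)" and ?G = "hseries (delta (\<gamma> \<circ> Inl) 1)"
      have F: "?F \<in> topspace (A_fin p)" and G: "?G \<in> topspace (A_fin p)"
        by (simp_all add: topspace_A_fin delta_support)
      from K F G have "A2_form (series_upto (T ?F)) (series_eval ?G) =
          A2_form (kernel_upto K) (\<lambda>z. series_eval ?G (z \<circ> Inl) * cnj (series_eval ?F (z \<circ> Inr)))"
        unfolding has_kernel_def by blast
      then show "hcoeff K \<gamma> = kernel_coeff T \<gamma>"
        unfolding form[OF F G] by (simp add: delta_support kernel_coeff_def case_sum_o) (simp add: delta_def)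
    qed
  next
    assume K: "hcoeff K = kernel_coeff T"
    \<comment> \<open>Read as a map of coefficient sequences, T is determined on finitely supported
      ones by its values on unit sequences.\<close>
    have T': "linear_continuous (ell_fin p) (ell_all p) (\<lambda>c. hcoeff (T (hseries c)))"
      using linear_continuous_coefficients[of "ell p (Real 0)" "ell_dual p (Real 0)" T] T
      by (simp add: A_def A_dual_def ell_def ell_dual_def)
    have TF: "hcoeff (T F) = (\<lambda>\<beta>. \<Sum>\<alpha> | hcoeff F \<alpha> \<noteq> 0. hcoeff F \<alpha> * kernel_coeff T (case_sum \<beta> \<alpha>))"
      if F: "F \<in> topspace (A_fin p)" for F
    proof -
      have f: "finite {\<alpha>. hcoeff F \<alpha> \<noteq> 0}" using F by (simp add: topspace_A_fin)
      have "hcoeff F = (\<lambda>\<beta>. \<Sum>\<alpha> | hcoeff F \<alpha> \<noteq> 0. hcoeff F \<alpha> * delta \<alpha> 1 \<beta>)"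
      proof
        fix \<beta>
        have "(\<Sum>\<alpha> | hcoeff F \<alpha> \<noteq> 0. hcoeff F \<alpha> * delta \<alpha> 1 \<beta>) =
            (\<Sum>\<alpha> | hcoeff F \<alpha> \<noteq> 0. if \<alpha> = \<beta> then hcoeff F \<beta> else 0)"
          by (rule sum.cong) (auto simp: delta_def)
        then show "hcoeff F \<beta> = (\<Sum>\<alpha> | hcoeff F \<alpha> \<noteq> 0. hcoeff F \<alpha> * delta \<alpha> 1 \<beta>)"
          using f by simp
      qed
      then have "hcoeff (T F) = hcoeff (T (hseries (\<lambda>\<beta>. \<Sum>\<alpha> | hcoeff F \<alpha> \<noteq> 0. hcoeff F \<alpha> * delta \<alpha> 1 \<beta>)))"
        by (metis hseries_hcoeff)
      also have "\<dots> = (\<lambda>\<beta>. \<Sum>\<alpha> | hcoeff F \<alpha> \<noteq> 0. hcoeff F \<alpha> * hcoeff (T (hseries (delta \<alpha> 1))) \<beta>)"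
        by (rule linear_continuous_finite_support[OF T' f])
      finally show ?thesis by (simp add: kernel_coeff_def o_def)
    qed
    show "has_kernel p T K"
      unfolding has_kernel_def by (simp add: form TF K sum_distrib_left ac_simps)
  qed
qed

text \<open>As \<open>hcoeff\<close> is a bijection, the matrix of T belongs to exactly one series;
  what remains for each space is the membership of the matrix.\<close>

lemma ex1_kernel:
  assumes "linear_continuous (A_fin p) (A_all p) T" and "kernel_coeff T \<in> W"
  shows "\<exists>!K. K \<in> {K. hcoeff K \<in> W} \<and> has_kernel p T K"
  unfolding has_kernel_iff[OF assms(1)]
proof (rule ex1I[of _ "hseries (kernel_coeff T)"])
  show "K = hseries (kernel_coeff T)" if "K \<in> {K. hcoeff K \<in> W} \<and> hcoeff K = kernel_coeff T" for K
    using that by (metis hseries_hcoeff)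
qed (use assms(2) in simp)

text \<open>The series e_\<alpha> are finitely supported, so an extension agrees with T on them and
  has the same matrix. Bounds for the extension become bounds for
  \<open>kernel_coeff T\<close>.\<close>

lemma extends_to_coefficients:
  fixes T :: "'d1::finite series \<Rightarrow> 'd2::finite series"
  assumes "extends_to p T (series_space X) (series_space Y)"
  obtains S where "linear_continuous X Y S"
    and "\<And>\<gamma>. kernel_coeff T \<gamma> = S (delta (\<gamma> \<circ> Inr) 1) (\<gamma> \<circ> Inl)"
proof -
  from assms obtain S where S: "linear_continuous (series_space X) (series_space Y) S"
    and eq: "\<And>F. F \<in> topspace (A_fin p) \<Longrightarrow> S F = T F"
    unfolding extends_to_def by blast
  have "hseries (delta a 1) \<in> topspace (A_fin p)" for a :: "'d1 mindex"
    by (simp add: A_def ell_def topspace_ell_fin delta_def)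
  then show thesis
    by (intro that[OF linear_continuous_coefficients[OF S]]) (simp add: kernel_coeff_def eq)
qed

lemma weighted_lp_bound:
  assumes p: "1 \<le> p" and h: "h summable_on UNIV" and le: "\<And>\<gamma>. norm (c \<gamma>) * \<theta> \<gamma> \<le> C * h \<gamma>"
    and \<theta>: "\<And>\<gamma>. 0 \<le> \<theta> \<gamma>"
  shows "c \<in> topspace (weighted_lp p \<theta>)"
  unfolding topspace_weighted_lp mem_Collect_eq
  by (rule lp_space_summable[OF p summable_on_cmult_right[OF h, of C]])
    (use le \<theta> in \<open>simp add: norm_mult\<close>)

section \<open>Directedness and carriers of the weighted sequence spaces\<close>

lemma inverse_theta_antimono:
  "0 < r \<Longrightarrow> r \<le> r' \<Longrightarrow> 1 / theta r' s \<alpha> \<le> 1 / theta r s \<alpha>"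
  by (intro divide_left_mono theta_mono mult_pos_pos theta_pos) auto

lemma theta_directed:
  assumes "0 < r" and "0 < r'"
  shows "\<exists>R>0. \<forall>a. theta R s a \<le> theta r s a \<and> theta R s a \<le> theta r' s a"
  using assms by (intro exI[of _ "min r r'"]) (auto intro!: theta_mono)

lemma inverse_theta_directed:
  assumes "0 < r" and "0 < r'"
  shows "\<exists>R>0. \<forall>a. 1 / theta R s a \<le> 1 / theta r s a \<and> 1 / theta R s a \<le> 1 / theta r' s a"
  using assms by (intro exI[of _ "max r r'"]) (auto intro!: inverse_theta_antimono simp del: theta.simps)

lemma topspace_ell:
  assumes "1 \<le> p" and "s \<in> R_flat"
  shows "topspace (ell p s) = (\<Union>r\<in>{0<..}. topspace (weighted_lp p (theta r s)))"
proof -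
  have "topspace (ind_lim {0<..} (\<lambda>r. weighted_lp p (theta r s))) =
      (\<Union>r\<in>{0<..}. topspace (weighted_lp p (theta r s)))"
    by (rule topspace_weighted_ind_lim[OF assms(1)])
      (use theta_directed less_imp_le[OF theta_pos] in \<open>auto simp: Bex_def\<close>)
  then show ?thesis using assms(2) by (auto simp: ell_def R_flat_def)
qed

lemma topspace_ell0_dual:
  assumes "1 \<le> p"
  shows "topspace (ell0_dual p s) = (\<Union>r\<in>{0<..}. topspace (weighted_lp p (\<lambda>\<alpha>. 1 / theta r s \<alpha>)))"
  unfolding ell0_dual_def
  by (rule topspace_weighted_ind_lim[OF assms])
    (use inverse_theta_directed less_imp_le[OF theta_pos] in \<open>auto simp: Bex_def\<close>)

lemma topspace_ell0: "topspace (ell0 p s) = (\<Inter>r\<in>{0<..}. topspace (weighted_lp p (theta r s)))"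
  unfolding ell0_def by (rule topspace_proj_lim) (simp add: greaterThan_non_empty)

lemma topspace_ell_dual:
  assumes "s \<in> R_flat"
  shows "topspace (ell_dual p s) = (\<Inter>r\<in>{0<..}. topspace (weighted_lp p (\<lambda>\<alpha>. 1 / theta r s \<alpha>)))"
proof -
  have "topspace (proj_lim {0<..} (\<lambda>r. weighted_lp p (\<lambda>\<alpha>. 1 / theta r s \<alpha>))) =
      (\<Inter>r\<in>{0<..}. topspace (weighted_lp p (\<lambda>\<alpha>. 1 / theta r s \<alpha>)))"
    by (rule topspace_proj_lim) (simp add: greaterThan_non_empty)
  then show ?thesis using assms by (auto simp: ell_dual_def R_flat_def)
qed

section \<open>Membership of the matrix for positive and flat indices\<close>

context
  fixes p :: ennreal and T :: "'d1::finite series \<Rightarrow> 'd2::finite series" and s :: order_index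
  assumes p: "1 \<le> p" and s: "s \<in> R_flat"
begin

text \<open>Projective to inductive, governed by small r: as r decreases, the source norms with
  weight 1/theta grow and the target steps with weight theta get larger. Hence \<rho> tends to
  0.\<close>

lemma kernel_coeff_ell:
  assumes "extends_to p T (A_dual p s) (A p s)"
  shows "kernel_coeff T \<in> topspace (ell p s)"
proof -
  obtain S where S: "linear_continuous (ell_dual p s) (ell p s) S"
    and c: "\<And>\<gamma>. kernel_coeff T \<gamma> = S (delta (\<gamma> \<circ> Inr) 1) (\<gamma> \<circ> Inl)"
    using assms unfolding A_dual_def A_def by (rule extends_to_coefficients) (rule that)
  let ?\<rho> = "\<lambda>n. 1 / real (Suc n)"
  have small: "\<exists>N. \<forall>n\<ge>N. ?\<rho> n \<le> r" if r: "0 < r" for r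
  proof -
    from reals_Archimedean[OF r] obtain N where N: "?\<rho> N < r" by (auto simp: inverse_eq_divide)
    have "?\<rho> n \<le> ?\<rho> N" if "N \<le> n" for n using that by (intro divide_left_mono) auto
    then show ?thesis using N by (meson less_imp_le order_trans)
  qed
  have "\<exists>n. \<forall>a b. norm (S (delta a 1) b) * theta (?\<rho> n) s b \<le> real n * (1 / theta (?\<rho> n) s a)"
  proof (rule proj_ind_coefficient_bound[OF p])
    show "linear_continuous (proj_lim {0<..} (\<lambda>r. weighted_lp p (\<lambda>\<alpha>. 1 / theta r s \<alpha>)))
        (ind_lim {0<..} (\<lambda>r. weighted_lp p (theta r s))) S"
      using S s by (auto simp: ell_def ell_dual_def R_flat_def)
    show "\<exists>N. \<forall>n\<ge>N. \<forall>a. 1 / theta r s a \<le> 1 / theta (?\<rho> n) s a" if "0 < r"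
      for r and a :: "'d1 mindex"
      using small[OF that] by (meson inverse_theta_antimono of_nat_0_less_iff zero_less_Suc zero_less_divide_1_iff)
    show "\<exists>N. \<forall>n\<ge>N. \<forall>b. theta (?\<rho> n) s b \<le> theta r s b" if "0 < r" for r
      using small[OF that] by (meson theta_mono of_nat_0_less_iff zero_less_Suc zero_less_divide_1_iff)
  qed (use theta_pos theta_directed in auto)
  then obtain n where n: "\<And>a b. norm (S (delta a 1) b) * theta (?\<rho> n) s b \<le> real n * (1 / theta (?\<rho> n) s a)"
    by blast
  obtain \<kappa> where \<kappa>: "0 < \<kappa>"
    and sum: "\<And>r. 0 < r \<Longrightarrow> (\<lambda>\<gamma> :: ('d2 + 'd1) mindex.
      theta r s \<gamma> / (theta (\<kappa> * r) s (\<gamma> \<circ> Inl) * theta (\<kappa> * r) s (\<gamma> \<circ> Inr))) summable_on UNIV"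
    by (rule theta_tensor_summable[OF s, where 'd = 'd1 and 'e = 'd2]) (rule that)
  \<comment> \<open>The dilation by \<kappa> in the summability statement then lands on the step
    found above.\<close>
  define R where "R = ?\<rho> n / \<kappa>"
  have R: "0 < R" "\<kappa> * R = ?\<rho> n" using \<kappa> by (simp_all add: R_def)
  have "kernel_coeff T \<in> topspace (weighted_lp p (theta R s))"
  proof (rule weighted_lp_bound[OF p sum[OF R(1)]])
    fix \<gamma> :: "('d2 + 'd1) mindex"
    have pos: "0 < theta (?\<rho> n) s (\<gamma> \<circ> Inl)" by (intro theta_pos) simp
    have "norm (kernel_coeff T \<gamma>) \<le> real n * (1 / theta (?\<rho> n) s (\<gamma> \<circ> Inr)) / theta (?\<rho> n) s (\<gamma> \<circ> Inl)"
      unfolding c using n pos by (simp only: pos_le_divide_eq)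
    then have "norm (kernel_coeff T \<gamma>) * theta R s \<gamma> \<le>
        real n * (1 / theta (?\<rho> n) s (\<gamma> \<circ> Inr)) / theta (?\<rho> n) s (\<gamma> \<circ> Inl) * theta R s \<gamma>"
      by (intro mult_right_mono less_imp_le[OF theta_pos] R)
    then show "norm (kernel_coeff T \<gamma>) * theta R s \<gamma> \<le> real n *
        (theta R s \<gamma> / (theta (\<kappa> * R) s (\<gamma> \<circ> Inl) * theta (\<kappa> * R) s (\<gamma> \<circ> Inr)))"
      unfolding R(2) by (simp add: ac_simps)
  qed (intro less_imp_le[OF theta_pos] R)
  then show ?thesis using R(1) unfolding topspace_ell[OF p s] by blast
qed

text \<open>Inductive to projective: the bound is available for all steps, so R is prescribed by the
  target and r = R/\<kappa> is adapted to it.\<close>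

lemma kernel_coeff_ell_dual:
  assumes "extends_to p T (A p s) (A_dual p s)"
  shows "kernel_coeff T \<in> topspace (ell_dual p s)"
proof -
  obtain S where S: "linear_continuous (ell p s) (ell_dual p s) S"
    and c: "\<And>\<gamma>. kernel_coeff T \<gamma> = S (delta (\<gamma> \<circ> Inr) 1) (\<gamma> \<circ> Inl)"
    using assms unfolding A_dual_def A_def by (rule extends_to_coefficients) (rule that)
  have S': "linear_continuous (ind_lim {0<..} (\<lambda>r. weighted_lp p (theta r s)))
      (proj_lim {0<..} (\<lambda>r. weighted_lp p (\<lambda>\<alpha>. 1 / theta r s \<alpha>))) S"
    using S s by (auto simp: ell_def ell_dual_def R_flat_def)
  obtain \<kappa> where \<kappa>: "0 < \<kappa>"
    and sum: "\<And>r. 0 < r \<Longrightarrow> (\<lambda>\<gamma> :: ('d2 + 'd1) mindex.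
      theta r s (\<gamma> \<circ> Inl) * theta r s (\<gamma> \<circ> Inr) / theta (\<kappa> * r) s \<gamma>) summable_on UNIV"
    by (rule theta_tensor_summable[OF s, where 'd = 'd1 and 'e = 'd2]) (rule that)
  have "kernel_coeff T \<in> topspace (weighted_lp p (\<lambda>\<alpha>. 1 / theta R s \<alpha>))" if R: "0 < R" for R
  proof -
    define r where "r = R / \<kappa>"
    have r: "0 < r" "\<kappa> * r = R" using \<kappa> R by (simp_all add: r_def)
    have "\<exists>C>0. \<forall>a b. norm (S (delta a 1) b) * (1 / theta r s b) \<le> C * theta r s a"
      by (rule ind_proj_coefficient_bound[OF p S' _ _ _ r(1) r(1)]) (use theta_pos theta_directed in auto)
    then obtain C where C: "\<And>a b. norm (S (delta a 1) b) * (1 / theta r s b) \<le> C * theta r s a"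
      by blast
    show ?thesis
    proof (rule weighted_lp_bound[OF p sum[OF r(1)]])
      fix \<gamma> :: "('d2 + 'd1) mindex"
      have "norm (kernel_coeff T \<gamma>) \<le> C * theta r s (\<gamma> \<circ> Inr) * theta r s (\<gamma> \<circ> Inl)"
        using C[of "\<gamma> \<circ> Inr" "\<gamma> \<circ> Inl"] theta_pos[OF r(1), of s "\<gamma> \<circ> Inl"]
        unfolding c by (simp add: pos_divide_le_eq)
      then have "norm (kernel_coeff T \<gamma>) * (1 / theta R s \<gamma>) \<le>
          C * theta r s (\<gamma> \<circ> Inr) * theta r s (\<gamma> \<circ> Inl) * (1 / theta R s \<gamma>)"
        using theta_pos[OF R, of s \<gamma>] by (intro mult_right_mono) auto
      then show "norm (kernel_coeff T \<gamma>) * (1 / theta R s \<gamma>) \<le>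
          C * (theta r s (\<gamma> \<circ> Inl) * theta r s (\<gamma> \<circ> Inr) / theta (\<kappa> * r) s \<gamma>)"
        unfolding r(2) by (simp add: ac_simps)
    qed (use theta_pos[OF R, of s] less_imp_le in auto)
  qed
  then show ?thesis unfolding topspace_ell_dual[OF s] by blast
qed

text \<open>All steps are available again, but the weight of the kernel now stands in the numerator,
  so r = \<kappa> R is dilated upwards to gain summability.\<close>

lemma kernel_coeff_ell0:
  assumes "extends_to p T (A0_dual p s) (A0 p s)"
  shows "kernel_coeff T \<in> topspace (ell0 p s)"
proof -
  obtain S where S: "linear_continuous (ell0_dual p s) (ell0 p s) S"
    and c: "\<And>\<gamma>. kernel_coeff T \<gamma> = S (delta (\<gamma> \<circ> Inr) 1) (\<gamma> \<circ> Inl)"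
    using assms unfolding A0_dual_def A0_def by (rule extends_to_coefficients) (rule that)
  obtain \<kappa> where \<kappa>: "0 < \<kappa>"
    and sum: "\<And>r. 0 < r \<Longrightarrow> (\<lambda>\<gamma> :: ('d2 + 'd1) mindex.
      theta r s \<gamma> / (theta (\<kappa> * r) s (\<gamma> \<circ> Inl) * theta (\<kappa> * r) s (\<gamma> \<circ> Inr))) summable_on UNIV"
    by (rule theta_tensor_summable[OF s, where 'd = 'd1 and 'e = 'd2]) (rule that)
  have "kernel_coeff T \<in> topspace (weighted_lp p (theta R s))" if R: "0 < R" for R
  proof -
    define r where "r = \<kappa> * R"
    have r: "0 < r" using \<kappa> R by (simp add: r_def)
    have "\<exists>C>0. \<forall>a b. norm (S (delta a 1) b) * theta r s b \<le> C * (1 / theta r s a)"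
      by (rule ind_proj_coefficient_bound[OF p S[unfolded ell0_def ell0_dual_def] _ _ _ r r])
        (use theta_pos inverse_theta_directed in auto)
    then obtain C where C: "\<And>a b. norm (S (delta a 1) b) * theta r s b \<le> C * (1 / theta r s a)"
      by blast
    show ?thesis
    proof (rule weighted_lp_bound[OF p sum[OF R]])
      fix \<gamma> :: "('d2 + 'd1) mindex"
      have "norm (kernel_coeff T \<gamma>) \<le> C * (1 / theta r s (\<gamma> \<circ> Inr)) / theta r s (\<gamma> \<circ> Inl)"
          unfolding c using C[of "\<gamma> \<circ> Inr" "\<gamma> \<circ> Inl"] theta_pos[OF r, of s "\<gamma> \<circ> Inl"]
        by (simp only: pos_le_divide_eq)
      then have "norm (kernel_coeff T \<gamma>) * theta R s \<gamma> \<le>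
          C * (1 / theta r s (\<gamma> \<circ> Inr)) / theta r s (\<gamma> \<circ> Inl) * theta R s \<gamma>"
        by (intro mult_right_mono less_imp_le[OF theta_pos] R)
      then show "norm (kernel_coeff T \<gamma>) * theta R s \<gamma> \<le>
          C * (theta R s \<gamma> / (theta (\<kappa> * R) s (\<gamma> \<circ> Inl) * theta (\<kappa> * R) s (\<gamma> \<circ> Inr)))"
        unfolding r_def[symmetric] by (simp add: ac_simps)
    qed (intro less_imp_le[OF theta_pos] R)
  qed
  then show ?thesis unfolding topspace_ell0 by blast
qed

text \<open>Mirror image of the case of \<open>ell\<close>: source norms and target steps grow as r
  tends to infinity, whence \<rho> n = n + 1, the shift keeping \<rho> 0 positive.\<close>

lemma kernel_coeff_ell0_dual:
  assumes "extends_to p T (A0 p s) (A0_dual p s)"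
  shows "kernel_coeff T \<in> topspace (ell0_dual p s)"
proof -
  obtain S where S: "linear_continuous (ell0 p s) (ell0_dual p s) S"
    and c: "\<And>\<gamma>. kernel_coeff T \<gamma> = S (delta (\<gamma> \<circ> Inr) 1) (\<gamma> \<circ> Inl)"
    using assms unfolding A0_dual_def A0_def by (rule extends_to_coefficients) (rule that)
  let ?\<rho> = "\<lambda>n. real (Suc n)"
  have large: "\<exists>N. \<forall>n\<ge>N. r \<le> ?\<rho> n" for r
  proof -
    from real_arch_simple[of r] obtain N where "r \<le> real N" by blast
    then show ?thesis by (intro exI[of _ N]) auto
  qed
  have "\<exists>n. \<forall>a b. norm (S (delta a 1) b) * (1 / theta (?\<rho> n) s b) \<le> real n * theta (?\<rho> n) s a"
  proof (rule proj_ind_coefficient_bound[OF p S[unfolded ell0_def ell0_dual_def]])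
    show "\<exists>N. \<forall>n\<ge>N. \<forall>a. theta r s a \<le> theta (?\<rho> n) s a" if "0 < r"
      for r and a :: "'d1 mindex"
      using large[of r] theta_mono[OF that] by blast
    show "\<exists>N. \<forall>n\<ge>N. \<forall>b. 1 / theta (?\<rho> n) s b \<le> 1 / theta r s b" if "0 < r" for r
      using large[of r] inverse_theta_antimono[OF that] by blast
  qed (use theta_pos inverse_theta_directed in auto)
  then obtain n where n: "\<And>a b. norm (S (delta a 1) b) * (1 / theta (?\<rho> n) s b) \<le> real n * theta (?\<rho> n) s a"
    by blast
  obtain \<kappa> where \<kappa>: "0 < \<kappa>"
    and sum: "\<And>r. 0 < r \<Longrightarrow> (\<lambda>\<gamma> :: ('d2 + 'd1) mindex.
      theta r s (\<gamma> \<circ> Inl) * theta r s (\<gamma> \<circ> Inr) / theta (\<kappa> * r) s \<gamma>) summable_on UNIV"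
    by (rule theta_tensor_summable[OF s, where 'd = 'd1 and 'e = 'd2]) (rule that)
  define r where "r = ?\<rho> n"
  have r: "0 < r" "0 < \<kappa> * r" using \<kappa> by (simp_all add: r_def)
  have "kernel_coeff T \<in> topspace (weighted_lp p (\<lambda>\<alpha>. 1 / theta (\<kappa> * r) s \<alpha>))"
  proof (rule weighted_lp_bound[OF p sum[OF r(1)]])
    fix \<gamma> :: "('d2 + 'd1) mindex"
    have "norm (kernel_coeff T \<gamma>) \<le> real n * theta r s (\<gamma> \<circ> Inr) * theta r s (\<gamma> \<circ> Inl)"
      using n[of "\<gamma> \<circ> Inr" "\<gamma> \<circ> Inl"] theta_pos[OF r(1), of s "\<gamma> \<circ> Inl"]
      unfolding c r_def[symmetric] by (simp add: pos_divide_le_eq)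
    then have "norm (kernel_coeff T \<gamma>) * (1 / theta (\<kappa> * r) s \<gamma>) \<le>
        real n * theta r s (\<gamma> \<circ> Inr) * theta r s (\<gamma> \<circ> Inl) * (1 / theta (\<kappa> * r) s \<gamma>)"
      using theta_pos[OF r(2), of s \<gamma>] by (intro mult_right_mono) auto
    then show "norm (kernel_coeff T \<gamma>) * (1 / theta (\<kappa> * r) s \<gamma>) \<le>
        real n * (theta r s (\<gamma> \<circ> Inl) * theta r s (\<gamma> \<circ> Inr) / theta (\<kappa> * r) s \<gamma>)"
      by (simp add: ac_simps)
  qed (use theta_pos[OF r(2), of s] less_imp_le in auto)
  then show ?thesis using r(2) unfolding topspace_ell0_dual[OF p] by blast
qed

end

text \<open>Degrees add when \<gamma> is split, so matrix entries that vanish for large total degree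
  form a finitely supported sequence.\<close>

lemma kernel_coeff_ell_fin:
  fixes T :: "'d1::finite series \<Rightarrow> 'd2::finite series"
  assumes p: "1 \<le> p" and T: "extends_to p T (A_all p) (A_fin p)"
  shows "kernel_coeff T \<in> topspace (ell p (Real 0))"
proof -
  obtain S where S: "linear_continuous (ell_dual p (Real 0)) (ell p (Real 0)) S"
    and c: "\<And>\<gamma>. kernel_coeff T \<gamma> = S (delta (\<gamma> \<circ> Inr) 1) (\<gamma> \<circ> Inl)"
    using T unfolding A_dual_def A_def by (rule extends_to_coefficients) (rule that)
  have "linear_continuous (ell_all p) (ell_fin p) S" using S by (simp add: ell_def ell_dual_def)
  from all_fin_coefficients_vanish[OF p this] obtain N
    where "\<And>a b. N < mdeg a + mdeg b \<Longrightarrow> S (delta a 1) b = 0" by blast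
  then have "kernel_coeff T \<gamma> = 0" if "N < mdeg \<gamma>" for \<gamma>
    using that by (simp add: c mdeg_sum_index[of \<gamma>] add.commute)
  then show ?thesis
    by (auto simp: ell_def topspace_ell_fin finite_support_iff_mdeg)
qed

theorem proposition3p2:
  fixes p :: ennreal
    and T :: "'d1::finite series \<Rightarrow> 'd2::finite series"
  assumes "1 \<le> p"
    and "linear_continuous (A_fin p) (A_all p) T"
  shows "(\<forall>s\<in>R_flat_bar.
      (extends_to p T (A_dual p s) (A p s) \<longrightarrow> (\<exists>!K. K \<in> A_kernel p s \<and> has_kernel p T K)) \<and>
      (extends_to p T (A p s) (A_dual p s) \<longrightarrow> (\<exists>!K. K \<in> A_dual_kernel p s \<and> has_kernel p T K))) \<and>
    (\<forall>s\<in>R_flat.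
      (extends_to p T (A0_dual p s) (A0 p s) \<longrightarrow> (\<exists>!K. K \<in> A0_kernel p s \<and> has_kernel p T K)) \<and>
      (extends_to p T (A0 p s) (A0_dual p s) \<longrightarrow> (\<exists>!K. K \<in> A0_dual_kernel p s \<and> has_kernel p T K)))"
proof -
  \<comment> \<open>For s = 0 the dual space contains every sequence, so (2) asks for no estimate
    there.\<close>
  have "kernel_coeff T \<in> topspace (ell_dual p (Real 0))"
    by (simp add: ell_dual_def ell_all_def)
  then show ?thesis
    unfolding A_kernel_def A_dual_kernel_def A0_kernel_def A0_dual_kernel_def
    using assms(1) kernel_coeff_ell_fin[OF assms(1), of T]
    by (auto simp: R_flat_bar_def intro!: ex1_kernel[OF assms(2)]
        intro: kernel_coeff_ell kernel_coeff_ell_dual kernel_coeff_ell0 kernel_coeff_ell0_dual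
        simp del: mem_Collect_eq)
qed

end
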